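(* Let $1<p<N$ and $0\le\mu<\left(\frac{N-p}{p}\right)^p$. Let $\Omega$ be an exterior domain in $\mathbb{R}^N$ such that $\Omega^c=\mathbb{R}^N\setminus\Omega$ is bounded, and let $f\in L^{\frac Np}(\Omega)$ be a nonnegative function. If $u\in\mathcal{D}^{1,p}(\Omega)$ is a nonnegative weak supersolution of $$-\Delta_p u-\frac{\mu}{|x|^p}|u|^{p-2}u=f|u|^{p-2}u\quad\text{in }\Omega,$$ then $$u(x)\ge Cm|x|^{-\gamma_2}\quad\text{for } x\in\Omega,$$ where $m=\inf_{\partial\Omega}u$ and $C=\inf_{\partial\Omega}|x|^{\gamma_2}$.
   Context: $\Delta_p u=\sum_{i=1}^N\partial_{x_i}(|\nabla u|^{p-2}\partial_{x_i}u)$ is the $p$-Laplacian and $p^*=\frac{Np}{N-p}$. $\mathcal{D}^{1,p}(\Omega)=\{v\in L^{p^*}(\Omega): v\text{ is weakly differentiable and }\nabla v\in L^p(\Omega)\}$, equipped with the seminorm $\|\nabla v\|_{L^p(\Omega)}$. A function $u\in\mathcal{D}^{1,p}(\Omega)$ is a weak subsolution of the equation in $\Omega$ if for all nonnegative $\varphi\in C_0^\infty(\Omega)$, $$\int_{\Omega}\Big(|\nabla u|^{p-2}\nabla u\cdot\nabla\varphi-\frac{\mu}{|x|^p}|u|^{p-2}u\varphi\Big)\le\int_{\Omega}f|u|^{p-2}u\varphi ,$$ and $u$ is a weak supersolution if $-u$ is a weak subsolution. $\gamma_1,\gamma_2\in[0,\infty)$, $\gamma_1<\gamma_2$, are the two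 roots of $\gamma^{p-2}[(p-1)\gamma^2-(N-p)\gamma]+\mu=0$. They satisfy $0\le\gamma_1<\frac{N-p}{p}<\gamma_2\le\frac{N-p}{p-1}$; in the case $\mu=0$, $\gamma_1=0$ and $\gamma_2=\frac{N-p}{p-1}$.
   Formalization: The origin is assumed not to lie in Ω; otherwise the claim fails whenever Cm>0, since u is in L^{p*} near 0 but |x|^{-γ2} is not. The infimum of u over ∂Ω is taken in the Sobolev (W_0^{1,p}) sense and the bound holds almost everywhere. *)

theory Defs
  imports "HOL-Analysis.Analysis"
begin

text \<open>Throughout, \<open>'a :: euclidean_space\<close> plays the role of $\mathbb{R}^N$, with \<open>N = DIM('a)\<close>.
  Functions on \<open>\<Omega>\<close> are total functions whose values outside \<open>\<Omega>\<close> are never used.\<close>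

definition gradient :: "('a::euclidean_space \<Rightarrow> real) \<Rightarrow> 'a \<Rightarrow> 'a"
  where "gradient f x = (THE D. GDERIV f x :> D)"

primrec C_k :: "nat \<Rightarrow> ('a::euclidean_space \<Rightarrow> real) \<Rightarrow> bool"
  where
    "C_k 0 f \<longleftrightarrow> continuous_on UNIV f"
  | "C_k (Suc k) f \<longleftrightarrow>
       (\<exists>g. (\<forall>x. GDERIV f x :> g x) \<and> (\<forall>i\<in>Basis. C_k k (\<lambda>x. g x \<bullet> i)))"

definition C0_infinity :: "'a::euclidean_space set \<Rightarrow> ('a \<Rightarrow> real) set"
  where "C0_infinity \<Omega> =
    {\<phi>. (\<forall>k. C_k k \<phi>) \<and> compact (closure {x. \<phi> x \<noteq> 0}) \<and> closure {x. \<phi> x \<noteq> 0} \<subseteq> \<Omega>}"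

definition Lspace :: "real \<Rightarrow> 'a::euclidean_space set \<Rightarrow> ('a \<Rightarrow> 'b::euclidean_space) set"
  where "Lspace q \<Omega> =
    {f. f \<in> borel_measurable (lebesgue_on \<Omega>) \<and>
        integrable (lebesgue_on \<Omega>) (\<lambda>x. norm (f x) powr q)}"

definition locally_integrable :: "'a::euclidean_space set \<Rightarrow> ('a \<Rightarrow> 'b::euclidean_space) \<Rightarrow> bool"
  where "locally_integrable \<Omega> f \<longleftrightarrow>
    (\<forall>K. compact K \<and> K \<subseteq> \<Omega> \<longrightarrow> f absolutely_integrable_on K)"

definition has_weak_gradient ::
    "'a::euclidean_space set \<Rightarrow> ('a \<Rightarrow> real) \<Rightarrow> ('a \<Rightarrow> 'a) \<Rightarrow> bool"
  where "has_weak_gradient \<Omega> u G \<longleftrightarrow>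
    locally_integrable \<Omega> u \<and> locally_integrable \<Omega> G \<and>
    (\<forall>\<phi>\<in>C0_infinity \<Omega>. \<forall>i\<in>Basis.
       (LINT x|lebesgue_on \<Omega>. u x * (gradient \<phi> x \<bullet> i)) =
       - (LINT x|lebesgue_on \<Omega>. (G x \<bullet> i) * \<phi> x))"

text \<open>On an open set the weak gradient is unique up to a null set, so the choice made here does not
  affect any of the integrals below.\<close>

definition weak_gradient :: "'a::euclidean_space set \<Rightarrow> ('a \<Rightarrow> real) \<Rightarrow> 'a \<Rightarrow> 'a"
  where "weak_gradient \<Omega> u = (SOME G. has_weak_gradient \<Omega> u G)"

definition weakly_differentiable :: "'a::euclidean_space set \<Rightarrow> ('a \<Rightarrow> real) \<Rightarrow> bool"
  where "weakly_differentiable \<Omega> u \<longleftrightarrow> (\<exists>G. has_weak_gradient \<Omega> u G)"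

definition sobolev_conjugate :: "'a::euclidean_space itself \<Rightarrow> real \<Rightarrow> real"
  where "sobolev_conjugate _ p = real DIM('a) * p / (real DIM('a) - p)"

definition D1p :: "real \<Rightarrow> 'a::euclidean_space set \<Rightarrow> ('a \<Rightarrow> real) set"
  where "D1p p \<Omega> =
    {v. v \<in> Lspace (sobolev_conjugate TYPE('a) p) \<Omega> \<and> weakly_differentiable \<Omega> v \<and>
        weak_gradient \<Omega> v \<in> Lspace p \<Omega>}"

text \<open>Since \<open>0 powr a = 0\<close>, the expressions $|\nabla u|^{p-2}\nabla u$ and $|u|^{p-2}u$ vanish where
  $\nabla u$, respectively $u$, does, also for \<open>p < 2\<close>. The value of the potential at the origin is
  irrelevant.\<close>

definition weak_subsolution ::
    "real \<Rightarrow> real \<Rightarrow> ('a::euclidean_space \<Rightarrow> real) \<Rightarrow> 'a set \<Rightarrow> ('a \<Rightarrow> real) \<Rightarrow> bool"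
  where "weak_subsolution p \<mu> f \<Omega> u \<longleftrightarrow>
    u \<in> D1p p \<Omega> \<and>
    (\<forall>\<phi>\<in>C0_infinity \<Omega>. (\<forall>x. \<phi> x \<ge> 0) \<longrightarrow>
       (LINT x|lebesgue_on \<Omega>.
          norm (weak_gradient \<Omega> u x) powr (p - 2) * (weak_gradient \<Omega> u x \<bullet> gradient \<phi> x)
          - \<mu> / norm x powr p * (\<bar>u x\<bar> powr (p - 2) * u x * \<phi> x))
       \<le> (LINT x|lebesgue_on \<Omega>. f x * (\<bar>u x\<bar> powr (p - 2) * u x * \<phi> x)))"

definition weak_supersolution ::
    "real \<Rightarrow> real \<Rightarrow> ('a::euclidean_space \<Rightarrow> real) \<Rightarrow> 'a set \<Rightarrow> ('a \<Rightarrow> real) \<Rightarrow> bool"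
  where "weak_supersolution p \<mu> f \<Omega> u \<longleftrightarrow> weak_subsolution p \<mu> f \<Omega> (\<lambda>x. - u x)"

text \<open>$W^{1,p}_0(\Omega)$: the closure of $C_0^\infty(\Omega)$ in $W^{1,p}(\Omega)$.\<close>

definition W01p :: "real \<Rightarrow> 'a::euclidean_space set \<Rightarrow> ('a \<Rightarrow> real) set"
  where "W01p p \<Omega> =
    {w. w \<in> Lspace p \<Omega> \<and> weakly_differentiable \<Omega> w \<and> weak_gradient \<Omega> w \<in> Lspace p \<Omega> \<and>
        (\<exists>\<phi>. (\<forall>n::nat. \<phi> n \<in> C0_infinity \<Omega>) \<and>
           (\<lambda>n. LINT x|lebesgue_on \<Omega>. \<bar>\<phi> n x - w x\<bar> powr p) \<longlonglongrightarrow> 0 \<and>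
           (\<lambda>n. LINT x|lebesgue_on \<Omega>. norm (gradient (\<phi> n) x - weak_gradient \<Omega> w x) powr p)
             \<longlonglongrightarrow> 0)}"

text \<open>A Sobolev function is defined only almost everywhere, so its boundary values are understood in
  the usual Sobolev sense: $u \ge k$ on $\partial\Omega$ means that $(k-u)^+$ vanishes on
  $\partial\Omega$ in the sense of $W^{1,p}_0$, and $\inf_{\partial\Omega} u$ is the supremum of all
  such \<open>k\<close>. The cutoffs \<open>\<eta>\<close> make this a condition near $\partial\Omega$ only; for unbounded
  \<open>\<Omega>\<close> it would otherwise also demand decay of $(k-u)^+$ at infinity.\<close>

definition boundary_ge :: "real \<Rightarrow> 'a::euclidean_space set \<Rightarrow> ('a \<Rightarrow> real) \<Rightarrow> real \<Rightarrow> bool"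
  where "boundary_ge p \<Omega> u k \<longleftrightarrow>
    (\<forall>\<eta>\<in>C0_infinity UNIV. (\<lambda>x. \<eta> x * max (k - u x) 0) \<in> W01p p \<Omega>)"

definition boundary_inf :: "real \<Rightarrow> 'a::euclidean_space set \<Rightarrow> ('a \<Rightarrow> real) \<Rightarrow> ereal"
  where "boundary_inf p \<Omega> u = Sup {ereal k |k. boundary_ge p \<Omega> u k}"

text \<open>At \<open>\<gamma> = 0\<close> the expression is read as $(p-1)\gamma^p - (N-p)\gamma^{p-1} + \mu$, i.e. as \<open>\<mu>\<close>;
  this is what \<open>0 powr a = 0\<close> yields.\<close>

definition hardy_root :: "'a::euclidean_space itself \<Rightarrow> real \<Rightarrow> real \<Rightarrow> real \<Rightarrow> bool"
  where "hardy_root _ p \<mu> \<gamma> \<longleftrightarrow>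
    \<gamma> \<ge> 0 \<and> \<gamma> powr (p - 2) * ((p - 1) * \<gamma>\<^sup>2 - (real DIM('a) - p) * \<gamma>) + \<mu> = 0"

definition exterior_domain :: "'a::euclidean_space set \<Rightarrow> bool"
  where "exterior_domain \<Omega> \<longleftrightarrow> open \<Omega> \<and> connected \<Omega> \<and> bounded (- \<Omega>)"

end

theory Submission
  imports Defs
begin

text \<open>For \<open>\<gamma> > \<gamma>2\<close> the function \<open>w x = k * (r / norm x) powr \<gamma>\<close>, with \<open>r\<close> the distance of the origin from
  \<open>frontier \<Omega>\<close>, satisfies \<open>w \<le> k\<close> on \<open>\<Omega>\<close> and is a strict subsolution of the equation without \<open>f\<close>. Testing the
  equations of \<open>u\<close> and \<open>w\<close> with functions of Diaz-Saa type supported in \<open>{w > u + \<epsilon>}\<close>, the energy terms compare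
  pointwise by Picone's inequality, and the potential terms then force \<open>{w > u}\<close> to be a null set. These test
  functions are smooth functions of \<open>(k - u)\<^sup>+\<close>, for which the boundary condition supplies approximations in
  \<open>C0_infinity \<Omega>\<close>; near infinity they vanish because \<open>w < \<epsilon>\<close> there. Finally \<open>\<gamma>\<close> decreases to \<open>\<gamma>2\<close>.\<close>

section \<open>Smooth functions\<close>

text \<open>The obstacle is that the inequality for \<open>u\<close> may be tested only with smooth
  compactly supported functions, while the natural test functions depend on \<open>u\<close>, which
  has just a weak gradient. A Sobolev chain rule is avoided: the ordinary one is used for the
  approximations, and dominated convergence does the rest. The one fact about weak derivatives that
  remains is that on \<open>{u < k}\<close> the gradient of the truncation is minus that of
  \<open>u\<close>; it rests on the vanishing of the weak derivatives of a nonnegative function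
  almost everywhere on its zero set, which is proved by difference quotients. The shift
  \<open>\<epsilon>\<close> keeps the denominator \<open>u + \<epsilon>\<close> away from zero, at
  the cost of a factor \<open>u / (u + \<epsilon>)\<close> in the potential term, which tends to one
  only where \<open>u > 0\<close>. The bound \<open>\<gamma> > (N - p) / p\<close> is exactly what
  makes the potential term of the barrier integrable at infinity, and
  \<open>\<gamma> > \<gamma>2\<close> gives this term a strict sign, which turns an integral
  inequality into a pointwise one.\<close>

lemma gradient_eqI: "GDERIV f x :> D \<Longrightarrow> gradient f x = D"
  unfolding gradient_def
proof (rule the_equality)
  fix E assume "GDERIV f x :> D" "GDERIV f x :> E"
  then have "(\<lambda>h. h \<bullet> E) = (\<lambda>h. h \<bullet> D)"
    unfolding gderiv_def by (rule has_derivative_unique[rotated])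
  then have "\<And>h. h \<bullet> (E - D) = 0" by (metis inner_diff_right right_minus_eq)
  from this[of "E - D"] show "E = D" by simp
qed

text \<open>A local form of \<open>C_k\<close>: the barrier and the reciprocals are smooth only away
  from their poles. Using \<open>gradient f\<close> in place of an existential witness fixes the
  function to which the next induction step applies.\<close>

primrec Ck_on :: "nat \<Rightarrow> 'a set \<Rightarrow> ('a::euclidean_space \<Rightarrow> real) \<Rightarrow> bool"
  where
    "Ck_on 0 S f \<longleftrightarrow> continuous_on S f"
  | "Ck_on (Suc k) S f \<longleftrightarrow>
       (\<forall>x\<in>S. GDERIV f x :> gradient f x) \<and> (\<forall>i\<in>Basis. Ck_on k S (\<lambda>x. gradient f x \<bullet> i))"

lemma C_k_iff_Ck_on: "C_k k f \<longleftrightarrow> Ck_on k UNIV f"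
proof (induction k arbitrary: f)
  case (Suc k)
  show ?case
  proof
    assume "C_k (Suc k) f"
    then obtain g where g: "\<forall>x. GDERIV f x :> g x" "\<forall>i\<in>Basis. C_k k (\<lambda>x. g x \<bullet> i)" by auto
    then have "g = gradient f" by (auto intro!: gradient_eqI[symmetric])
    with g Suc show "Ck_on (Suc k) UNIV f" by auto
  qed (use Suc in auto)
qed simp

lemma GDERIV_cong_open:
  assumes "open S" "x \<in> S" "\<And>y. y \<in> S \<Longrightarrow> f y = g y"
  shows "GDERIV f x :> D \<longleftrightarrow> GDERIV g x :> D"
  unfolding gderiv_def
proof
  assume "FDERIV f x :> (\<lambda>h. h \<bullet> D)"
  then show "FDERIV g x :> (\<lambda>h. h \<bullet> D)"
    by (rule has_derivative_transform_within_open[OF _ assms])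
next
  assume "FDERIV g x :> (\<lambda>h. h \<bullet> D)"
  then show "FDERIV f x :> (\<lambda>h. h \<bullet> D)"
    by (rule has_derivative_transform_within_open[OF _ assms(1,2)]) (simp add: assms(3))
qed

lemma gradient_cong_open:
  assumes "open S" "x \<in> S" "\<And>y. y \<in> S \<Longrightarrow> f y = g y"
  shows "gradient f x = gradient g x"
  unfolding gradient_def by (rule arg_cong[where f=The], rule ext, rule GDERIV_cong_open[OF assms])

lemma Ck_on_cong:
  assumes "open S" "\<And>x. x \<in> S \<Longrightarrow> f x = g x"
  shows "Ck_on k S f \<longleftrightarrow> Ck_on k S g"
  using assms(2)
proof (induction k arbitrary: f g)
  case 0
  then show ?case by (simp cong: continuous_on_cong)
next
  case (Suc k)
  have eq: "\<And>x. x \<in> S \<Longrightarrow> gradient f x = gradient g x"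
    using gradient_cong_open[OF assms(1)] Suc.prems by blast
  have "Ck_on k S (\<lambda>x. gradient f x \<bullet> i) \<longleftrightarrow> Ck_on k S (\<lambda>x. gradient g x \<bullet> i)" for i
    by (rule Suc.IH) (simp add: eq)
  moreover have "(\<forall>x\<in>S. GDERIV f x :> gradient f x) \<longleftrightarrow> (\<forall>x\<in>S. GDERIV g x :> gradient g x)"
  proof (intro ball_cong refl)
    fix x assume x: "x \<in> S"
    show "(GDERIV f x :> gradient f x) = (GDERIV g x :> gradient g x)"
      unfolding eq[OF x] by (rule GDERIV_cong_open[OF assms(1) x Suc.prems])
  qed
  ultimately show ?case unfolding Ck_on.simps by blast
qed

lemma Ck_on_SucI:
  assumes "open S" "\<And>x. x \<in> S \<Longrightarrow> GDERIV f x :> g x" "\<And>i. i \<in> Basis \<Longrightarrow> Ck_on k S (\<lambda>x. g x \<bullet> i)"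
  shows "Ck_on (Suc k) S f"
proof -
  have eq: "\<And>x. x \<in> S \<Longrightarrow> gradient f x = g x" using assms gradient_eqI by blast
  then have "Ck_on k S (\<lambda>x. gradient f x \<bullet> i)" if "i \<in> Basis" for i
    using assms(3)[OF that] Ck_on_cong[OF assms(1), of "\<lambda>x. gradient f x \<bullet> i" "\<lambda>x. g x \<bullet> i"] by simp
  then show ?thesis using assms(2) eq by simp
qed

text \<open>Used for gluing functions given by different formulas on overlapping open sets. The
  derivatives are pointwise conditions, so openness matters only for the continuity at the bottom of
  the recursion.\<close>

lemma Ck_on_Un:
  assumes "open S" "open T" "Ck_on k S f" "Ck_on k T f"
  shows "Ck_on k (S \<union> T) f"
  using assms(3,4)
  by (induction k arbitrary: f) (auto intro: continuous_on_open_Un assms(1,2))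

lemma Ck_on_subset: "T \<subseteq> S \<Longrightarrow> Ck_on k S f \<Longrightarrow> Ck_on k T f"
  by (induction k arbitrary: f) (auto intro: continuous_on_subset)

lemma GDERIV_isCont: "GDERIV f x :> D \<Longrightarrow> isCont f x"
  unfolding gderiv_def by (rule has_derivative_continuous)

lemma Ck_on_continuous: "Ck_on k S f \<Longrightarrow> continuous_on S f"
  by (cases k) (auto intro!: continuous_at_imp_continuous_on GDERIV_isCont)

lemma Ck_on_Suc_le: "Ck_on (Suc k) S f \<Longrightarrow> Ck_on k S f"
proof (induction k arbitrary: f)
  case 0
  then show ?case using Ck_on_continuous by (metis Ck_on.simps(1))
next
  case (Suc k)
  have "Ck_on k S (\<lambda>x. gradient f x \<bullet> i)" if "i \<in> Basis" for i
    using Suc.prems that by (intro Suc.IH) simp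
  then show ?case using Suc.prems by simp
qed

lemma Ck_on_const: "open S \<Longrightarrow> Ck_on k S (\<lambda>x. c)"
proof (induction k arbitrary: c)
  case (Suc k)
  then show ?case by (intro Ck_on_SucI[where g="\<lambda>x. 0"] GDERIV_const) simp_all
qed simp

lemma Ck_on_add:
  assumes "open S" "Ck_on k S f" "Ck_on k S g"
  shows "Ck_on k S (\<lambda>x. f x + g x)"
  using assms(2,3)
proof (induction k arbitrary: f g)
  case 0
  then show ?case by (simp add: continuous_on_add)
next
  case (Suc k)
  show ?case
  proof (rule Ck_on_SucI[where g="\<lambda>x. gradient f x + gradient g x", OF assms(1)])
    show "GDERIV (\<lambda>x. f x + g x) x :> gradient f x + gradient g x" if "x \<in> S" for x
      using Suc.prems that by (simp add: GDERIV_add)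
    show "Ck_on k S (\<lambda>x. (gradient f x + gradient g x) \<bullet> i)" if "i \<in> Basis" for i
      unfolding inner_add_left using Suc.prems that by (intro Suc.IH) simp_all
  qed
qed

lemma Ck_on_mult:
  assumes "open S" "Ck_on k S f" "Ck_on k S g"
  shows "Ck_on k S (\<lambda>x. f x * g x)"
  using assms(2,3)
proof (induction k arbitrary: f g)
  case 0
  then show ?case by (simp add: continuous_on_mult)
next
  case (Suc k)
  have fg: "Ck_on k S f" "Ck_on k S g" using Suc.prems Ck_on_Suc_le by blast+
  show ?case
  proof (rule Ck_on_SucI[where g="\<lambda>x. f x *\<^sub>R gradient g x + g x *\<^sub>R gradient f x", OF assms(1)])
    show "GDERIV (\<lambda>x. f x * g x) x :> f x *\<^sub>R gradient g x + g x *\<^sub>R gradient f x" if "x \<in> S" for x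
      using Suc.prems that by (simp add: GDERIV_mult)
    show "Ck_on k S (\<lambda>x. (f x *\<^sub>R gradient g x + g x *\<^sub>R gradient f x) \<bullet> i)" if "i \<in> Basis" for i
      unfolding inner_add_left inner_scaleR_left
      using Suc.prems that fg by (intro Ck_on_add assms(1) Suc.IH) simp_all
  qed
qed

lemma Ck_on_sum:
  assumes "open S" "\<And>i. i \<in> I \<Longrightarrow> Ck_on k S (f i)"
  shows "Ck_on k S (\<lambda>x. \<Sum>i\<in>I. f i x)"
  using assms(2)
  by (induction I rule: infinite_finite_induct) (simp_all add: Ck_on_const Ck_on_add assms(1))

lemma Ck_on_prod:
  assumes "open S" "\<And>i. i \<in> I \<Longrightarrow> Ck_on k S (f i)"
  shows "Ck_on k S (\<lambda>x. \<Prod>i\<in>I. f i x)"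
  using assms(2)
  by (induction I rule: infinite_finite_induct) (simp_all add: Ck_on_const Ck_on_mult assms(1))

lemma GDERIV_inner: "GDERIV (\<lambda>x. x \<bullet> a) x :> a"
  unfolding gderiv_def by (intro bounded_linear_imp_has_derivative bounded_linear_inner_left)

lemma Ck_on_inner: "open S \<Longrightarrow> Ck_on k S (\<lambda>x. x \<bullet> a)"
proof (cases k)
  case (Suc n)
  assume "open S"
  then show ?thesis unfolding Suc by (intro Ck_on_SucI[where g="\<lambda>x. a"] GDERIV_inner Ck_on_const)
qed (simp add: continuous_on_inner continuous_on_id)

lemma Ck_on_real_Suc:
  "Ck_on (Suc k) T (h::real\<Rightarrow>real) \<longleftrightarrow> (\<forall>t\<in>T. (h has_field_derivative gradient h t) (at t)) \<and> Ck_on k T (gradient h)"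
  by simp

lemma Ck_on_real_SucI:
  assumes "open T" "\<And>t. t \<in> T \<Longrightarrow> (h has_field_derivative h' t) (at t)" "Ck_on k T h'"
  shows "Ck_on (Suc k) T (h::real\<Rightarrow>real)"
  by (rule Ck_on_SucI[OF assms(1), where g=h']) (use assms in auto)

text \<open>The induction varies \<open>h\<close> and keeps \<open>f\<close>: the first factor of
  the derivative, \<open>gradient h (f x)\<close>, is again a composite with inner function
  \<open>f\<close>.\<close>

lemma Ck_on_compose:
  fixes h :: "real \<Rightarrow> real"
  assumes "open S" "Ck_on k S f" "Ck_on k T h" "f ` S \<subseteq> T"
  shows "Ck_on k S (\<lambda>x. h (f x))"
  using assms(2,3)
proof (induction k arbitrary: h)
  case 0
  then show ?case using continuous_on_compose2[OF _ _ assms(4)] by auto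
next
  case (Suc k)
  have "Ck_on k S f" using Suc.prems Ck_on_Suc_le by blast
  moreover have d: "Ck_on k T (gradient h)" "\<And>x. x \<in> S \<Longrightarrow> (h has_field_derivative gradient h (f x)) (at (f x))"
    using Suc.prems(2) assms(4) unfolding Ck_on_real_Suc by auto
  ultimately have "Ck_on k S (\<lambda>x. gradient h (f x))" using Suc.IH by blast
  note dh = this
  show ?case
  proof (rule Ck_on_SucI[where g="\<lambda>x. gradient h (f x) *\<^sub>R gradient f x", OF assms(1)])
    show "GDERIV (\<lambda>x. h (f x)) x :> gradient h (f x) *\<^sub>R gradient f x" if "x \<in> S" for x
      using Suc.prems(1) that d(2) by (intro GDERIV_DERIV_compose) auto
    show "Ck_on k S (\<lambda>x. (gradient h (f x) *\<^sub>R gradient f x) \<bullet> i)" if "i \<in> Basis" for i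
      unfolding inner_scaleR_left using Suc.prems(1) that dh by (intro Ck_on_mult assms(1)) auto
  qed
qed

lemma Ck_on_powr: "Ck_on k {0<..} (\<lambda>t::real. t powr a)"
proof (induction k arbitrary: a)
  case 0
  show ?case by (auto intro!: continuous_intros)
next
  case (Suc k)
  show ?case
  proof (rule Ck_on_real_SucI[where h'="\<lambda>t. a * t powr (a-1)"])
    fix t :: real assume "t \<in> {0<..}"
    then show "((\<lambda>t. t powr a) has_field_derivative a * t powr (a-1)) (at t)"
      by (intro has_real_derivative_powr) simp
  qed (intro Ck_on_mult Ck_on_const Suc open_greaterThan)+
qed

lemma Ck_on_inverse: "Ck_on k {0<..} (\<lambda>t::real. 1 / t)"
proof -
  have "Ck_on k {0<..} (\<lambda>t::real. 1 / t) = Ck_on k {0<..} (\<lambda>t::real. t powr (-1))"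
    by (rule Ck_on_cong) (auto simp: powr_minus divide_simps)
  then show ?thesis using Ck_on_powr by blast
qed

lemma Ck_on_affine: "Ck_on k UNIV (\<lambda>t::real. a * t + b)"
  using Ck_on_add[OF _ Ck_on_inner[of UNIV k a] Ck_on_const[of UNIV k b]] by (simp add: mult.commute)

text \<open>The standard flat function \<open>exp (- 1 / t)\<close> is the case
  \<open>m = 0\<close>. The extra powers of \<open>1 / t\<close> make the family closed under
  differentiation up to linear combinations, so one induction shows that all its members are
  smooth.\<close>

definition exp_bump :: "nat \<Rightarrow> real \<Rightarrow> real"
  where "exp_bump m t = (if t > 0 then exp (- 1 / t) / t ^ m else 0)"

lemma exp_bump_tendsto: "((\<lambda>t. exp (- 1 / t) / t ^ m) \<longlongrightarrow> 0) (at_right (0::real))"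
proof -
  have "((\<lambda>y::real. y ^ m / exp y) \<longlongrightarrow> 0) at_top" by (rule tendsto_power_div_exp_0)
  then have "((\<lambda>t::real. (inverse t) ^ m / exp (inverse t)) \<longlongrightarrow> 0) (at_right 0)"
    by (rule filterlim_compose[OF _ filterlim_inverse_at_top_right])
  then show ?thesis by (simp add: exp_minus divide_simps power_inverse mult.commute)
qed

text \<open>Only the point 0 needs an argument. There the difference quotient of
  \<open>exp_bump m\<close> is \<open>exp_bump (Suc m)\<close> on the right and 0 on the left, and
  the exponential beats every power.\<close>

lemma exp_bump_deriv:
  "(exp_bump m has_field_derivative (exp_bump (m + 2) t - real m * exp_bump (Suc m) t)) (at t)"
proof -
  consider "t < 0" | "t = 0" | "t > 0" by linarith
  then show ?thesis
  proof cases
    case 1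
    then have "((\<lambda>t. 0) has_field_derivative
        (exp_bump (m + 2) t - real m * exp_bump (Suc m) t)) (at t)"
      by (simp add: exp_bump_def)
    then show ?thesis
      by (rule has_field_derivative_transform_within_open[where S="{..<0}"]) (use 1 in \<open>auto simp: exp_bump_def\<close>)
  next
    case 2
    have "\<forall>\<^sub>F y in at_left 0. exp_bump m y / y = 0"
      by (auto simp: exp_bump_def eventually_at_filter)
    then have l: "((\<lambda>y. exp_bump m y / y) \<longlongrightarrow> 0) (at_left 0)"
      by (rule tendsto_eventually)
    have "\<forall>\<^sub>F y in at_right 0. exp (- 1 / y) / y ^ Suc m = exp_bump m y / y"
      by (auto simp: exp_bump_def eventually_at_filter)
    then have r: "((\<lambda>y. exp_bump m y / y) \<longlongrightarrow> 0) (at_right 0)"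
      by (rule Lim_transform_eventually[OF exp_bump_tendsto])
    show ?thesis using 2 filterlim_split_at[OF l r] by (simp add: has_field_derivative_iff exp_bump_def)
  next
    case 3
    have "((\<lambda>t. exp (- 1 / t) * t powr (- real m)) has_field_derivative
        (exp (-1/t) * (1 / t^2) * t powr (- real m) + exp (-1/t) * (- real m * t powr (- real m - 1)))) (at t)"
      using 3 by (auto intro!: derivative_eq_intros simp: power2_eq_square)
    moreover have "t powr (- real m) = 1 / t ^ m" "t powr (- real m - 1) = 1 / t ^ Suc m"
      using 3 by (auto simp: powr_minus powr_diff powr_realpow field_simps)
    ultimately have "((\<lambda>t. exp (- 1 / t) * t powr (- real m)) has_field_derivative
        (exp_bump (m + 2) t - real m * exp_bump (Suc m) t)) (at t)"
      using 3 by (simp add: exp_bump_def power2_eq_square field_simps)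
    then show ?thesis
      by (rule has_field_derivative_transform_within_open[where S="{0<..}"])
        (use 3 in \<open>auto simp: exp_bump_def powr_minus powr_realpow divide_simps\<close>)
  qed
qed
lemma Ck_on_exp_bump: "Ck_on k UNIV (exp_bump m)"
proof (induction k arbitrary: m)
  case 0
  show ?case using exp_bump_deriv[of m]
    by (auto intro!: continuous_at_imp_continuous_on DERIV_isCont)
next
  case (Suc k)
  have "Ck_on k UNIV (\<lambda>t. exp_bump (m + 2) t + (- real m) * exp_bump (Suc m) t)"
    by (intro Ck_on_add Ck_on_mult Ck_on_const Suc) auto
  then show ?case by (intro Ck_on_real_SucI[OF _ exp_bump_deriv]) auto
qed

definition smooth_step :: "real \<Rightarrow> real"
  where "smooth_step t = exp_bump 0 t / (exp_bump 0 t + exp_bump 0 (1 - t))"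

lemma exp_bump_nonneg: "exp_bump m t \<ge> 0" by (simp add: exp_bump_def)
lemma exp_bump_0_le_1: "exp_bump 0 t \<le> 1" by (simp add: exp_bump_def)
lemma exp_bump_pos: "t > 0 \<Longrightarrow> exp_bump m t > 0" by (simp add: exp_bump_def)
lemma exp_bump_eq_0: "t \<le> 0 \<Longrightarrow> exp_bump m t = 0" by (simp add: exp_bump_def)

lemma smooth_step_eq_0: "t \<le> 0 \<Longrightarrow> smooth_step t = 0" by (simp add: smooth_step_def exp_bump_eq_0)
text \<open>\<open>t\<close> and \<open>1 - t\<close> cannot both be nonpositive.\<close>

lemma smooth_step_denom_pos: "exp_bump 0 t + exp_bump 0 (1 - t) > 0"
  using exp_bump_pos[of t 0] exp_bump_pos[of "1-t" 0] exp_bump_nonneg[of 0 t] exp_bump_nonneg[of 0 "1-t"]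
  by linarith
lemma smooth_step_eq_1: "t \<ge> 1 \<Longrightarrow> smooth_step t = 1"
  using smooth_step_denom_pos[of t] by (simp add: smooth_step_def exp_bump_eq_0)
lemma smooth_step_nonneg: "smooth_step t \<ge> 0" using smooth_step_denom_pos[of t] exp_bump_nonneg[of 0 t] by (simp add: smooth_step_def)
lemma smooth_step_le_1: "smooth_step t \<le> 1"
  using smooth_step_denom_pos[of t] exp_bump_nonneg[of 0 "1-t"] by (simp add: smooth_step_def)

lemma Ck_on_smooth_step: "Ck_on k UNIV smooth_step"
proof -
  have c: "Ck_on k UNIV (\<lambda>t. exp_bump 0 (1 - t))"
    using Ck_on_compose[OF _ Ck_on_affine[of k "-1" 1] Ck_on_exp_bump[of k 0]] by simp
  have "Ck_on k UNIV (\<lambda>t. exp_bump 0 t + exp_bump 0 (1 - t))"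
    by (intro Ck_on_add c Ck_on_exp_bump) auto
  from Ck_on_compose[OF open_UNIV this Ck_on_inverse]
  have "Ck_on k UNIV (\<lambda>t. 1 / (exp_bump 0 t + exp_bump 0 (1 - t)))"
    using smooth_step_denom_pos by auto
  then have "Ck_on k UNIV (\<lambda>t. exp_bump 0 t * (1 / (exp_bump 0 t + exp_bump 0 (1 - t))))"
    by (intro Ck_on_mult Ck_on_exp_bump) auto
  then show ?thesis unfolding smooth_step_def[abs_def] by simp
qed

section \<open>Test functions and the fundamental lemma\<close>

text \<open>Smoothness has to be checked only on an open set \<open>U\<close> around the support,
  where the defining formula is good: the function is zero on \<open>- K\<close>, and
  \<open>U\<close> and \<open>- K\<close> cover the space.\<close>

lemma C0_infinityI:
  assumes "open U" "\<And>k. Ck_on k U f" "compact K" "K \<subseteq> U" "K \<subseteq> \<Omega>" "\<And>x. x \<notin> K \<Longrightarrow> f x = 0"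
  shows "f \<in> C0_infinity \<Omega>"
proof -
  have sub: "closure {x. f x \<noteq> 0} \<subseteq> K"
    using assms(3,6) by (intro closure_minimal) (auto intro: compact_imp_closed)
  have op: "open (- K)" using assms(3) by (simp add: compact_imp_closed open_Compl)
  have "Ck_on k (- K) f" for k
    using Ck_on_const[OF op, of k 0] Ck_on_cong[OF op, of f "\<lambda>x. 0" k] assms(6) by simp
  then have "Ck_on k (U \<union> - K) f" for k
    using assms(1,2) op by (intro Ck_on_Un) auto
  moreover have "U \<union> - K = UNIV" using assms(4) by auto
  ultimately have "C_k k f" for k unfolding C_k_iff_Ck_on by simp
  moreover have "compact (closure {x. f x \<noteq> 0})"
    using sub assms(3) by (metis closed_closure compact_Int_closed inf.absorb_iff2)
  ultimately show ?thesis unfolding C0_infinity_def using sub assms(5) by blast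
qed

lemma C0_infinity_mono: "\<Omega> \<subseteq> \<Omega>' \<Longrightarrow> \<phi> \<in> C0_infinity \<Omega> \<Longrightarrow> \<phi> \<in> C0_infinity \<Omega>'"
  unfolding C0_infinity_def by auto

context
  fixes \<phi> :: "'a::euclidean_space \<Rightarrow> real" and \<Omega> :: "'a set"
  assumes phi: "\<phi> \<in> C0_infinity \<Omega>"
begin

lemma C0_infinity_Ck_on: "Ck_on k S \<phi>"
  using phi Ck_on_subset[of S UNIV k \<phi>] by (simp add: C0_infinity_def C_k_iff_Ck_on)

lemma C0_infinity_GDERIV: "GDERIV \<phi> x :> gradient \<phi> x"
  using C0_infinity_Ck_on[of "Suc 0" UNIV] by simp

lemma C0_infinity_continuous: "continuous_on UNIV \<phi>"
  using C0_infinity_Ck_on[of 0 UNIV] by simp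

lemma C0_infinity_continuous_gradient: "continuous_on UNIV (gradient \<phi>)"
  using C0_infinity_Ck_on[of "Suc 0" UNIV] by (subst continuous_on_componentwise) simp

lemma C0_infinity_borel[measurable]: "\<phi> \<in> borel_measurable borel"
  using C0_infinity_continuous by (rule borel_measurable_continuous_onI)

lemma C0_infinity_gradient_borel[measurable]: "gradient \<phi> \<in> borel_measurable borel"
  using C0_infinity_continuous_gradient by (rule borel_measurable_continuous_onI)

lemma C0_infinity_support:
  obtains K where "compact K" "K \<subseteq> \<Omega>" "\<And>x. x \<notin> K \<Longrightarrow> \<phi> x = 0" "\<And>x. x \<notin> K \<Longrightarrow> gradient \<phi> x = 0"
proof
  let ?K = "closure {x. \<phi> x \<noteq> 0}"
  show "compact ?K" "?K \<subseteq> \<Omega>" using phi by (auto simp: C0_infinity_def)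
  show z: "\<phi> x = 0" if "x \<notin> ?K" for x
    using that closure_subset[of "{x. \<phi> x \<noteq> 0}"] by auto
  show "gradient \<phi> x = 0" if "x \<notin> ?K" for x
  proof -
    have "GDERIV (\<lambda>x. 0) x :> (0::'a)" by (rule GDERIV_const)
    moreover have "open (- ?K)" "x \<in> - ?K" using that by auto
    ultimately have "GDERIV \<phi> x :> 0"
      by (subst GDERIV_cong_open[where g="\<lambda>x. 0"]) (auto intro: z)
    then show ?thesis by (rule gradient_eqI)
  qed
qed

lemma C0_infinity_bounded:
  obtains B where "B > 0" "\<And>x. \<bar>\<phi> x\<bar> \<le> B" "\<And>x. norm (gradient \<phi> x) \<le> B"
proof -
  obtain K where K: "compact K" "\<And>x. x \<notin> K \<Longrightarrow> \<phi> x = 0" "\<And>x. x \<notin> K \<Longrightarrow> gradient \<phi> x = 0"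
    by (rule C0_infinity_support) blast
  have "bounded (\<phi> ` K)" "bounded (gradient \<phi> ` K)"
    using K(1) C0_infinity_continuous C0_infinity_continuous_gradient
    by (auto intro!: compact_imp_bounded compact_continuous_image intro: continuous_on_subset)
  then obtain B1 B2 where "\<And>x. x \<in> K \<Longrightarrow> \<bar>\<phi> x\<bar> \<le> B1" "\<And>x. x \<in> K \<Longrightarrow> norm (gradient \<phi> x) \<le> B2"
    unfolding bounded_iff by auto
  then have "\<bar>\<phi> x\<bar> \<le> \<bar>B1\<bar> + \<bar>B2\<bar> + 1 \<and> norm (gradient \<phi> x) \<le> \<bar>B1\<bar> + \<bar>B2\<bar> + 1" for x
    using K(2,3)[of x] by (cases "x \<in> K") fastforce+
  then show ?thesis by (intro that[of "\<bar>B1\<bar> + \<bar>B2\<bar> + 1"]) auto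
qed

end

section \<open>Translation of integrals and the integral of a gradient\<close>

lemma continuous_compact_support_integrable:
  fixes f :: "'a::euclidean_space \<Rightarrow> 'b::{banach, second_countable_topology}"
  assumes "continuous_on UNIV f" "compact K" "\<And>x. x \<notin> K \<Longrightarrow> f x = 0"
  shows "integrable lborel f"
proof -
  have "integrable lborel (\<lambda>x. indicator K x *\<^sub>R f x)"
    by (rule borel_integrable_compact) (use assms in \<open>auto intro: continuous_on_subset\<close>)
  also have "(\<lambda>x. indicator K x *\<^sub>R f x) = f" using assms(3) by (auto simp: indicator_def)
  finally show ?thesis .
qed

lemma integral_lborel_shift:
  fixes f :: "'a::euclidean_space \<Rightarrow> real"
  assumes [measurable]: "f \<in> borel_measurable borel"
  shows "(LINT x|lborel. f (x + c)) = (LINT x|lborel. f x)"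
proof -
  have "(LINT x|lborel. f x) = (LINT x|distr lborel borel ((+) c). f x)" by (simp add: lborel_distr_plus)
  also have "\<dots> = (LINT x|lborel. f (c + x))" by (subst integral_distr) auto
  finally show ?thesis by (simp add: add.commute)
qed

lemma integrable_lborel_shift:
  fixes f :: "'a::euclidean_space \<Rightarrow> real"
  assumes "integrable lborel f"
  shows "integrable lborel (\<lambda>x. f (x + c))"
proof -
  have "integrable (distr lborel borel ((+) c)) f" using assms by (simp add: lborel_distr_plus)
  then have "integrable lborel (\<lambda>x. f (c + x))"
    using borel_measurable_integrable[OF assms] by (subst (asm) integrable_distr_eq) auto
  then show ?thesis by (simp add: add.commute)
qed

lemma GDERIV_Lipschitz:
  fixes g :: "'a::euclidean_space \<Rightarrow> real"
  assumes "\<And>x. GDERIV g x :> g' x" "\<And>x. norm (g' x) \<le> B"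
  shows "\<bar>g x - g y\<bar> \<le> B * norm (x - y)"
proof -
  have "norm (g x - g y) \<le> B * norm (x - y)"
  proof (rule differentiable_bound[of UNIV])
    show "(g has_derivative (\<lambda>h. h \<bullet> g' x)) (at x within UNIV)" for x
      using assms(1) by (simp add: gderiv_def)
    show "onorm (\<lambda>h. h \<bullet> g' x) \<le> B" for x
    proof (rule onorm_le)
      fix h
      have "norm (h \<bullet> g' x) \<le> norm h * norm (g' x)" using Cauchy_Schwarz_ineq2 by simp
      also have "\<dots> \<le> norm h * B" using assms(2) by (intro mult_left_mono) auto
      finally show "norm (h \<bullet> g' x) \<le> B * norm h" by (simp add: mult.commute)
    qed
  qed auto
  then show ?thesis by simp
qed

lemma GDERIV_directional:
  assumes "GDERIV g x :> D"
  shows "((\<lambda>t. g (x + t *\<^sub>R e)) has_field_derivative (D \<bullet> e)) (at 0)"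
proof -
  have "((\<lambda>t::real. x + t *\<^sub>R e) has_derivative (\<lambda>t. t *\<^sub>R e)) (at 0)"
    by (auto intro!: derivative_eq_intros)
  moreover have "(g has_derivative (\<lambda>h. h \<bullet> D)) (at (x + 0 *\<^sub>R e))" using assms by (simp add: gderiv_def)
  ultimately have "((\<lambda>t. g (x + t *\<^sub>R e)) has_derivative (\<lambda>t. (t *\<^sub>R e) \<bullet> D)) (at 0)"
    by (rule has_derivative_compose)
  then show ?thesis unfolding has_field_derivative_def
    by (simp add: inner_commute mult_commute_abs)
qed

text \<open>Translation invariance gives every difference quotient integral zero.\<close>

lemma integral_gradient_eq_0:
  fixes g :: "'a::euclidean_space \<Rightarrow> real"
  assumes g: "g \<in> C0_infinity \<Omega>"
  shows "(LINT x|lborel. gradient g x \<bullet> e) = 0"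
proof -
  note [measurable] = C0_infinity_borel[OF g] C0_infinity_gradient_borel[OF g]
  obtain K where K: "compact K" "\<And>x. x \<notin> K \<Longrightarrow> g x = 0"
    using C0_infinity_support[OF g] by metis
  obtain B where B: "B > 0" "\<And>x. norm (gradient g x) \<le> B" using C0_infinity_bounded[OF g] by metis
  obtain R where R: "\<And>x. x \<in> K \<Longrightarrow> norm x \<le> R" using compact_imp_bounded[OF K(1)] bounded_iff by metis
  define t where "t n = 1 / real (Suc n)" for n
  have t: "t n > 0" "t n \<le> 1" for n by (auto simp: t_def)
  have t0: "t \<longlonglongrightarrow> 0" unfolding t_def by (rule LIMSEQ_Suc[OF lim_1_over_n])
  define D where "D n x = (g (x + t n *\<^sub>R e) - g x) / t n" for n x
  have [measurable]: "D n \<in> borel_measurable borel" for n unfolding D_def by measurable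
  have gint: "integrable lborel g"
    using C0_infinity_continuous[OF g] K by (rule continuous_compact_support_integrable)
  have D0: "(LINT x|lborel. D n x) = 0" for n
    unfolding D_def using gint integrable_lborel_shift[OF gint, of "t n *\<^sub>R e"]
      integral_lborel_shift[of g "t n *\<^sub>R e"] by simp
  have "(\<lambda>n. LINT x|lborel. D n x) \<longlonglongrightarrow> (LINT x|lborel. gradient g x \<bullet> e)"
  \<comment> \<open>As \<open>t n\<close> is at most 1, all difference quotients vanish outside the
    ball containing the support, enlarged by \<open>norm e\<close>; inside it the Lipschitz bound
    applies.\<close>
  proof (rule integral_dominated_convergence[where w="\<lambda>x. B * norm e * indicator (cball 0 (R + norm e)) x"])
    show "integrable lborel (\<lambda>x. B * norm e * indicator (cball 0 (R + norm e)) x)"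
      using emeasure_lborel_cball_finite[of 0 "R + norm e"]
      by (intro integrable_mult_right integrable_real_indicator) simp_all
    show "AE x in lborel. (\<lambda>n. D n x) \<longlonglongrightarrow> gradient g x \<bullet> e"
    proof (intro AE_I2)
      fix x
      have "((\<lambda>s. (g (x + s *\<^sub>R e) - g x) / s) \<longlongrightarrow> gradient g x \<bullet> e) (at 0)"
        using GDERIV_directional[OF C0_infinity_GDERIV[OF g], of x e] by (simp add: has_field_derivative_iff)
      moreover have "filterlim t (at 0) sequentially"
        using t0 t by (auto simp: filterlim_at intro!: always_eventually less_imp_neq[symmetric])
      ultimately show "(\<lambda>n. D n x) \<longlonglongrightarrow> gradient g x \<bullet> e"
        unfolding D_def by (rule filterlim_compose)
    qed
    show "AE x in lborel. norm (D n x) \<le> B * norm e * indicator (cball 0 (R + norm e)) x" for n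
    proof (intro AE_I2)
      fix x
      show "norm (D n x) \<le> B * norm e * indicator (cball 0 (R + norm e)) x"
      proof (cases "norm x \<le> R + norm e")
        case True
        have "\<bar>g (x + t n *\<^sub>R e) - g x\<bar> \<le> B * norm (x + t n *\<^sub>R e - x)"
          by (rule GDERIV_Lipschitz[OF C0_infinity_GDERIV[OF g] B(2)])
        then show ?thesis using True t[of n] by (simp add: D_def divide_simps mult_ac)
      next
        case False
        have "norm (t n *\<^sub>R e) \<le> norm e" using t[of n] by (simp add: mult_left_le_one_le)
        then have "norm (x + t n *\<^sub>R e) > R" using False norm_triangle_ineq2[of x "- (t n *\<^sub>R e)"] by simp
        moreover have "norm x > R" using False norm_ge_zero[of e] by linarith
        ultimately have "g (x + t n *\<^sub>R e) = 0" "g x = 0" using K(2) R by fastforce+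
        then show ?thesis by (simp add: D_def B less_imp_le)
      qed
    qed
  qed auto
  then have "(\<lambda>n. 0) \<longlonglongrightarrow> (LINT x|lborel. gradient g x \<bullet> e)" unfolding D0 .
  then show ?thesis using LIMSEQ_unique tendsto_const by blast
qed

section \<open>Box indicators as limits of test functions\<close>

definition box_bump :: "nat \<Rightarrow> 'a \<Rightarrow> 'a \<Rightarrow> 'a::euclidean_space \<Rightarrow> real"
  where "box_bump n a b x = (\<Prod>i\<in>Basis. exp_bump 0 (real (Suc n) * (x \<bullet> i - a \<bullet> i)) * exp_bump 0 (real (Suc n) * (b \<bullet> i - x \<bullet> i)))"

lemma box_bump_nonneg: "box_bump n a b x \<ge> 0"
  unfolding box_bump_def by (intro prod_nonneg mult_nonneg_nonneg exp_bump_nonneg)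

lemma box_bump_le_1: "box_bump n a b x \<le> 1"
  unfolding box_bump_def by (intro prod_le_1 conjI mult_nonneg_nonneg mult_le_one exp_bump_nonneg exp_bump_0_le_1)

lemma box_bump_eq_0: "x \<notin> box a b \<Longrightarrow> box_bump n a b x = 0"
  unfolding box_bump_def mem_box
  by (auto simp: exp_bump_eq_0 mult_le_0_iff not_less intro!: prod_zero bexI)

lemma exp_bump_0_tendsto: "t > 0 \<Longrightarrow> (\<lambda>n. exp_bump 0 (real (Suc n) * t)) \<longlonglongrightarrow> 1"
proof -
  assume t: "t > 0"
  have "(\<lambda>n. exp (- (1 / t * (1 / real (Suc n))))) \<longlonglongrightarrow> exp (- (1 / t * 0))"
    by (intro tendsto_intros LIMSEQ_Suc[OF lim_1_over_n])
  moreover have "exp (- (1 / t * (1 / real (Suc n)))) = exp_bump 0 (real (Suc n) * t)" for n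
    using t by (simp add: exp_bump_def mult.commute del: of_nat_Suc)
  ultimately show ?thesis by simp
qed

lemma box_bump_tendsto: "(\<lambda>n. box_bump n a b x) \<longlonglongrightarrow> indicator (box a b) x"
proof (cases "x \<in> box a b")
  case True
  have "(\<lambda>n. box_bump n a b x) \<longlonglongrightarrow> (\<Prod>i\<in>(Basis::'a set). 1 * 1)"
    unfolding box_bump_def using True
    by (intro tendsto_prod tendsto_mult exp_bump_0_tendsto) (auto simp: mem_box)
  then show ?thesis using True by simp
qed (simp add: box_bump_eq_0)

lemma box_bump_C0_infinity:
  assumes "cbox a b \<subseteq> \<Omega>"
  shows "box_bump n a b \<in> C0_infinity \<Omega>"
proof (rule C0_infinityI[of UNIV])
  have lin: "Ck_on k UNIV (\<lambda>x. c * (x \<bullet> i - d))" "Ck_on k UNIV (\<lambda>x. c * (d - x \<bullet> i))" for k c d i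
    using Ck_on_mult[OF _ Ck_on_const[of UNIV k c] Ck_on_add[OF _ Ck_on_inner[of UNIV k i] Ck_on_const[of UNIV k "-d"]]]
      Ck_on_mult[OF _ Ck_on_const[of UNIV k "-c"] Ck_on_add[OF _ Ck_on_inner[of UNIV k i] Ck_on_const[of UNIV k "-d"]]]
    by (simp_all add: algebra_simps)
  show "Ck_on k UNIV (box_bump n a b)" for k
    unfolding box_bump_def[abs_def]
    by (intro Ck_on_prod Ck_on_mult open_UNIV Ck_on_compose[OF _ lin(1) Ck_on_exp_bump] Ck_on_compose[OF _ lin(2) Ck_on_exp_bump]) auto
  show "box_bump n a b x = 0" if "x \<notin> cbox a b" for x
    using that box_subset_cbox by (intro box_bump_eq_0) blast
qed (use assms in auto)

lemma integral_box_eq_0: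
  assumes g: "integrable lborel g" and cb: "cbox a b \<subseteq> U"
    and 0: "\<And>\<phi>. \<phi> \<in> C0_infinity U \<Longrightarrow> (LINT x|lborel. g x * \<phi> x) = 0"
  shows "(LINT x|lborel. g x * indicator (box a b) x) = (0::real)"
proof -
  note [measurable] = C0_infinity_borel[OF box_bump_C0_infinity[OF cb]]
  note [measurable] = borel_measurable_integrable[OF g]
  have "(\<lambda>n. LINT x|lborel. g x * box_bump n a b x) \<longlonglongrightarrow> (LINT x|lborel. g x * indicator (box a b) x)"
  proof (rule integral_dominated_convergence[where w="\<lambda>x. \<bar>g x\<bar>"])
    show "AE x in lborel. (\<lambda>n. g x * box_bump n a b x) \<longlonglongrightarrow> g x * indicator (box a b) x"
      by (intro AE_I2 tendsto_intros box_bump_tendsto)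
    show "AE x in lborel. norm (g x * box_bump n a b x) \<le> \<bar>g x\<bar>" for n
      by (intro AE_I2) (simp add: abs_mult mult_left_le box_bump_le_1 box_bump_nonneg)
  qed (use g in auto)
  then have "(\<lambda>n. 0) \<longlonglongrightarrow> (LINT x|lborel. g x * indicator (box a b) x)"
    using 0[OF box_bump_C0_infinity[OF cb]] by simp
  then show ?thesis using LIMSEQ_unique tendsto_const by blast
qed

text \<open>Testing with \<open>box_bump\<close> and letting \<open>n\<close> grow shows that
  \<open>g\<close> integrates to zero over boxes in \<open>U\<close>. Lebesgue differentiation along
  shrinking cubes then gives \<open>g = 0\<close> almost everywhere on each such box, and countably
  many boxes exhaust \<open>U\<close>.\<close>

lemma fundamental_lemma:
  fixes g :: "'a::euclidean_space \<Rightarrow> real"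
  assumes g: "integrable lborel g" and "open U"
    and 0: "\<And>\<phi>. \<phi> \<in> C0_infinity U \<Longrightarrow> (LINT x|lborel. g x * \<phi> x) = 0"
  shows "AE x in lborel. x \<in> U \<longrightarrow> g x = 0"
proof -
  note [measurable] = borel_measurable_integrable[OF g]
  have box: "AE x in lborel. x \<in> cbox a b \<longrightarrow> g x = 0" if cb: "cbox a b \<subseteq> U" for a b
  proof -
    \<comment> \<open>The differentiation theorem needs integrals over all small cubes. The cutoff
      makes them zero over every box of the space, because the intersection of two boxes is a box,
      here one inside \<open>U\<close>.\<close>
    define f where "f x = g x * indicator (cbox a b) x" for x
    have fint: "integrable lborel f" unfolding f_def using integrable_mult_indicator[OF _ g, of "cbox a b"]
      by (simp add: mult.commute)
    have zero: "(f has_integral 0) (cbox c d)" for c d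
    proof -
      have "\<exists>a' b'. cbox a b \<inter> cbox c d = cbox a' b'" by (intro exI) (rule Int_interval)
      then obtain a' b' where ab: "cbox a b \<inter> cbox c d = cbox a' b'" by blast
      have N: "AE x in lborel. x \<notin> cbox a' b' - box a' b'"
      proof -
        have "negligible (cbox a' b' - box a' b')" by (rule negligible_frontier_interval)
        then show ?thesis unfolding negligible_iff_null_sets using AE_not_in AE_completion_iff by blast
      qed
      have "integrable lborel (\<lambda>x. f x * indicator (cbox c d) x)"
        using integrable_mult_indicator[OF _ fint, of "cbox c d"] by (simp add: mult.commute)
      moreover have "(LINT x|lborel. f x * indicator (cbox c d) x) = (LINT x|lborel. g x * indicator (box a' b') x)"
        by (rule integral_cong_AE)
          (use N box_subset_cbox[of a' b'] ab in \<open>auto simp: f_def indicator_def split: if_splits elim!: eventually_mono\<close>)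
      moreover have "\<dots> = 0" by (rule integral_box_eq_0[OF g _ 0]) (use cb ab in auto)
      ultimately have "((\<lambda>x. f x * indicator (cbox c d) x) has_integral 0) UNIV"
        using has_integral_integral_lborel by metis
      moreover have "(\<lambda>x. f x * indicator (cbox c d) x) = (\<lambda>x. if x \<in> cbox c d then f x else 0)" by auto
      ultimately show ?thesis by (simp add: has_integral_restrict_UNIV)
    qed
    obtain N where N: "negligible N"
      and lim: "\<And>x e. \<lbrakk>x \<notin> N; 0 < e\<rbrakk> \<Longrightarrow>
               \<exists>d>0. \<forall>h. 0 < h \<and> h < d \<longrightarrow> norm (integral (cbox x (x + h *\<^sub>R One)) f /\<^sub>R h ^ DIM('a) - f x) < e"
      using integrable_ccontinuous_explicit[of f] zero by (metis has_integral_integrable)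
    have "f x = 0" if xN: "x \<notin> N" for x
    proof (rule ccontr)
      assume "f x \<noteq> 0"
      then obtain d where d: "d > 0" "\<forall>h. 0 < h \<and> h < d \<longrightarrow> norm (integral (cbox x (x + h *\<^sub>R One)) f /\<^sub>R h ^ DIM('a) - f x) < \<bar>f x\<bar>"
        using lim[OF xN, of "\<bar>f x\<bar>"] by auto
      show False using d(2)[rule_format, of "d/2"] d(1) integral_unique[OF zero] by simp
    qed
    moreover have "AE x in lborel. x \<notin> N"
      using N unfolding negligible_iff_null_sets using AE_not_in AE_completion_iff by blast
    moreover have "f x = g x" if "x \<in> cbox a b" for x using that by (simp add: f_def)
    ultimately show ?thesis by (auto elim!: eventually_mono) metis
  qed
  obtain \<D> where D: "countable \<D>" "\<And>X. X \<in> \<D> \<Longrightarrow> \<exists>a b. X = cbox a b" "\<Union>\<D> = U"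
    using open_countable_Union_open_cbox[OF \<open>open U\<close>] by metis
  have "AE x in lborel. \<forall>X\<in>\<D>. x \<in> X \<longrightarrow> g x = 0"
  proof (subst AE_ball_countable[OF D(1)], intro ballI)
    fix X assume X: "X \<in> \<D>"
    then obtain a b where "X = cbox a b" using D(2) by blast
    then show "AE x in lborel. x \<in> X \<longrightarrow> g x = 0" using box X D(3) by blast
  qed
  then show ?thesis using D(3) by (auto elim!: eventually_mono)
qed

section \<open>Weak derivatives on zero sets\<close>

text \<open>A translation preserves the measure of \<open>U\<close>, so the mass that enters equals
  the mass that leaves and it suffices to bound one of them. Since \<open>U\<close> is open, a point
  of \<open>U\<close> stays in \<open>U\<close> under all small shifts, and dominated convergence
  applies.\<close>

lemma integral_abs_shift_diff_indicator:
  fixes U :: "'a::euclidean_space set"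
  assumes U: "open U" "emeasure lborel U < \<infinity>" and c: "c \<longlonglongrightarrow> 0"
  shows "(\<lambda>n. LINT x|lborel. \<bar>indicator U (x + c n) - indicator U x\<bar>) \<longlonglongrightarrow> (0::real)"
proof -
  define F :: "'a \<Rightarrow> real" where "F = indicator U"
  have [measurable]: "F \<in> borel_measurable borel" unfolding F_def using U by simp
  have Fint: "integrable lborel F" unfolding F_def using U by (intro integrable_real_indicator) auto
  have F01: "F x = 0 \<or> F x = 1" for x by (auto simp: F_def indicator_def)
  have prod: "integrable lborel (\<lambda>x. F x * (1 - F (x + c n)))" for n
  proof (rule Bochner_Integration.integrable_bound[OF Fint])
    have "norm (F x * (1 - F (x + c n))) \<le> norm (F x)" for x
      using F01[of x] F01[of "x + c n"] by auto
    then show "AE x in lborel. norm (F x * (1 - F (x + c n))) \<le> norm (F x)" by simp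
  qed simp
  have "(LINT x|lborel. \<bar>F (x + c n) - F x\<bar>) = 2 * (LINT x|lborel. F x * (1 - F (x + c n)))" for n
  proof -
    have "\<bar>F (x + c n) - F x\<bar> = F (x + c n) - F x + 2 * (F x * (1 - F (x + c n)))" for x
      using F01[of x] F01[of "x + c n"] by auto
    then have "(LINT x|lborel. \<bar>F (x + c n) - F x\<bar>)
        = (LINT x|lborel. F (x + c n) - F x + 2 * (F x * (1 - F (x + c n))))" by simp
    also have "\<dots> = (LINT x|lborel. F (x + c n)) - (LINT x|lborel. F x) + 2 * (LINT x|lborel. F x * (1 - F (x + c n)))"
      using Fint prod integrable_lborel_shift[OF Fint] by simp
    finally show ?thesis by (simp add: integral_lborel_shift)
  qed
  moreover have "(\<lambda>n. LINT x|lborel. F x * (1 - F (x + c n))) \<longlonglongrightarrow> (LINT x|(lborel::'a measure). (0::real))"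
  proof (rule integral_dominated_convergence[where w=F])
    show "AE x in lborel. (\<lambda>n. F x * (1 - F (x + c n))) \<longlonglongrightarrow> 0"
    proof (intro AE_I2)
      fix x
      show "(\<lambda>n. F x * (1 - F (x + c n))) \<longlonglongrightarrow> 0"
      proof (cases "x \<in> U")
        case True
        have "(\<lambda>n. x + c n) \<longlonglongrightarrow> x + 0" by (intro tendsto_intros c)
        then have "\<forall>\<^sub>F n in sequentially. x + c n \<in> U" using U(1) True by (auto simp: tendsto_def)
        then have "\<forall>\<^sub>F n in sequentially. F x * (1 - F (x + c n)) = 0"
          by eventually_elim (simp add: F_def)
        then show ?thesis by (rule tendsto_eventually)
      qed (simp add: F_def)
    qed
    have "norm (F x * (1 - F (x + c n))) \<le> F x" for x n
      using F01[of x] F01[of "x + c n"] by auto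
    then show "AE x in lborel. norm (F x * (1 - F (x + c n))) \<le> F x" for n by simp
  qed (use Fint in auto)
  ultimately show ?thesis unfolding F_def[symmetric] by (simp add: tendsto_mult_right_zero)
qed

text \<open>Translations are isometries of the space of integrable functions, so replacing
  \<open>f\<close> by \<open>g\<close> costs their distance twice.\<close>

lemma integral_abs_shift_diff_le:
  fixes f g :: "'a::euclidean_space \<Rightarrow> real"
  assumes f: "integrable lborel f" and g: "integrable lborel g"
  shows "(LINT x|lborel. \<bar>f (x + c) - f x\<bar>)
    \<le> (LINT x|lborel. \<bar>g (x + c) - g x\<bar>) + 2 * (LINT x|lborel. \<bar>f x - g x\<bar>)"
proof -
  note [measurable] = borel_measurable_integrable[OF f] borel_measurable_integrable[OF g]
  have i: "integrable lborel (\<lambda>x. \<bar>f x - g x\<bar>)" "integrable lborel (\<lambda>x. \<bar>f (x + c) - f x\<bar>)"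
    "integrable lborel (\<lambda>x. \<bar>g (x + c) - g x\<bar>)" "integrable lborel (\<lambda>x. \<bar>f (x + c) - g (x + c)\<bar>)"
    using f g integrable_lborel_shift[OF f, of c] integrable_lborel_shift[OF g, of c] by auto
  have "(LINT x|lborel. \<bar>f (x + c) - f x\<bar>)
      \<le> (LINT x|lborel. \<bar>g (x + c) - g x\<bar> + \<bar>f (x + c) - g (x + c)\<bar> + \<bar>f x - g x\<bar>)"
    using i by (intro integral_mono) auto
  also have "\<dots> = (LINT x|lborel. \<bar>g (x + c) - g x\<bar>) + (LINT x|lborel. \<bar>f (x + c) - g (x + c)\<bar>) + (LINT x|lborel. \<bar>f x - g x\<bar>)"
    using i by simp
  also have "(LINT x|lborel. \<bar>f (x + c) - g (x + c)\<bar>) = (LINT x|lborel. \<bar>f x - g x\<bar>)"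
    using integral_lborel_shift[of "\<lambda>x. \<bar>f x - g x\<bar>" c] by simp
  finally show ?thesis by simp
qed

lemma tendsto_0_approx:
  fixes F :: "nat \<Rightarrow> real"
  assumes "\<And>n. F n \<ge> 0" "\<And>e. e > 0 \<Longrightarrow> \<exists>H. H \<longlonglongrightarrow> 0 \<and> (\<forall>n. F n \<le> H n + e)"
  shows "F \<longlonglongrightarrow> 0"
proof (rule LIMSEQ_I)
  fix r :: real assume "r > 0"
  then obtain H where H: "H \<longlonglongrightarrow> 0" "\<And>n. F n \<le> H n + r/2" using assms(2)[of "r/2"] by auto
  obtain N where "\<And>n. n \<ge> N \<Longrightarrow> norm (H n - 0) < r/2" using LIMSEQ_D[OF H(1), of "r/2"] \<open>r > 0\<close> by auto
  then have "norm (F n - 0) < r" if "n \<ge> N" for n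
    using assms(1)[of n] H(2)[of n] that by (fastforce simp: abs_if split: if_splits)
  then show "\<exists>N. \<forall>n\<ge>N. norm (F n - 0) < r" by blast
qed

text \<open>Induction over integrable functions. An indicator is approximated from outside by that
  of an open set, using outer regularity, since the direct argument above needs openness.\<close>

lemma L1_translation_continuous:
  fixes f :: "'a::euclidean_space \<Rightarrow> real"
  assumes "integrable lborel f" "c \<longlonglongrightarrow> 0"
  shows "(\<lambda>n. LINT x|lborel. \<bar>f (x + c n) - f x\<bar>) \<longlonglongrightarrow> 0"
  using assms(1)
proof (induction rule: integrable_induct)
  case (base A r)
  then have A: "A \<in> sets borel" "emeasure lborel A < \<infinity>" by auto
  have iA: "integrable lborel (indicator A :: 'a \<Rightarrow> real)"
    using A by (intro integrable_real_indicator) auto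
  have "(\<lambda>n. LINT x|lborel. \<bar>indicator A (x + c n) - indicator A x\<bar>) \<longlonglongrightarrow> (0::real)"
  proof (rule tendsto_0_approx)
    fix e :: real assume "e > 0"
    then obtain U where U: "open U" "A \<subseteq> U" "emeasure lborel (U - A) < ennreal (e/2)"
      using outer_regular_lborel[of A "e/2"] A by auto
    have "emeasure lborel U \<le> emeasure lborel A + emeasure lborel (U - A)"
      using emeasure_subadditive[of A lborel "U - A"] A U by (simp add: Un_absorb1)
    also have "\<dots> < \<infinity>" using A(2) order_less_trans[OF U(3) ennreal_less_top] by simp
    finally have Ufin: "emeasure lborel U < \<infinity>" .
    have iU: "integrable lborel (indicator U :: 'a \<Rightarrow> real)"
      using U Ufin by (intro integrable_real_indicator) auto
    have "(LINT x|lborel. \<bar>indicator A x - indicator U x\<bar>) = (LINT x|lborel. indicator (U - A) x :: real)"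
      using U(2) by (intro Bochner_Integration.integral_cong refl) (auto simp: indicator_def)
    also have "\<dots> = measure lborel (U - A)" using A U by simp
    also have "\<dots> \<le> e / 2" unfolding measure_def using U(3) \<open>e > 0\<close>
      by (intro enn2real_leI) auto
    finally have "(LINT x|lborel. \<bar>indicator A x - indicator U x\<bar>) \<le> e / 2" .
    then have "(LINT x|lborel. \<bar>indicator A (x + c n) - indicator A x :: real\<bar>)
      \<le> (LINT x|lborel. \<bar>indicator U (x + c n) - indicator U x\<bar>) + e" for n
      using integral_abs_shift_diff_le[OF iA iU, of "c n"] by simp
    then show "\<exists>H. H \<longlonglongrightarrow> 0 \<and> (\<forall>n. (LINT x|lborel. \<bar>indicator A (x + c n) - indicator A x :: real\<bar>) \<le> H n + e)"
      using integral_abs_shift_diff_indicator[OF U(1) Ufin assms(2)] by blast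
  qed simp
  then have "(\<lambda>n. (LINT x|lborel. \<bar>indicator A (x + c n) - indicator A x\<bar>) * \<bar>r\<bar>) \<longlonglongrightarrow> 0"
    by (rule tendsto_mult_left_zero)
  moreover have "\<bar>indicator A (x + c n) * r - indicator A x * r\<bar> = \<bar>indicator A (x + c n) - indicator A x\<bar> * \<bar>r\<bar>" for x n
    by (simp add: abs_mult[symmetric] left_diff_distrib)
  ultimately show ?case by simp
next
  case (add f g)
  have lim0: "(\<lambda>n. (LINT x|lborel. \<bar>f (x + c n) - f x\<bar>) + (LINT x|lborel. \<bar>g (x + c n) - g x\<bar>)) \<longlonglongrightarrow> 0"
    using tendsto_add[OF add.IH] by simp
  have "(LINT x|lborel. \<bar>(f (x + c n) + g (x + c n)) - (f x + g x)\<bar>)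
      \<le> (LINT x|lborel. \<bar>f (x + c n) - f x\<bar>) + (LINT x|lborel. \<bar>g (x + c n) - g x\<bar>)" for n
  proof -
    have i: "integrable lborel (\<lambda>x. f (x + c n) - f x)" "integrable lborel (\<lambda>x. g (x + c n) - g x)"
      by (intro Bochner_Integration.integrable_diff integrable_lborel_shift add.hyps)+
    have "integrable lborel (\<lambda>x. (f (x + c n) - f x) + (g (x + c n) - g x))"
      by (intro Bochner_Integration.integrable_add i)
    then have i3: "integrable lborel (\<lambda>x. (f (x + c n) + g (x + c n)) - (f x + g x))" by (simp add: algebra_simps)
    have "(LINT x|lborel. \<bar>(f (x + c n) + g (x + c n)) - (f x + g x)\<bar>)
      \<le> (LINT x|lborel. \<bar>f (x + c n) - f x\<bar> + \<bar>g (x + c n) - g x\<bar>)"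
      using i i3 by (intro integral_mono Bochner_Integration.integrable_add integrable_abs) auto
    also have "\<dots> = (LINT x|lborel. \<bar>f (x + c n) - f x\<bar>) + (LINT x|lborel. \<bar>g (x + c n) - g x\<bar>)"
      using i by (intro Bochner_Integration.integral_add integrable_abs)
    finally show ?thesis .
  qed
  then have "\<forall>\<^sub>F n in sequentially. norm (LINT x|lborel. \<bar>(f (x + c n) + g (x + c n)) - (f x + g x)\<bar>)
      \<le> (LINT x|lborel. \<bar>f (x + c n) - f x\<bar>) + (LINT x|lborel. \<bar>g (x + c n) - g x\<bar>)"
    by (intro always_eventually allI) simp
  from Lim_null_comparison[OF this lim0] show ?case .
next
  case (lim f s)
  note [measurable] = borel_measurable_integrable[OF lim.hyps(1)] borel_measurable_integrable[OF lim.hyps(4)]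
  have l: "(\<lambda>i. LINT x|lborel. \<bar>f x - s i x\<bar>) \<longlonglongrightarrow> (LINT x|(lborel::'a measure). (0::real))"
  proof (rule integral_dominated_convergence[where w="\<lambda>x. 3 * \<bar>f x\<bar>"])
    show "AE x in lborel. (\<lambda>i. \<bar>f x - s i x\<bar>) \<longlonglongrightarrow> 0"
    proof (intro AE_I2)
      fix x
      have "(\<lambda>i. \<bar>f x - s i x\<bar>) \<longlonglongrightarrow> \<bar>f x - f x\<bar>"
        using lim.hyps(2)[of x] by (intro tendsto_intros) auto
      then show "(\<lambda>i. \<bar>f x - s i x\<bar>) \<longlonglongrightarrow> 0" by simp
    qed
    show "AE x in lborel. norm \<bar>f x - s i x\<bar> \<le> 3 * \<bar>f x\<bar>" for i
    proof (intro AE_I2)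
      fix x show "norm \<bar>f x - s i x\<bar> \<le> 3 * \<bar>f x\<bar>"
        using lim.hyps(3)[of x i] by simp
    qed
  qed (use lim.hyps in auto)
  show ?case
  proof (rule tendsto_0_approx)
    fix e :: real assume "e > 0"
    then have "\<forall>\<^sub>F i in sequentially. (LINT x|lborel. \<bar>f x - s i x\<bar>) < e/2"
      using l by (intro order_tendstoD) auto
    then obtain i where i: "(LINT x|lborel. \<bar>f x - s i x\<bar>) < e/2" by (auto simp: eventually_sequentially)
    have "(LINT x|lborel. \<bar>f (x + c n) - f x\<bar>) \<le> (LINT x|lborel. \<bar>s i (x + c n) - s i x\<bar>) + e" for n
      using integral_abs_shift_diff_le[OF lim.hyps(4,1), of "c n" i] i by simp
    then show "\<exists>H. H \<longlonglongrightarrow> 0 \<and> (\<forall>n. (LINT x|lborel. \<bar>f (x + c n) - f x\<bar>) \<le> H n + e)"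
      using lim.IH[of i] by blast
  qed simp
qed

lemma Ck_on_shift: "Ck_on k UNIV f \<Longrightarrow> Ck_on k UNIV (\<lambda>x. f (x + c))"
proof (induction k arbitrary: f)
  case 0
  then show ?case by (auto intro!: continuous_intros continuous_on_compose2[of UNIV f])
next
  case (Suc k)
  show ?case
  proof (rule Ck_on_SucI[where g="\<lambda>x. gradient f (x + c)"])
    show "GDERIV (\<lambda>x. f (x + c)) x :> gradient f (x + c)" for x
    proof -
      have "(f has_derivative (\<lambda>h. h \<bullet> gradient f (x + c))) (at (x + c))"
        using Suc.prems by (simp add: gderiv_def)
      then show ?thesis unfolding gderiv_def
        by (rule has_derivative_compose[rotated]) (auto intro!: derivative_eq_intros)
    qed
    show "Ck_on k UNIV (\<lambda>x. gradient f (x + c) \<bullet> i)" if "i \<in> Basis" for i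
      using Suc.prems that by (intro Suc.IH[of "\<lambda>x. gradient f x \<bullet> i"]) simp
  qed simp
qed

lemma gradient_shift: "gradient (\<lambda>x. f (x + c)) x = gradient f (x + c)" if "GDERIV f (x + c) :> D"
proof -
  have "(f has_derivative (\<lambda>h. h \<bullet> D)) (at (x + c))" using that by (simp add: gderiv_def)
  then have "GDERIV (\<lambda>x. f (x + c)) x :> D" unfolding gderiv_def
    by (rule has_derivative_compose[rotated]) (auto intro!: derivative_eq_intros)
  then show ?thesis using that by (simp add: gradient_eqI)
qed

lemma C0_infinity_shift:
  assumes "\<phi> \<in> C0_infinity (ball x0 r)" "norm c \<le> s" "r + s \<le> R"
  shows "(\<lambda>x. \<phi> (x + c)) \<in> C0_infinity (ball x0 R)"
proof -
  obtain K where K: "compact K" "K \<subseteq> ball x0 r" "\<And>x. x \<notin> K \<Longrightarrow> \<phi> x = 0"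
    using C0_infinity_support[OF assms(1)] by metis
  show ?thesis
  proof (rule C0_infinityI[of UNIV])
    show "Ck_on k UNIV (\<lambda>x. \<phi> (x + c))" for k by (rule Ck_on_shift[OF C0_infinity_Ck_on[OF assms(1)]])
    show "compact ((+) (- c) ` K)" using K(1) by (rule compact_translation)
    show "(+) (- c) ` K \<subseteq> ball x0 R"
    proof clarify
      fix x assume "x \<in> K"
      then have "dist x0 x < r" using K(2) by auto
      then have "norm (x0 - x) < r" by (simp add: dist_norm)
      have "norm (x0 - (- c + x)) \<le> norm (x0 - x) + norm c"
        using norm_triangle_ineq[of "x0 - x" c] by (simp add: algebra_simps)
      then show "- c + x \<in> ball x0 R" using assms(2,3) \<open>norm (x0 - x) < r\<close> by (simp add: dist_norm)
    qed
    show "\<phi> (x + c) = 0" if x: "x \<notin> (+) (- c) ` K" for x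
    proof (rule K(3), rule)
      assume "x + c \<in> K"
      then have "- c + (x + c) \<in> (+) (- c) ` K" by blast
      then show False using x by simp
    qed
  qed auto
qed

section \<open>Difference quotients as averages of the weak derivative\<close>

abbreviation unit_interval :: "real measure"
  where "unit_interval \<equiv> restrict_space lborel {0..1}"

lemma finite_measure_unit_interval: "finite_measure unit_interval"
  by (rule finite_measureI) (simp add: space_restrict_space emeasure_restrict_space)

interpretation unit_interval: finite_measure unit_interval
  by (rule finite_measure_unit_interval)

interpretation unit_pair: pair_sigma_finite unit_interval "lborel :: 'a::euclidean_space measure"
  by (intro pair_sigma_finite.intro unit_interval.sigma_finite_measure_axioms sigma_finite_lborel)

lemma measurable_unit_id[measurable]: "(\<lambda>t. t) \<in> borel_measurable unit_interval"
  by (rule measurable_restrict_space1) simp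

lemma measure_unit_interval: "measure unit_interval {0..1} = 1"
  by (simp add: measure_restrict_space)

text \<open>The difference quotients of \<open>z\<close> are averages of translates of its weak derivative \<open>Z\<close>, so they tend to
  \<open>Z\<close> in \<open>L\<^sup>1\<close>. If \<open>z \<ge> 0\<close>, then on \<open>{z = 0}\<close> they are nonnegative for positive and nonpositive for negative
  increments, which forces \<open>Z = 0\<close> there.\<close>

context
  fixes z Z :: "'a::euclidean_space \<Rightarrow> real" and x0 i :: 'a and \<delta> :: real
  assumes z: "integrable lborel z" and Z: "integrable lborel Z"
    and \<delta>: "\<delta> > 0" and i: "i \<in> Basis"
    and weak: "\<And>\<phi>. \<phi> \<in> C0_infinity (ball x0 (2 * \<delta>)) \<Longrightarrow>
      (LINT x|lborel. z x * (gradient \<phi> x \<bullet> i)) = - (LINT x|lborel. Z x * \<phi> x)"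
begin

text \<open>Fubini is applied twice below: once with the translation acting on the bounded test
  function, and once, after a change of variables, with the translation acting on the integrable
  factor. The primed variant serves the second use.\<close>

lemma integrable_pair_translate:
  fixes w h :: "'a \<Rightarrow> real"
  assumes w: "integrable lborel w" and [measurable]: "h \<in> borel_measurable borel"
    and B: "\<And>x. \<bar>h x\<bar> \<le> B"
  shows "integrable (unit_interval \<Otimes>\<^sub>M lborel) (\<lambda>(t, x). w x * h (x + (t * s) *\<^sub>R i))"
proof (rule unit_pair.Fubini_integrable)
  note [measurable] = borel_measurable_integrable[OF w]
  show "(\<lambda>(t, x). w x * h (x + (t * s) *\<^sub>R i)) \<in> borel_measurable (unit_interval \<Otimes>\<^sub>M lborel)"
    by measurable
  have B0: "B \<ge> 0" using B[of 0] by simp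
  have bd: "norm (w x * h y) \<le> norm (B * w x)" for x y
    using B[of y] B0 by (simp add: abs_mult mult.commute[of B] mult_left_mono)
  have int: "integrable lborel (\<lambda>x. w x * h (x + c))" for c
    by (rule Bochner_Integration.integrable_bound[of _ "\<lambda>x. B * w x"]) (use bd w in auto)
  then show "AE t in unit_interval. integrable lborel (\<lambda>y. case (t, y) of (t, x) \<Rightarrow> w x * h (x + (t * s) *\<^sub>R i))"
    by simp
  show "integrable unit_interval (\<lambda>t. LINT y|lborel. norm (case (t, y) of (t, x) \<Rightarrow> w x * h (x + (t * s) *\<^sub>R i)))"
  proof (rule unit_interval.integrable_const_bound[where B="LINT x|lborel. norm (B * w x)"])
    show "AE t in unit_interval. norm (LINT y|lborel. norm (case (t, y) of (t, x) \<Rightarrow> w x * h (x + (t * s) *\<^sub>R i))) \<le> (LINT x|lborel. norm (B * w x))"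
    proof (intro AE_I2)
      fix t
      have "(LINT y|lborel. norm (w y * h (y + (t * s) *\<^sub>R i))) \<le> (LINT x|lborel. norm (B * w x))"
        using int w bd by (intro integral_mono) auto
      then show "norm (LINT y|lborel. norm (case (t, y) of (t, x) \<Rightarrow> w x * h (x + (t * s) *\<^sub>R i))) \<le> (LINT x|lborel. norm (B * w x))"
        by simp
    qed
  qed measurable
qed

lemma integrable_pair_translate':
  fixes w h :: "'a \<Rightarrow> real"
  assumes w: "integrable lborel w" and [measurable]: "h \<in> borel_measurable borel"
    and B: "\<And>x. \<bar>h x\<bar> \<le> B"
  shows "integrable (unit_interval \<Otimes>\<^sub>M lborel) (\<lambda>(t, x). w (x + (t * s) *\<^sub>R i) * h x)"
proof (rule unit_pair.Fubini_integrable)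
  note [measurable] = borel_measurable_integrable[OF w]
  show "(\<lambda>(t, x). w (x + (t * s) *\<^sub>R i) * h x) \<in> borel_measurable (unit_interval \<Otimes>\<^sub>M lborel)"
    by measurable
  have B0: "B \<ge> 0" using B[of 0] by simp
  have bd: "norm (w x * h y) \<le> norm (B * w x)" for x y
    using B[of y] B0 by (simp add: abs_mult mult.commute[of B] mult_left_mono)
  have int: "integrable lborel (\<lambda>x. w (x + c) * h x)" for c
    by (rule Bochner_Integration.integrable_bound[of _ "\<lambda>x. B * w (x + c)"])
      (use bd integrable_lborel_shift[OF w, of c] in auto)
  then show "AE t in unit_interval. integrable lborel (\<lambda>y. case (t, y) of (t, x) \<Rightarrow> w (x + (t * s) *\<^sub>R i) * h x)"
    by simp
  show "integrable unit_interval (\<lambda>t. LINT y|lborel. norm (case (t, y) of (t, x) \<Rightarrow> w (x + (t * s) *\<^sub>R i) * h x))"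
  proof (rule unit_interval.integrable_const_bound[where B="LINT x|lborel. norm (B * w x)"])
    show "AE t in unit_interval. norm (LINT y|lborel. norm (case (t, y) of (t, x) \<Rightarrow> w (x + (t * s) *\<^sub>R i) * h x)) \<le> (LINT x|lborel. norm (B * w x))"
    proof (intro AE_I2)
      fix t
      have "(LINT y|lborel. norm (w (y + (t * s) *\<^sub>R i) * h y)) \<le> (LINT x|lborel. norm (B * w (x + (t * s) *\<^sub>R i)))"
        using int integrable_lborel_shift[OF w, of "(t * s) *\<^sub>R i"] bd by (intro integral_mono) auto
      also have "\<dots> = (LINT x|lborel. norm (B * w x))"
        by (rule integral_lborel_shift) measurable
      finally show "norm (LINT y|lborel. norm (case (t, y) of (t, x) \<Rightarrow> w (x + (t * s) *\<^sub>R i) * h x)) \<le> (LINT x|lborel. norm (B * w x))"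
        by simp
    qed
  qed measurable
qed

definition avg :: "real \<Rightarrow> 'a \<Rightarrow> real"
  where "avg s x = (LINT t|unit_interval. Z (x + (t * s) *\<^sub>R i))"

lemma integrable_avg: "integrable lborel (avg s)"
proof -
  have "integrable lborel (\<lambda>x. LINT t|unit_interval. (case (t, x) of (t, x) \<Rightarrow> Z (x + (t * s) *\<^sub>R i) * 1))"
    using unit_pair.integrable_snd[OF integrable_pair_translate'[OF Z, of "\<lambda>x. 1" 1 s]] by simp
  then show ?thesis unfolding avg_def by simp
qed

text \<open>By the fundamental lemma it suffices to test with \<open>\<phi>\<close> supported in the
  ball of radius \<open>\<delta>\<close>. The shift is moved from \<open>z\<close> to
  \<open>\<phi>\<close>, the increment of \<open>\<phi>\<close> is written as an integral of its
  derivative along the segment, and for each translate the weak identity passes the derivative to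
  \<open>Z\<close>. A shift of size at most \<open>\<delta>\<close> keeps the supports in the ball
  of radius \<open>2 * \<delta>\<close>, where that identity holds.\<close>

lemma shift_sub_eq_avg:
  assumes s: "\<bar>s\<bar> \<le> \<delta>"
  shows "AE x in lborel. x \<in> ball x0 \<delta> \<longrightarrow> z (x + s *\<^sub>R i) - z x = s * avg s x"
proof -
  have "AE x in lborel. x \<in> ball x0 \<delta> \<longrightarrow> z (x + s *\<^sub>R i) - z x - s * avg s x = 0"
  proof (rule fundamental_lemma)
    show "integrable lborel (\<lambda>x. z (x + s *\<^sub>R i) - z x - s * avg s x)"
      using z integrable_lborel_shift[OF z, of "s *\<^sub>R i"] integrable_avg by simp
    fix \<phi> assume phi: "\<phi> \<in> C0_infinity (ball x0 \<delta>)"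
    note [measurable] = C0_infinity_borel[OF phi] C0_infinity_gradient_borel[OF phi]
      borel_measurable_integrable[OF z] borel_measurable_integrable[OF Z]
      borel_measurable_integrable[OF integrable_avg]
    obtain B where B: "\<And>x. \<bar>\<phi> x\<bar> \<le> B" "\<And>x. norm (gradient \<phi> x) \<le> B"
      using C0_infinity_bounded[OF phi] by metis
    have Bg: "\<bar>gradient \<phi> x \<bullet> i\<bar> \<le> B" for x
      using B(2)[of x] Basis_le_norm[OF i, of "gradient \<phi> x"] by linarith
    have B0: "B \<ge> 0" using B(1)[of 0] by simp
    have mi: "integrable lborel (\<lambda>x. w x * \<phi> x)" if "integrable lborel w" for w :: "'a \<Rightarrow> real"
    proof (rule Bochner_Integration.integrable_bound[of _ "\<lambda>x. B * w x"])
      show "AE x in lborel. norm (w x * \<phi> x) \<le> norm (B * w x)"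
        using B(1) B0 by (intro AE_I2) (simp add: abs_mult mult.commute[of B] mult_left_mono)
    qed (use that in auto)
    have key: "(LINT x|lborel. z x * (gradient \<phi> (x + (t * (- s)) *\<^sub>R i) \<bullet> i))
        = - (LINT x|lborel. Z (x + (t * s) *\<^sub>R i) * \<phi> x)" if t: "t \<in> {0..1}" for t
    proof -
      let ?c = "(t * (- s)) *\<^sub>R i"
      have "norm ?c = t * \<bar>s\<bar>" using t i by (simp add: abs_mult)
      also have "\<dots> \<le> 1 * \<delta>" using t s by (intro mult_mono) auto
      finally have c: "norm ?c \<le> \<delta>" by simp
      have "(\<lambda>x. \<phi> (x + ?c)) \<in> C0_infinity (ball x0 (2 * \<delta>))"
        by (rule C0_infinity_shift[OF phi c]) simp
      from weak[OF this]
      have "(LINT x|lborel. z x * (gradient \<phi> (x + ?c) \<bullet> i)) = - (LINT x|lborel. Z x * \<phi> (x + ?c))"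
        unfolding gradient_shift[OF C0_infinity_GDERIV[OF phi]] .
      also have "(LINT x|lborel. Z x * \<phi> (x + ?c)) = (LINT x|lborel. Z (x + (t * s) *\<^sub>R i) * \<phi> x)"
        using integral_lborel_shift[of "\<lambda>x. Z x * \<phi> (x + ?c)" "(t * s) *\<^sub>R i"] by (simp add: algebra_simps)
      finally show ?thesis .
    qed
    have FTC: "s * (LINT t|unit_interval. gradient \<phi> (x + (t * (- s)) *\<^sub>R i) \<bullet> i) = \<phi> x - \<phi> (x - s *\<^sub>R i)" for x
    proof -
      have d: "((\<lambda>t. - \<phi> (x + (t * (- s)) *\<^sub>R i)) has_field_derivative s * (gradient \<phi> (x + (t * (- s)) *\<^sub>R i) \<bullet> i)) (at t)" for t
      proof -
        have "((\<lambda>t::real. x + (t * (- s)) *\<^sub>R i) has_derivative (\<lambda>t. (t * (- s)) *\<^sub>R i)) (at t)"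
          by (auto intro!: derivative_eq_intros)
        moreover have "(\<phi> has_derivative (\<lambda>h. h \<bullet> gradient \<phi> (x + (t * (- s)) *\<^sub>R i))) (at (x + (t * (- s)) *\<^sub>R i))"
          using C0_infinity_GDERIV[OF phi] by (simp add: gderiv_def)
        ultimately have "((\<lambda>t. \<phi> (x + (t * (- s)) *\<^sub>R i)) has_derivative
            (\<lambda>r. ((r * (- s)) *\<^sub>R i) \<bullet> gradient \<phi> (x + (t * (- s)) *\<^sub>R i))) (at t)"
          by (rule has_derivative_compose)
        then have "((\<lambda>t. - \<phi> (x + (t * (- s)) *\<^sub>R i)) has_derivative
            (\<lambda>r. - (((r * (- s)) *\<^sub>R i) \<bullet> gradient \<phi> (x + (t * (- s)) *\<^sub>R i)))) (at t)"
          by (rule has_derivative_minus)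
        moreover have "(\<lambda>r. - (((r * (- s)) *\<^sub>R i) \<bullet> gradient \<phi> (x + (t * (- s)) *\<^sub>R i)))
            = (*) (s * (gradient \<phi> (x + (t * (- s)) *\<^sub>R i) \<bullet> i))"
          by (simp add: fun_eq_iff inner_commute)
        ultimately show ?thesis unfolding has_field_derivative_def by simp
      qed
      have c: "isCont (\<lambda>t. s * (gradient \<phi> (x + (t * (- s)) *\<^sub>R i) \<bullet> i)) t" for t
      proof -
        have "continuous_on UNIV (\<lambda>t. gradient \<phi> (x + (t * (- s)) *\<^sub>R i))"
          by (rule continuous_on_compose2[OF C0_infinity_continuous_gradient[OF phi]]) (auto intro!: continuous_intros)
        then show ?thesis
          by (intro continuous_intros) (simp add: continuous_on_eq_continuous_at)
      qed
      have "s * (LINT t|unit_interval. gradient \<phi> (x + (t * (- s)) *\<^sub>R i) \<bullet> i)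
        = (LINT t|lborel. s * (gradient \<phi> (x + (t * (- s)) *\<^sub>R i) \<bullet> i) * indicator {0..1} t)"
        by (subst integral_restrict_space) (simp_all add: mult_ac flip: integral_mult_right_zero)
      also have "\<dots> = - \<phi> (x + (1 * (- s)) *\<^sub>R i) - - \<phi> (x + (0 * (- s)) *\<^sub>R i)"
        by (rule integral_FTC_Icc_real) (use d c in auto)
      finally show ?thesis by simp
    qed
    have zphi: "integrable lborel (\<lambda>x. z x * \<phi> (x - s *\<^sub>R i))"
    proof (rule Bochner_Integration.integrable_bound[of _ "\<lambda>x. B * z x"])
      show "AE x in lborel. norm (z x * \<phi> (x - s *\<^sub>R i)) \<le> norm (B * z x)"
        using B(1) B0 by (intro AE_I2) (simp add: abs_mult mult.commute[of B] mult_left_mono)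
    qed (use z in auto)
    have sh: "(LINT x|lborel. z (x + s *\<^sub>R i) * \<phi> x) = (LINT x|lborel. z x * \<phi> (x - s *\<^sub>R i))"
      using integral_lborel_shift[of "\<lambda>x. z x * \<phi> (x - s *\<^sub>R i)" "s *\<^sub>R i"] by simp
    have "(LINT x|lborel. z (x + s *\<^sub>R i) * \<phi> x - z x * \<phi> x) = (LINT x|lborel. z (x + s *\<^sub>R i) * \<phi> x) - (LINT x|lborel. z x * \<phi> x)"
      by (rule Bochner_Integration.integral_diff) (intro mi z integrable_lborel_shift)+
    also have "\<dots> = (LINT x|lborel. z x * \<phi> (x - s *\<^sub>R i)) - (LINT x|lborel. z x * \<phi> x)" unfolding sh ..
    also have "\<dots> = (LINT x|lborel. z x * \<phi> (x - s *\<^sub>R i) - z x * \<phi> x)"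
      by (rule Bochner_Integration.integral_diff[symmetric]) (intro mi z zphi)+
    also have "\<dots> = (LINT x|lborel. (- s) * (LINT t|unit_interval. z x * (gradient \<phi> (x + (t * (- s)) *\<^sub>R i) \<bullet> i)))"
    proof (intro Bochner_Integration.integral_cong refl)
      fix x
      have "z x * \<phi> (x - s *\<^sub>R i) - z x * \<phi> x = - (z x * (\<phi> x - \<phi> (x - s *\<^sub>R i)))" by (simp add: algebra_simps)
      then show "z x * \<phi> (x - s *\<^sub>R i) - z x * \<phi> x = (- s) * (LINT t|unit_interval. z x * (gradient \<phi> (x + (t * (- s)) *\<^sub>R i) \<bullet> i))"
        unfolding FTC[symmetric] by simp
    qed
    also have "\<dots> = (- s) * (LINT x|lborel. (LINT t|unit_interval. z x * (gradient \<phi> (x + (t * (- s)) *\<^sub>R i) \<bullet> i)))"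
      by (rule integral_mult_right_zero)
    also have "(LINT x|lborel. (LINT t|unit_interval. z x * (gradient \<phi> (x + (t * (- s)) *\<^sub>R i) \<bullet> i)))
       = (LINT t|unit_interval. (LINT x|lborel. z x * (gradient \<phi> (x + (t * (- s)) *\<^sub>R i) \<bullet> i)))"
      using integrable_pair_translate[OF z, of "\<lambda>x. gradient \<phi> x \<bullet> i" B "- s"] Bg
      by (intro unit_pair.Fubini_integral) auto
    also have "\<dots> = (LINT t|unit_interval. - (LINT x|lborel. Z (x + (t * s) *\<^sub>R i) * \<phi> x))"
      by (intro Bochner_Integration.integral_cong refl key) (simp add: space_restrict_space)
    also have "\<dots> = - (LINT t|unit_interval. (LINT x|lborel. Z (x + (t * s) *\<^sub>R i) * \<phi> x))" by simp
    also have "(LINT t|unit_interval. (LINT x|lborel. Z (x + (t * s) *\<^sub>R i) * \<phi> x))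
       = (LINT x|lborel. (LINT t|unit_interval. Z (x + (t * s) *\<^sub>R i) * \<phi> x))"
      using integrable_pair_translate'[OF Z, of \<phi> B s] B(1)
      by (intro unit_pair.Fubini_integral[symmetric]) auto
    also have "\<dots> = (LINT x|lborel. avg s x * \<phi> x)" unfolding avg_def by simp
    finally have main: "(LINT x|lborel. z (x + s *\<^sub>R i) * \<phi> x - z x * \<phi> x) = s * (LINT x|lborel. avg s x * \<phi> x)"
      by simp
    have "(LINT x|lborel. (z (x + s *\<^sub>R i) - z x - s * avg s x) * \<phi> x)
      = (LINT x|lborel. (z (x + s *\<^sub>R i) * \<phi> x - z x * \<phi> x) - s * (avg s x * \<phi> x))"
      by (simp add: algebra_simps)
    also have "\<dots> = (LINT x|lborel. z (x + s *\<^sub>R i) * \<phi> x - z x * \<phi> x) - s * (LINT x|lborel. avg s x * \<phi> x)"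
      by (subst Bochner_Integration.integral_diff)
        (auto intro!: Bochner_Integration.integrable_diff mi z integrable_lborel_shift integrable_avg)
    finally show "(LINT x|lborel. (z (x + s *\<^sub>R i) - z x - s * avg s x) * \<phi> x) = 0" using main by simp
  qed simp
  then show ?thesis by (auto elim!: eventually_mono)
qed

text \<open>The mean of the distances between \<open>Z\<close> and its translates bounds the
  distance from \<open>Z\<close> to the average, by Fubini. Each of them tends to zero by continuity
  of translations, and all are at most twice the norm of \<open>Z\<close>.\<close>

lemma avg_tendsto:
  assumes "s \<longlonglongrightarrow> 0"
  shows "(\<lambda>n. LINT x|lborel. \<bar>avg (s n) x - Z x\<bar>) \<longlonglongrightarrow> 0"
proof -
  note [measurable] = borel_measurable_integrable[OF Z]
  define d where "d n t = (LINT x|lborel. \<bar>Z (x + (t * s n) *\<^sub>R i) - Z x\<bar>)" for n and t :: real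
  have Zi: "integrable lborel (\<lambda>x. Z (x + c) - Z x)" for c
    using Z integrable_lborel_shift[OF Z, of c] by simp
  have pair: "integrable (unit_interval \<Otimes>\<^sub>M lborel) (\<lambda>(t, x). \<bar>Z (x + (t * s n) *\<^sub>R i) - Z x\<bar>)" for n
  proof -
    have "integrable (unit_interval \<Otimes>\<^sub>M lborel) (\<lambda>p. (case p of (t, x) \<Rightarrow> Z (x + (t * s n) *\<^sub>R i) * 1) - (case p of (t, x) \<Rightarrow> Z x * 1))"
      using integrable_pair_translate'[OF Z, of "\<lambda>x. 1" 1] integrable_pair_translate[OF Z, of "\<lambda>x. 1" 1 0]
      by (intro Bochner_Integration.integrable_diff) auto
    then show ?thesis by (simp add: case_prod_unfold)
  qed
  have le: "(LINT x|lborel. \<bar>avg (s n) x - Z x\<bar>) \<le> (LINT t|unit_interval. d n t)" for n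
  proof -
    have "(LINT x|lborel. \<bar>avg (s n) x - Z x\<bar>) \<le> (LINT x|lborel. LINT t|unit_interval. \<bar>Z (x + (t * s n) *\<^sub>R i) - Z x\<bar>)"
    proof (rule integral_mono_AE)
      show "integrable lborel (\<lambda>x. \<bar>avg (s n) x - Z x\<bar>)" using integrable_avg Z by simp
      show "integrable lborel (\<lambda>x. LINT t|unit_interval. \<bar>Z (x + (t * s n) *\<^sub>R i) - Z x\<bar>)"
        using unit_pair.integrable_snd[OF pair] by simp
      have "AE x in lborel. integrable unit_interval (\<lambda>t. case (t, x) of (t, x) \<Rightarrow> Z (x + (t * s n) *\<^sub>R i) * 1)"
        using integrable_pair_translate'[OF Z, of "\<lambda>x. 1" 1] by (intro unit_pair.AE_integrable_snd) auto
      then show "AE x in lborel. \<bar>avg (s n) x - Z x\<bar> \<le> (LINT t|unit_interval. \<bar>Z (x + (t * s n) *\<^sub>R i) - Z x\<bar>)"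
      proof eventually_elim
        case (elim x)
        have "avg (s n) x - Z x = (LINT t|unit_interval. Z (x + (t * s n) *\<^sub>R i) - Z x)"
          unfolding avg_def using elim by (subst Bochner_Integration.integral_diff) (simp_all add: measure_unit_interval space_restrict_space)
        then show ?case using integral_abs_bound by simp
      qed
    qed
    also have "\<dots> = (LINT t|unit_interval. d n t)" unfolding d_def
      by (rule unit_pair.Fubini_integral[OF pair])
    finally show ?thesis .
  qed
  have "(\<lambda>n. LINT t|unit_interval. d n t) \<longlonglongrightarrow> (LINT t|unit_interval. 0)"
  proof (rule integral_dominated_convergence[where w="\<lambda>t. 2 * (LINT x|lborel. \<bar>Z x\<bar>)"])
    show "d n \<in> borel_measurable unit_interval" for n
      unfolding d_def by measurable
    show "AE t in unit_interval. (\<lambda>n. d n t) \<longlonglongrightarrow> 0"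
    proof (intro AE_I2)
      fix t
      have "(\<lambda>n. (t * s n) *\<^sub>R i) \<longlonglongrightarrow> (t * 0) *\<^sub>R i" by (intro tendsto_intros assms)
      then show "(\<lambda>n. d n t) \<longlonglongrightarrow> 0" unfolding d_def
        by (intro L1_translation_continuous[OF Z]) simp
    qed
    show "AE t in unit_interval. norm (d n t) \<le> 2 * (LINT x|lborel. \<bar>Z x\<bar>)" for n
    proof (intro AE_I2)
      fix t
      have "d n t \<le> 2 * (LINT x|lborel. \<bar>Z x\<bar>)"
        unfolding d_def using integral_abs_shift_diff_le[OF Z, of "\<lambda>x. 0"] by simp
      moreover have "d n t \<ge> 0" unfolding d_def by simp
      ultimately show "norm (d n t) \<le> 2 * (LINT x|lborel. \<bar>Z x\<bar>)" by simp
    qed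
  qed simp_all
  then have lim0: "(\<lambda>n. LINT t|unit_interval. d n t) \<longlonglongrightarrow> 0" by simp
  have "\<forall>\<^sub>F n in sequentially. norm (LINT x|lborel. \<bar>avg (s n) x - Z x\<bar>) \<le> (LINT t|unit_interval. d n t)"
    using le by (intro always_eventually allI) simp
  from Lim_null_comparison[OF this lim0] show ?thesis .
qed

lemma weak_derivative_sign:
  assumes nonneg: "\<And>x. z x \<ge> 0" and sg: "\<bar>\<sigma>\<bar> = 1"
  shows "AE x in lborel. x \<in> ball x0 \<delta> \<longrightarrow> z x = 0 \<longrightarrow> \<sigma> * Z x \<ge> 0"
proof -
  note [measurable] = borel_measurable_integrable[OF Z] borel_measurable_integrable[OF z]
    borel_measurable_integrable[OF integrable_avg]
  define s where "s n = \<sigma> * (\<delta> / real (Suc n))" for n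
  have s0: "s \<longlonglongrightarrow> 0"
    using tendsto_mult[OF tendsto_const[of "\<sigma> * \<delta>"] LIMSEQ_Suc[OF lim_1_over_n]] by (simp add: s_def[abs_def] mult.assoc)
  have s: "\<bar>s n\<bar> \<le> \<delta>" for n using \<delta> sg by (simp add: s_def abs_mult divide_simps)
  \<comment> \<open>\<open>g\<close> is the negative part of \<open>\<sigma> * Z\<close> on the zero
    set of \<open>z\<close>. There \<open>\<sigma> * avg (s n)\<close> is nonnegative, so
    \<open>g\<close> is at most the distance between \<open>avg (s n)\<close> and \<open>Z\<close>,
    whose integral tends to zero.\<close>
  define g where "g x = indicator (ball x0 \<delta> \<inter> {x. z x = 0}) x * max (- (\<sigma> * Z x)) 0" for x
  have "{x \<in> space lborel. z x = 0} \<in> sets lborel" by measurable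
  then have [measurable]: "{x. z x = 0} \<in> sets borel" by simp
  have "g \<in> borel_measurable lborel" unfolding g_def[abs_def]
    by (intro borel_measurable_times borel_measurable_indicator borel_measurable_max
        borel_measurable_uminus borel_measurable_const borel_measurable_integrable[OF Z]) simp
  note g_measurable = this
  have gi: "integrable lborel g"
  proof (rule Bochner_Integration.integrable_bound[OF Z g_measurable])
    have "- (\<sigma> * Z x) \<le> \<bar>Z x\<bar>" for x
      using abs_ge_minus_self[of "\<sigma> * Z x"] sg by (simp add: abs_mult)
    then show "AE x in lborel. norm (g x) \<le> norm (Z x)"
      by (intro AE_I2) (auto simp: g_def indicator_def max_def)
  qed
  have "(LINT x|lborel. g x) \<le> (LINT x|lborel. \<bar>avg (s n) x - Z x\<bar>)" for n
  proof (rule integral_mono_AE[OF gi])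
    show "integrable lborel (\<lambda>x. \<bar>avg (s n) x - Z x\<bar>)" using integrable_avg Z by simp
    show "AE x in lborel. g x \<le> \<bar>avg (s n) x - Z x\<bar>"
      using shift_sub_eq_avg[OF s[of n]]
    proof eventually_elim
      case (elim x)
      show ?case
      proof (cases "x \<in> ball x0 \<delta> \<and> z x = 0")
        case True
        then have "s n * avg (s n) x \<ge> 0" using elim nonneg[of "x + s n *\<^sub>R i"] by simp
        then have "\<delta> / real (Suc n) * (\<sigma> * avg (s n) x) \<ge> 0" by (simp add: s_def mult_ac)
        then have "\<sigma> * avg (s n) x \<ge> 0" using \<delta> by (simp add: zero_le_mult_iff zero_le_divide_iff)
        moreover have "\<bar>avg (s n) x - Z x\<bar> = \<bar>\<sigma> * avg (s n) x - \<sigma> * Z x\<bar>"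
          using sg by (simp add: abs_mult flip: right_diff_distrib)
        ultimately show ?thesis by (auto simp: g_def max_def indicator_def)
      qed (auto simp: g_def)
    qed
  qed
  then have "(LINT x|lborel. g x) \<le> 0"
    using avg_tendsto[OF s0] by (intro LIMSEQ_le_const) auto
  moreover have g0: "g x \<ge> 0" for x by (simp add: g_def)
  then have "(LINT x|lborel. g x) \<ge> 0" by simp
  ultimately have "(LINT x|lborel. g x) = 0" by simp
  then have "AE x in lborel. g x = 0" using integral_nonneg_eq_0_iff_AE[OF gi] g0 by simp
  then show ?thesis by eventually_elim (auto simp: g_def max_def split: if_splits)
qed

lemma weak_derivative_zero:
  assumes nonneg: "\<And>x. z x \<ge> 0"
  shows "AE x in lborel. x \<in> ball x0 \<delta> \<longrightarrow> z x = 0 \<longrightarrow> Z x = 0"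
proof -
  have "\<bar>1::real\<bar> = 1" "\<bar>-1::real\<bar> = 1" by simp_all
  from weak_derivative_sign[OF nonneg this(1)] weak_derivative_sign[OF nonneg this(2)]
  show ?thesis by eventually_elim force
qed

end

section \<open>Inequalities and integrals for the radial barrier\<close>

lemma powr_minus_2_mult: "x \<ge> 0 \<Longrightarrow> x powr (p - 2) * x = x powr (p - 1)" for x p :: real
  using powr_add[of x "p - 2" 1] by (cases "x = 0") auto

lemma powr_minus_1_mult: "x \<ge> 0 \<Longrightarrow> x powr (p - 1) * x = x powr p" for x p :: real
  using powr_add[of x "p - 1" 1] by (cases "x = 0") auto

lemma p_Young:
  fixes A B :: "'a::real_inner"
  assumes p: "1 < p"
  shows "p * (norm A powr (p - 2) *\<^sub>R A \<bullet> B) \<le> (p - 1) * norm A powr p + norm B powr p"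
proof -
  have "norm A powr (p - 2) *\<^sub>R A \<bullet> B \<le> norm A powr (p - 2) * (norm A * norm B)"
    using norm_cauchy_schwarz[of A B] by (simp add: mult_left_mono)
  also have "\<dots> = norm A powr (p - 1) * norm B"
    using powr_minus_2_mult[of "norm A" p] by (simp add: mult.assoc[symmetric])
  also have "\<dots> \<le> (norm A powr (p - 1)) powr (p / (p - 1)) / (p / (p - 1)) + norm B powr p / p"
    using p by (intro Youngs_inequality) (auto simp: field_simps)
  also have "(norm A powr (p - 1)) powr (p / (p - 1)) = norm A powr p"
    using p by (simp add: powr_powr)
  finally show ?thesis using p by (simp add: field_simps)
qed

text \<open>Applied with \<open>A = T \<nabla>u\<close>, \<open>B = \<nabla>w\<close>, \<open>h' = T h'(T)\<close>, where \<open>T = w / (u + \<epsilon>)\<close>; both sides then come from test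
  functions of Diaz-Saa type.\<close>

lemma picone_inequality:
  fixes A B :: "'a::real_inner"
  assumes p: "1 < p" and h: "h \<ge> 0" "h' \<ge> 0"
  shows "(norm A powr (p - 2) *\<^sub>R A) \<bullet> (h *\<^sub>R B + ((p - 1) * h + h') *\<^sub>R (B - A))
    \<le> (norm B powr (p - 2) *\<^sub>R B) \<bullet> (h *\<^sub>R B + h' *\<^sub>R (B - A))"
proof -
  let ?X = "norm A powr (p - 2) *\<^sub>R A" and ?Y = "norm B powr (p - 2) *\<^sub>R B"
  have XA: "norm C powr (p - 2) *\<^sub>R C \<bullet> C = norm C powr p" for C :: 'a
    using powr_minus_2_mult[of "norm C" p] powr_minus_1_mult[of "norm C" p]
    by (simp add: dot_square_norm power2_eq_square mult.assoc[symmetric])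
  have 1: "p * (?X \<bullet> B) \<le> (p - 1) * norm A powr p + norm B powr p" by (rule p_Young[OF p])
  have 2: "p * (?Y \<bullet> A) \<le> (p - 1) * norm B powr p + norm A powr p" by (rule p_Young[OF p])
  have "p * (?X \<bullet> B + ?Y \<bullet> A) \<le> p * (norm A powr p + norm B powr p)"
    using 1 2 by (simp add: algebra_simps)
  then have 3: "?X \<bullet> B + ?Y \<bullet> A \<le> norm A powr p + norm B powr p" using p by simp
  \<comment> \<open>The part with \<open>h\<close> is one Young inequality. The part with
    \<open>h'\<close> equals \<open>- h'\<close> times the inner product of \<open>?X - ?Y\<close>
    with \<open>A - B\<close>, so its sign is the monotonicity of the p-Laplace field; it comes from
    adding the two Young inequalities.\<close>
  have "?X \<bullet> (h *\<^sub>R B + ((p - 1) * h + h') *\<^sub>R (B - A)) - ?Y \<bullet> (h *\<^sub>R B + h' *\<^sub>R (B - A))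
     = h * (p * (?X \<bullet> B) - (p - 1) * (?X \<bullet> A) - ?Y \<bullet> B)
       + h' * (?X \<bullet> B + ?Y \<bullet> A - ?X \<bullet> A - ?Y \<bullet> B)"
    by (simp only: inner_add_right inner_diff_right inner_scaleR_right) (simp add: algebra_simps)
  also have "\<dots> = h * (p * (?X \<bullet> B) - (p - 1) * norm A powr p - norm B powr p)
       + h' * (?X \<bullet> B + ?Y \<bullet> A - norm A powr p - norm B powr p)" unfolding XA ..
  also have "\<dots> \<le> 0"
    using mult_nonneg_nonpos[OF h(1), of "p * (?X \<bullet> B) - (p - 1) * norm A powr p - norm B powr p"]
      mult_nonneg_nonpos[OF h(2), of "?X \<bullet> B + ?Y \<bullet> A - norm A powr p - norm B powr p"] 1 3 by linarith
  finally show ?thesis by simp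
qed

text \<open>The constant \<open>\<mu>\<close> for which \<open>norm x powr (- \<gamma>)\<close> solves the equation with \<open>f = 0\<close>.\<close>

definition hardy_const :: "real \<Rightarrow> real \<Rightarrow> real \<Rightarrow> real"
  where "hardy_const N p \<gamma> = \<gamma> powr (p - 1) * (N - p - (p - 1) * \<gamma>)"

lemma hardy_root_iff:
  "hardy_root TYPE('a::euclidean_space) p \<mu> \<gamma> \<longleftrightarrow> \<gamma> \<ge> 0 \<and> hardy_const (real DIM('a)) p \<gamma> = \<mu>"
proof -
  have "\<gamma> powr (p - 2) * ((p - 1) * \<gamma>\<^sup>2 - (real DIM('a) - p) * \<gamma>) = - hardy_const (real DIM('a)) p \<gamma>" if "\<gamma> \<ge> 0"
  proof -
    have "\<gamma> powr (p - 2) * ((p - 1) * \<gamma>\<^sup>2 - (real DIM('a) - p) * \<gamma>)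
      = (\<gamma> powr (p - 2) * \<gamma>) * ((p - 1) * \<gamma> - (real DIM('a) - p))"
      by (simp add: power2_eq_square algebra_simps)
    then show ?thesis unfolding powr_minus_2_mult[OF that] hardy_const_def by (simp add: algebra_simps)
  qed
  then show ?thesis unfolding hardy_root_def by auto
qed

section \<open>Monotonicity of the Hardy constant in the exponent\<close>

lemma hardy_const_deriv:
  assumes "\<gamma> > 0"
  shows "(hardy_const N p has_field_derivative (p - 1) * \<gamma> powr (p - 2) * (N - p - p * \<gamma>)) (at \<gamma>)"
proof -
  have "((\<lambda>\<gamma>. \<gamma> powr (p - 1) * (N - p - (p - 1) * \<gamma>)) has_field_derivative
     ((p - 1) * \<gamma> powr (p - 1 - 1)) * (N - p - (p - 1) * \<gamma>) + (- (p - 1)) * \<gamma> powr (p - 1)) (at \<gamma>)"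
    using assms by (auto intro!: derivative_eq_intros)
  moreover have "\<gamma> powr (p - 1) = \<gamma> powr (p - 2) * \<gamma>" using powr_minus_2_mult[of \<gamma> p] assms by simp
  ultimately show ?thesis unfolding hardy_const_def[abs_def] by (simp add: algebra_simps)
qed

text \<open>The derivative has the sign of \<open>N - p - p * \<gamma>\<close>, so
  \<open>hardy_const\<close> peaks at \<open>(N - p) / p\<close>, where its value is
  \<open>((N - p) / p) powr p\<close>, the constant of Hardy's inequality.\<close>

lemma hardy_const_decreasing:
  assumes p: "1 < p" "p < N" and g: "(N - p) / p \<le> a" "a < b"
  shows "hardy_const N p b < hardy_const N p a"
proof (rule DERIV_neg_imp_decreasing_open[OF g(2)])
  have a: "a > 0" using p g(1) by (meson diff_gt_0_iff_gt divide_pos_pos less_le_trans less_trans zero_less_one)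
  fix x assume x: "a < x" "x < b"
  have "N - p \<le> p * a" using g(1) p by (simp add: field_simps)
  then have "N - p - p * x < 0" using x p by (smt (verit) mult_strict_left_mono)
  then have "(p - 1) * x powr (p - 2) * (N - p - p * x) < 0"
    using p x a by (intro mult_pos_neg mult_pos_pos) auto
  then show "\<exists>y. (hardy_const N p has_real_derivative y) (at x) \<and> y < 0"
    using hardy_const_deriv[of x N p] x a by (intro exI[of _ "(p - 1) * x powr (p - 2) * (N - p - p * x)"]) auto
next
  have a: "a > 0" using p g(1) by (meson diff_gt_0_iff_gt divide_pos_pos less_le_trans less_trans zero_less_one)
  show "continuous_on {a..b} (hardy_const N p)"
    using a by (intro continuous_at_imp_continuous_on ballI DERIV_isCont[OF hardy_const_deriv]) auto
qed

lemma hardy_const_increasing: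
  assumes p: "1 < p" "p < N" and g: "0 \<le> a" "a < b" "b \<le> (N - p) / p"
  shows "hardy_const N p a < hardy_const N p b"
proof (rule DERIV_pos_imp_increasing_open[OF g(2)])
  fix x assume x: "a < x" "x < b"
  have "p * b \<le> N - p" using g(3) p by (simp add: field_simps)
  then have "N - p - p * x > 0" using x p by (smt (verit) mult_strict_left_mono)
  then have "(p - 1) * x powr (p - 2) * (N - p - p * x) > 0"
    using p x g by (intro mult_pos_pos) auto
  then show "\<exists>y. (hardy_const N p has_real_derivative y) (at x) \<and> y > 0"
    using hardy_const_deriv[of x N p] x g by (intro exI[of _ "(p - 1) * x powr (p - 2) * (N - p - p * x)"]) auto
next
  show "continuous_on {a..b} (hardy_const N p)"
    unfolding hardy_const_def[abs_def] using p g
    by (intro continuous_intros continuous_on_powr') auto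
qed

text \<open>Two different exponents with the same value cannot both lie on the increasing branch, so
  the larger one is beyond the peak.\<close>

lemma hardy_roots:
  assumes p: "1 < p" "p < N" and "0 \<le> \<gamma>1" "\<gamma>1 < \<gamma>2" "hardy_const N p \<gamma>1 = hardy_const N p \<gamma>2"
  shows "(N - p) / p < \<gamma>2"
  using hardy_const_increasing[OF p assms(3,4)] assms(5) by force

text \<open>\<open>(N - p) / (p - 1)\<close> is the exponent of the fundamental solution. A power
  decaying faster is a strict subsolution of the p-Laplace equation without any potential.\<close>

lemma hardy_const_neg:
  assumes p: "1 < p" "p < N" and "(N - p) / (p - 1) < \<gamma>"
  shows "hardy_const N p \<gamma> < 0"
proof -
  have "0 < (N - p) / (p - 1)" using p by simp
  then have "\<gamma> > 0" using assms(3) by linarith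
  moreover have "N - p - (p - 1) * \<gamma> < 0" using assms(3) p by (simp add: field_simps)
  ultimately show ?thesis unfolding hardy_const_def by (intro mult_pos_neg) auto
qed

text \<open>Comparison with a geometric series: on the shell where \<open>norm x\<close> lies
  between \<open>r * 2 ^ j\<close> and \<open>r * 2 ^ Suc j\<close> the integrand is at most
  \<open>b j\<close>, and the ball \<open>B j\<close> containing this shell has volume proportional
  to \<open>2 ^ (N * j)\<close>. The ratio \<open>2 powr (N - q)\<close> is below 1.\<close>

lemma integrable_powr_exterior:
  fixes r q :: real
  assumes r: "r > 0" and q: "q > real DIM('a)"
  shows "integrable lborel (\<lambda>x::'a::euclidean_space. indicator {x. r \<le> norm x} x * norm x powr (- q))"
proof (rule integrableI_bounded)
  define b where "b j = (r * 2 ^ j) powr (- q)" for j :: nat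
  define B where "B j = (ball 0 (r * 2 ^ Suc j) :: 'a set)" for j
  have [measurable]: "B j \<in> sets borel" for j by (simp add: B_def)
  define V where "V = measure lborel (ball (0::'a) 1)"
  define N where "N = DIM('a)"
  show "(\<lambda>x::'a. indicator {x. r \<le> norm x} x * norm x powr (- q)) \<in> borel_measurable lborel"
    by measurable
  have pw: "ennreal (norm (indicator {x. r \<le> norm x} x * norm x powr (- q))) \<le> (\<Sum>j. ennreal (b j * indicator (B j) x))" for x :: 'a
  proof (cases "r \<le> norm x")
    case True
    define j where "j = nat \<lfloor>log 2 (norm x / r)\<rfloor>"
    have x0: "norm x / r \<ge> 1" using True r by simp
    have "real j \<le> log 2 (norm x / r)" "log 2 (norm x / r) < real (Suc j)"
      using x0 unfolding j_def by (auto simp: zero_le_log_cancel_iff) linarith+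
    then have "2 powr real j \<le> norm x / r" "norm x / r < 2 powr real (Suc j)"
      using x0 by (simp_all add: le_log_iff log_less_iff)
    then have j: "r * 2 ^ j \<le> norm x" "norm x < r * 2 ^ Suc j"
      using r by (simp_all only: powr_realpow zero_less_numeral) (simp_all add: field_simps)
    have "norm x powr (- q) \<le> b j" unfolding b_def
      using j(1) r q by (intro powr_mono2') auto
    then have "ennreal (norm (indicator {x. r \<le> norm x} x * norm x powr (- q))) \<le> ennreal (b j * indicator (B j) x)"
      using True j(2) by (intro ennreal_leI) (simp add: B_def)
    also have "\<dots> \<le> (\<Sum>j. ennreal (b j * indicator (B j) x))"
      using sum_le_suminf[of "\<lambda>j. ennreal (b j * indicator (B j) x)" "{j}"] by simp
    finally show ?thesis .
  qed simp
  have tm: "b j * measure lborel (B j) = (r powr (- q) * (2 * r) ^ N * V) * (2 powr (real N - q)) ^ j" for j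
  proof -
    have "measure lborel (B j) = (r * 2 ^ Suc j) ^ N * V"
      unfolding B_def V_def N_def using r by (subst content_ball_conv_unit_ball) auto
    moreover have "(r * 2 ^ Suc j) ^ N = (2 * r) ^ N * (2 ^ N) ^ j"
    proof -
      have "((2::real) ^ j) ^ N = (2 ^ N) ^ j" by (metis power_mult mult.commute)
      then show ?thesis by (simp add: power_mult_distrib)
    qed
    moreover have "b j = r powr (- q) * (2 powr (- q)) ^ j"
      unfolding b_def using r by (simp add: powr_mult powr_realpow[symmetric] powr_powr mult.commute)
    moreover have "2 powr (real N - q) = 2 ^ N * 2 powr (- q)"
      by (simp add: powr_diff powr_minus powr_realpow divide_inverse)
    moreover have "((2::real) ^ j) ^ N = (2 ^ N) ^ j" by (metis power_mult mult.commute)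
    ultimately show ?thesis by (simp add: power_mult_distrib mult_ac)
  qed
  have sm: "summable (\<lambda>j. b j * measure lborel (B j))"
    unfolding tm using q by (intro summable_mult summable_geometric) (simp add: N_def powr_less_one)
  have b0: "b j \<ge> 0" for j by (simp add: b_def)
  have "(\<integral>\<^sup>+ x. ennreal (norm (indicator {x. r \<le> norm x} x * norm x powr (- q))) \<partial>(lborel::'a measure))
      \<le> (\<integral>\<^sup>+ x. (\<Sum>j. ennreal (b j * indicator (B j) x)) \<partial>lborel)"
    by (rule nn_integral_mono) (rule pw)
  also have "\<dots> = (\<Sum>j. \<integral>\<^sup>+ x. ennreal (b j * indicator (B j) x) \<partial>lborel)"
    by (rule nn_integral_suminf) measurable
  also have "\<dots> = (\<Sum>j. ennreal (b j * measure lborel (B j)))"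
  proof (intro suminf_cong)
    fix j
    have "(\<integral>\<^sup>+ x. ennreal (b j * indicator (B j) x) \<partial>lborel) = (\<integral>\<^sup>+ x. ennreal (b j) * indicator (B j) x \<partial>lborel)"
      by (intro nn_integral_cong) (auto simp: indicator_def)
    also have "\<dots> = ennreal (b j) * emeasure lborel (B j)" by (simp add: nn_integral_cmult_indicator B_def)
    also have "\<dots> = ennreal (b j) * ennreal (measure lborel (B j))"
      using emeasure_lborel_ball_finite[of "0::'a" "r * 2 ^ Suc j"] by (simp add: B_def emeasure_eq_ennreal_measure less_top)
    finally show "(\<integral>\<^sup>+ x. ennreal (b j * indicator (B j) x) \<partial>lborel) = ennreal (b j * measure lborel (B j))"
      using b0 by (simp add: ennreal_mult)
  qed
  also have "\<dots> = ennreal (\<Sum>j. b j * measure lborel (B j))"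
    by (rule suminf_ennreal2) (use b0 sm in auto)
  also have "\<dots> < \<infinity>" by simp
  finally show "(\<integral>\<^sup>+ x. ennreal (norm (indicator {x. r \<le> norm x} x * norm x powr (- q))) \<partial>(lborel::'a measure)) < \<infinity>" .
qed

section \<open>Powers of the norm and the divergence of a radial field\<close>

lemma Ck_on_norm_powr: "Ck_on k (- {0}) (\<lambda>x::'a::euclidean_space. norm x powr a)"
proof -
  have "Ck_on k (- {0}) (\<lambda>x::'a. \<Sum>i\<in>Basis. (x \<bullet> i) * (x \<bullet> i))"
    by (intro Ck_on_sum Ck_on_mult Ck_on_inner) auto
  then have "Ck_on k (- {0}) (\<lambda>x::'a. x \<bullet> x)" by (simp add: euclidean_inner[symmetric])
  moreover have "(\<lambda>x::'a. x \<bullet> x) ` (- {0}) \<subseteq> {0<..}" by auto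
  ultimately have "Ck_on k (- {0}) (\<lambda>x::'a. (x \<bullet> x) powr (a / 2))"
    by (intro Ck_on_compose[OF _ _ Ck_on_powr[of k "a / 2"]]) (auto simp: open_Compl)
  moreover have "(x \<bullet> x) powr (a / 2) = norm x powr a" for x :: 'a
  proof -
    have "x \<bullet> x = norm x powr 2" by (simp add: dot_square_norm)
    then show ?thesis by (simp only: powr_powr) simp
  qed
  ultimately show ?thesis by simp
qed

lemma GDERIV_norm_powr:
  fixes x :: "'a::euclidean_space"
  assumes "x \<noteq> 0"
  shows "GDERIV (\<lambda>x. norm x powr a) x :> (a * norm x powr (a - 2)) *\<^sub>R x"
proof -
  have "((\<lambda>t. t powr a) has_real_derivative a * norm x powr (a - 1)) (at (norm x))"
    using assms by (intro has_real_derivative_powr) simp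
  from GDERIV_DERIV_compose[OF GDERIV_norm[OF assms] this]
  have "GDERIV (\<lambda>x. norm x powr a) x :> (a * norm x powr (a - 1)) *\<^sub>R sgn x" .
  moreover have "norm x powr (a - 1) / norm x = norm x powr (a - 2)"
    using assms powr_diff[of "norm x" "a - 1" 1] by simp
  ultimately show ?thesis by (simp add: sgn_div_norm divide_inverse mult.assoc)
qed

text \<open>The field \<open>norm x powr (- \<sigma>) *\<^sub>R x\<close> has divergence
  \<open>(N - \<sigma>) * norm x powr (- \<sigma>)\<close>. The functions \<open>g i\<close> are the
  components of \<open>\<phi>\<close> times this field; they are test functions, as the support
  avoids the pole, so their partial derivatives integrate to zero.\<close>

lemma radial_field_integration_by_parts:
  fixes \<phi> :: "'a::euclidean_space \<Rightarrow> real"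
  assumes phi: "\<phi> \<in> C0_infinity \<Omega>" and "0 \<notin> \<Omega>"
  shows "integrable lborel (\<lambda>x. norm x powr (- \<sigma>) * \<phi> x)" (is ?A)
    and "integrable lborel (\<lambda>x. norm x powr (- \<sigma>) * (x \<bullet> gradient \<phi> x))" (is ?B)
    and "(LINT x|lborel. norm x powr (- \<sigma>) * (x \<bullet> gradient \<phi> x))
      = - (real DIM('a) - \<sigma>) * (LINT x|lborel. norm x powr (- \<sigma>) * \<phi> x)" (is ?C)
proof -
  obtain K where K: "compact K" "K \<subseteq> \<Omega>" "\<And>x. x \<notin> K \<Longrightarrow> \<phi> x = 0" "\<And>x. x \<notin> K \<Longrightarrow> gradient \<phi> x = 0"
    using C0_infinity_support[OF phi] by metis
  have K0: "K \<subseteq> - {0}" using K assms(2) by auto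
  define w where "w x = norm x powr (- \<sigma>)" for x :: 'a
  have wC: "Ck_on k (- {0}) w" for k unfolding w_def[abs_def] by (rule Ck_on_norm_powr)
  have op: "open (- {0::'a})" by (simp add: open_Compl)
  have wphi: "(\<lambda>x. w x * \<phi> x) \<in> C0_infinity \<Omega>"
    by (rule C0_infinityI[OF op _ K(1) K0 K(2)]) (auto intro!: Ck_on_mult op wC C0_infinity_Ck_on[OF phi] simp: K(3))
  define g where "g i x = (x \<bullet> i) * (w x * \<phi> x)" for i x
  have gC: "g i \<in> C0_infinity \<Omega>" for i unfolding g_def[abs_def]
    by (rule C0_infinityI[OF op _ K(1) K0 K(2)])
      (auto intro!: Ck_on_mult Ck_on_inner op wC C0_infinity_Ck_on[OF phi] simp: K(3))
  show ?A using continuous_compact_support_integrable[OF C0_infinity_continuous[OF wphi] K(1)] K(3)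
    by (simp add: w_def)
  have gint: "integrable lborel (\<lambda>x. gradient (g i) x \<bullet> i)" for i
  proof -
    obtain K' where K': "compact K'" "\<And>x. x \<notin> K' \<Longrightarrow> gradient (g i) x = 0"
      using C0_infinity_support[OF gC[of i]] by metis
    show ?thesis using K' by (intro continuous_compact_support_integrable[OF _ K'(1)]
        continuous_on_inner continuous_on_const C0_infinity_continuous_gradient[OF gC]) auto
  qed
  have sum: "(\<Sum>i\<in>Basis. gradient (g i) x \<bullet> i) = w x * (x \<bullet> gradient \<phi> x) + (real DIM('a) - \<sigma>) * (w x * \<phi> x)" for x
  proof (cases "x \<in> K")
    case True
    then have x: "x \<noteq> 0" using K0 by auto
    let ?dw = "(- \<sigma> * norm x powr (- \<sigma> - 2)) *\<^sub>R x"
    have dw: "GDERIV w x :> ?dw" unfolding w_def[abs_def] by (rule GDERIV_norm_powr[OF x])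
    have gr: "gradient (g i) x = (x \<bullet> i) *\<^sub>R (w x *\<^sub>R gradient \<phi> x + \<phi> x *\<^sub>R ?dw) + (w x * \<phi> x) *\<^sub>R i" for i
      unfolding g_def[abs_def]
      by (intro gradient_eqI GDERIV_mult GDERIV_inner C0_infinity_GDERIV[OF phi] dw)
    have e1: "(\<Sum>i\<in>Basis. (x \<bullet> i) * (v \<bullet> i)) = x \<bullet> v" for v :: 'a by (rule euclidean_inner[symmetric])
    have "(\<Sum>i\<in>Basis. gradient (g i) x \<bullet> i)
        = (\<Sum>i\<in>Basis. (x \<bullet> i) * ((w x *\<^sub>R gradient \<phi> x + \<phi> x *\<^sub>R ?dw) \<bullet> i) + w x * \<phi> x)"
      by (intro sum.cong refl) (simp add: gr inner_add_left inner_Basis)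
    also have "\<dots> = x \<bullet> (w x *\<^sub>R gradient \<phi> x + \<phi> x *\<^sub>R ?dw) + real DIM('a) * (w x * \<phi> x)"
      by (simp add: sum.distrib e1)
    also have "x \<bullet> (w x *\<^sub>R gradient \<phi> x + \<phi> x *\<^sub>R ?dw) = w x * (x \<bullet> gradient \<phi> x) - \<sigma> * (\<phi> x * (norm x powr (- \<sigma> - 2) * (norm x)\<^sup>2))"
      by (simp add: inner_add_right dot_square_norm algebra_simps)
    also have "norm x powr (- \<sigma> - 2) * (norm x)\<^sup>2 = w x"
      using x powr_add[of "norm x" "- \<sigma> - 2" 2] by (simp add: w_def)
    finally show ?thesis by (simp add: algebra_simps)
  next
    case False
    have "gradient (g i) x = 0" for i
    proof -
      have "x \<in> - K" "open (- K)" using False K(1) by (auto simp: compact_imp_closed open_Compl)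
      then have "gradient (g i) x = gradient (\<lambda>x. 0) x"
        by (intro gradient_cong_open[of "- K"]) (auto simp: g_def K(3))
      also have "\<dots> = 0" by (intro gradient_eqI GDERIV_const)
      finally show ?thesis .
    qed
    then show ?thesis using K False by simp
  qed
  have "integrable lborel (\<lambda>x. (\<Sum>i\<in>Basis. gradient (g i) x \<bullet> i) - (real DIM('a) - \<sigma>) * (w x * \<phi> x))"
    using \<open>?A\<close> gint by (intro Bochner_Integration.integrable_diff Bochner_Integration.integrable_sum integrable_mult_right)
       (auto simp: w_def)
  then show ?B unfolding sum by (simp add: w_def)
  have "0 = (LINT x|lborel. (\<Sum>i\<in>Basis. gradient (g i) x \<bullet> i))"
    using gint integral_gradient_eq_0[OF gC] by (subst Bochner_Integration.integral_sum) auto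
  also have "\<dots> = (LINT x|lborel. w x * (x \<bullet> gradient \<phi> x)) + (real DIM('a) - \<sigma>) * (LINT x|lborel. w x * \<phi> x)"
    unfolding sum using \<open>?A\<close> \<open>?B\<close> by (subst Bochner_Integration.integral_add) (auto simp: w_def)
  finally show ?C by (simp add: w_def algebra_simps)
qed

text \<open>Indices are chosen so that the integrals are summable; the sum of the chosen functions
  is then an integrable majorant, finite almost everywhere. \<open>r\<close> need not be increasing:
  convergence to zero follows from summability alone.\<close>

lemma dominated_subsequence:
  fixes f :: "nat \<Rightarrow> 'a \<Rightarrow> real"
  assumes int: "\<And>n. integrable M (f n)" and nn: "\<And>n x. f n x \<ge> 0"
    and lim: "(\<lambda>n. LINT x|M. f n x) \<longlonglongrightarrow> 0"
  obtains r g where "integrable M g" "AE x in M. \<forall>n. f (r n) x \<le> g x" "AE x in M. (\<lambda>n. f (r n) x) \<longlonglongrightarrow> 0"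
proof -
  have "\<exists>m. (LINT x|M. f m x) \<le> (1/2) ^ n" for n :: nat
  proof -
    have "\<forall>\<^sub>F m in sequentially. (LINT x|M. f m x) < (1/2) ^ n" using lim by (rule order_tendstoD) simp
    then show ?thesis by (auto simp: eventually_sequentially intro: less_imp_le)
  qed
  then obtain r where r: "\<And>n. (LINT x|M. f (r n) x) \<le> (1/2) ^ n" by metis
  have sm: "summable (\<lambda>n. LINT x|M. f (r n) x)"
    by (rule summable_comparison_test'[of "\<lambda>n. (1/2) ^ n" 0]) (use r nn in \<open>auto simp: summable_geometric\<close>)
  have [measurable]: "f n \<in> borel_measurable M" for n using int by auto
  have "(\<integral>\<^sup>+x. (\<Sum>n. ennreal (f (r n) x)) \<partial>M) = (\<Sum>n. \<integral>\<^sup>+x. ennreal (f (r n) x) \<partial>M)"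
    by (rule nn_integral_suminf) measurable
  also have "\<dots> = (\<Sum>n. ennreal (LINT x|M. f (r n) x))"
    by (intro suminf_cong nn_integral_eq_integral int) (simp add: nn)
  also have "\<dots> = ennreal (\<Sum>n. LINT x|M. f (r n) x)"
    by (rule suminf_ennreal2[OF _ sm]) (simp add: nn)
  finally have "(\<integral>\<^sup>+x. (\<Sum>n. ennreal (f (r n) x)) \<partial>M) \<noteq> \<infinity>" by simp
  then have "AE x in M. (\<Sum>n. ennreal (f (r n) x)) \<noteq> \<infinity>"
    by (intro nn_integral_PInf_AE) measurable
  then have AE: "AE x in M. summable (\<lambda>n. f (r n) x)"
    by eventually_elim (intro summable_suminf_not_top, auto simp: nn)
  show ?thesis
  proof
    show "integrable M (\<lambda>x. \<Sum>n. f (r n) x)"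
      by (rule integrable_suminf) (use int AE sm nn in auto)
    show "AE x in M. \<forall>n. f (r n) x \<le> (\<Sum>n. f (r n) x)"
      using AE
    proof eventually_elim
      case (elim x)
      then show ?case using sum_le_suminf[OF elim, of "{n}" for n] nn by auto
    qed
    show "AE x in M. (\<lambda>n. f (r n) x) \<longlonglongrightarrow> 0"
      using AE by eventually_elim (rule summable_LIMSEQ_zero)
  qed
qed

section \<open>Test functions built from the barrier\<close>

text \<open>A pole-free substitute for \<open>1 / (k + \<epsilon> - s)\<close> is needed because the smooth approximations of
  \<open>(k - u)\<^sup>+\<close> may exceed \<open>k\<close>.\<close>

lemma smooth_reciprocal:
  fixes k \<epsilon> :: real
  assumes e: "\<epsilon> > 0"
  obtains Y Y' B where "\<And>j. Ck_on j UNIV Y" "\<And>s. (Y has_field_derivative Y' s) (at s)"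
    "continuous_on UNIV Y'" "\<And>s. 0 \<le> Y s" "\<And>s. Y s \<le> 2 / \<epsilon>" "\<And>s. \<bar>Y' s\<bar> \<le> B"
    "\<And>s. s \<le> k \<Longrightarrow> Y s = 1 / (k + \<epsilon> - s)" "\<And>s. s \<le> k \<Longrightarrow> Y' s = 1 / (k + \<epsilon> - s)\<^sup>2"
proof -
  \<comment> \<open>The reciprocal is left unchanged up to \<open>k + \<epsilon> / 4\<close> and
    switched off from \<open>k + \<epsilon> / 2\<close> on, halfway to the pole at
    \<open>k + \<epsilon>\<close>. Where it is alive the denominator is at least
    \<open>\<epsilon> / 2\<close>, hence the bound \<open>2 / \<epsilon>\<close>.\<close>
  define Y where "Y s = (if s < k + \<epsilon> then smooth_step (2 - 4 * (s - k) / \<epsilon>) * (1 / (k + \<epsilon> - s)) else 0)" for s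
  have Y1: "Y s = 1 / (k + \<epsilon> - s)" if "s \<le> k + \<epsilon> / 4" for s
  proof -
    have "4 * (s - k) / \<epsilon> \<le> 1" using that e by (simp add: field_simps)
    then have "smooth_step (2 - 4 * (s - k) / \<epsilon>) = 1" by (intro smooth_step_eq_1) simp
    then show ?thesis using that e by (simp add: Y_def)
  qed
  have Y0: "Y s = 0" if "s \<ge> k + \<epsilon> / 2" for s
  proof -
    have "4 * (s - k) / \<epsilon> \<ge> 2" using that e by (simp add: field_simps)
    then have "smooth_step (2 - 4 * (s - k) / \<epsilon>) = 0" by (intro smooth_step_eq_0) simp
    then show ?thesis by (simp add: Y_def)
  qed
  have sm: "Ck_on j UNIV Y" for j
  proof -
    have op: "open {..<k + \<epsilon>}" "open {k + \<epsilon> / 2<..}" by auto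
    have a1: "Ck_on j {..<k + \<epsilon>} (\<lambda>s. (- 4 / \<epsilon>) * s + (2 + 4 * k / \<epsilon>))"
      and a2: "Ck_on j {..<k + \<epsilon>} (\<lambda>s. (- 1) * s + (k + \<epsilon>))"
      by (rule Ck_on_subset[OF subset_UNIV Ck_on_affine])+
    have 1: "Ck_on j {..<k + \<epsilon>} (\<lambda>s. smooth_step ((- 4 / \<epsilon>) * s + (2 + 4 * k / \<epsilon>)))"
      by (rule Ck_on_compose[OF op(1) a1 Ck_on_smooth_step]) simp
    have 2: "Ck_on j {..<k + \<epsilon>} (\<lambda>s. 1 / ((- 1) * s + (k + \<epsilon>)))"
      by (rule Ck_on_compose[OF op(1) a2 Ck_on_inverse]) auto
    have "Ck_on j {..<k + \<epsilon>} Y = Ck_on j {..<k + \<epsilon>} (\<lambda>s. smooth_step ((- 4 / \<epsilon>) * s + (2 + 4 * k / \<epsilon>)) * (1 / ((- 1) * s + (k + \<epsilon>))))"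
    proof (rule Ck_on_cong[OF op(1)])
      fix s assume "s \<in> {..<k + \<epsilon>}"
      moreover have "(- 4 / \<epsilon>) * s + (2 + 4 * k / \<epsilon>) = 2 - 4 * (s - k) / \<epsilon>" using e by (simp add: field_simps)
      moreover have "(- 1) * s + (k + \<epsilon>) = k + \<epsilon> - s" by simp
      ultimately show "Y s = smooth_step ((- 4 / \<epsilon>) * s + (2 + 4 * k / \<epsilon>)) * (1 / ((- 1) * s + (k + \<epsilon>)))"
        by (simp only: Y_def lessThan_iff if_True)
    qed
    then have A: "Ck_on j {..<k + \<epsilon>} Y" using Ck_on_mult[OF op(1) 1 2] by simp
    have B: "Ck_on j {k + \<epsilon> / 2<..} Y"
      using Ck_on_cong[OF op(2), of Y "\<lambda>_. 0" j] Ck_on_const[OF op(2)] Y0 by simp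
    have "{..<k + \<epsilon>} \<union> {k + \<epsilon> / 2<..} = UNIV" using e by auto
    then show ?thesis using Ck_on_Un[OF op A B] by simp
  qed
  define Y' where "Y' = gradient Y"
  have d: "(Y has_field_derivative Y' s) (at s)" for s
    using sm[of "Suc 0"] by (simp add: Y'_def)
  have c: "continuous_on UNIV Y'"
    using sm[of "Suc 0"] by (simp add: Y'_def)
  have Y'1: "Y' s = 1 / (k + \<epsilon> - s)\<^sup>2" if s: "s \<le> k" for s
  proof -
    have "((\<lambda>s. 1 / (k + \<epsilon> - s)) has_field_derivative 1 / (k + \<epsilon> - s)\<^sup>2) (at s)"
      using s e by (auto intro!: derivative_eq_intros simp: power2_eq_square)
    then have "(Y has_field_derivative 1 / (k + \<epsilon> - s)\<^sup>2) (at s)"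
      by (rule has_field_derivative_transform_within_open[where S="{..<k + \<epsilon> / 4}"]) (use s e Y1 in auto)
    then show ?thesis using d DERIV_unique by blast
  qed
  have Y'0: "Y' s = 0" if s: "s \<ge> k + \<epsilon>" for s
  proof -
    have "((\<lambda>s. 0) has_field_derivative 0) (at s)" by simp
    then have "(Y has_field_derivative 0) (at s)"
      by (rule has_field_derivative_transform_within_open[where S="{k + \<epsilon> / 2<..}"]) (use s e Y0 in auto)
    then show ?thesis using d DERIV_unique by blast
  qed
  \<comment> \<open>Only this interval needs a compactness bound: to its left \<open>Y'\<close> is
    explicit and at most \<open>1 / \<epsilon>\<^sup>2\<close>, to its right it is zero.\<close>
  have "bounded (Y' ` {k..k + \<epsilon>})"
    by (intro compact_imp_bounded compact_continuous_image continuous_on_subset[OF c]) auto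
  then obtain B where B: "\<And>s. s \<in> {k..k + \<epsilon>} \<Longrightarrow> \<bar>Y' s\<bar> \<le> B"
    unfolding bounded_iff by (auto simp del: atLeastAtMost_iff)
  have bd: "\<bar>Y' s\<bar> \<le> max B (1 / \<epsilon>\<^sup>2)" for s
  proof -
    consider "s \<le> k" | "s \<in> {k..k + \<epsilon>}" | "s \<ge> k + \<epsilon>" by fastforce
    then show ?thesis
    proof cases
      case 1
      have "\<bar>Y' s\<bar> \<le> 1 / \<epsilon>\<^sup>2" using 1 e Y'1[OF 1]
        by (simp add: frac_le power_mono)
      then show ?thesis by simp
    next
      case 2
      then show ?thesis using B[of s] by simp
    next
      case 3
      then show ?thesis by (simp add: Y'0 le_max_iff_disj)
    qed
  qed
  have "0 \<le> Y s" for s using smooth_step_nonneg by (simp add: Y_def)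
  moreover have "Y s \<le> 2 / \<epsilon>" for s
  proof (cases "s \<le> k + \<epsilon> / 2")
    case True
    have "Y s \<le> 1 * (1 / (k + \<epsilon> - s))"
      using True e smooth_step_le_1 smooth_step_nonneg unfolding Y_def by (auto intro!: mult_right_mono simp del: times_divide_eq_right)
    also have "\<dots> \<le> 2 / \<epsilon>" using True e by (simp add: field_simps)
    finally show ?thesis .
  qed (use Y0 e in simp)
  ultimately show ?thesis using that[of Y Y' "max B (1 / \<epsilon>\<^sup>2)"] sm d c bd Y1 Y'1 e by simp
qed

text \<open>The choice of \<open>R\<close> makes \<open>W x * Y s \<le> 1\<close> for \<open>norm x \<ge> R\<close>, so that test functions \<open>W * H (W * Y \<phi>)\<close>
  with \<open>H = 0\<close> on \<open>{..1}\<close> live in a fixed ball and no decay at infinity enters.\<close>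

locale barrier =
  fixes \<Omega> :: "'a::euclidean_space set" and p k \<epsilon> r \<gamma> R BY :: real and Y Y' :: "real \<Rightarrow> real"
  assumes open_\<Omega>: "open \<Omega>" and r: "r > 0" and norm_ge: "\<And>x. x \<in> \<Omega> \<Longrightarrow> r \<le> norm x"
    and p: "1 < p" and k: "k > 0" and e: "\<epsilon> > 0" and \<gamma>: "\<gamma> > 0"
    and Y_smooth: "\<And>j. Ck_on j UNIV Y" and Y_deriv: "\<And>s. (Y has_field_derivative Y' s) (at s)"
    and Y'_cont: "continuous_on UNIV Y'" and Y_nonneg: "\<And>s. 0 \<le> Y s" and Y_le: "\<And>s. Y s \<le> 2 / \<epsilon>"
    and Y'_le: "\<And>s. \<bar>Y' s\<bar> \<le> BY"
    and Y_eq: "\<And>s. s \<le> k \<Longrightarrow> Y s = 1 / (k + \<epsilon> - s)"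
    and Y'_eq: "\<And>s. s \<le> k \<Longrightarrow> Y' s = 1 / (k + \<epsilon> - s)\<^sup>2"
    and R: "\<And>x::'a. norm x \<ge> R \<Longrightarrow> k * r powr \<gamma> * norm x powr (- \<gamma>) \<le> \<epsilon> / 2"
begin

definition W :: "'a \<Rightarrow> real" where "W x = k * r powr \<gamma> * norm x powr (- \<gamma>)"
definition DW :: "'a \<Rightarrow> 'a" where "DW x = (- \<gamma> * (k * r powr \<gamma>) * norm x powr (- \<gamma> - 2)) *\<^sub>R x"

lemma zero_notin: "0 \<notin> \<Omega>" using norm_ge[of 0] r by auto

lemma W_pos: assumes "x \<in> \<Omega>" shows "W x > 0"
proof -
  have "norm x > 0" using norm_ge[OF assms] r by linarith
  then show ?thesis unfolding W_def using k r by (intro mult_pos_pos) auto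
qed

lemma W_nonneg: "W x \<ge> 0" using k by (simp add: W_def)

lemma W_le_k: assumes "x \<in> \<Omega>" shows "W x \<le> k"
proof -
  have "norm x powr (- \<gamma>) \<le> r powr (- \<gamma>)"
    using norm_ge[OF assms] r \<gamma> by (intro powr_mono2') auto
  then have "W x \<le> k * r powr \<gamma> * r powr (- \<gamma>)" unfolding W_def using k by (intro mult_left_mono) auto
  also have "\<dots> = k" using r by (simp add: powr_minus)
  finally show ?thesis .
qed

lemma W_GDERIV: "x \<noteq> 0 \<Longrightarrow> GDERIV W x :> DW x"
  using GDERIV_mult[OF GDERIV_const GDERIV_norm_powr, of x "k * r powr \<gamma>" "- \<gamma>"]
  unfolding W_def[abs_def] DW_def by (simp add: mult_ac)

lemma W_smooth: "Ck_on j (- {0}) W"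
  unfolding W_def[abs_def] by (intro Ck_on_mult Ck_on_const Ck_on_norm_powr) (auto simp: open_Compl)

lemma norm_DW: assumes "x \<noteq> 0" shows "norm (DW x) = \<gamma> * W x / norm x"
proof -
  have "norm x powr (- \<gamma> - 2) * norm x = norm x powr (- \<gamma> - 2) * norm x powr 1" by simp
  also have "\<dots> = norm x powr (- \<gamma> - 2 + 1)" by (rule powr_add[symmetric])
  also have "- \<gamma> - 2 + 1 = - \<gamma> - 1" by simp
  also have "norm x powr (- \<gamma> - 1) = norm x powr (- \<gamma>) / norm x" using powr_diff[of "norm x" "- \<gamma>" 1] assms by simp
  finally have "norm x powr (- \<gamma> - 2) * norm x = norm x powr (- \<gamma>) / norm x" .
  moreover have "norm (DW x) = \<gamma> * (k * r powr \<gamma>) * (norm x powr (- \<gamma> - 2) * norm x)"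
    unfolding DW_def using \<gamma> k by (simp add: abs_mult)
  ultimately show ?thesis unfolding W_def by simp
qed

lemma norm_DW_le: assumes "x \<in> \<Omega>" shows "norm (DW x) \<le> \<gamma> * k / r"
proof -
  have "\<gamma> * W x / norm x \<le> \<gamma> * k / r"
    using W_le_k[OF assms] norm_ge[OF assms] r \<gamma> W_nonneg[of x] by (intro frac_le mult_left_mono) auto
  moreover have "x \<noteq> 0" using zero_notin assms by auto
  ultimately show ?thesis using norm_DW[of x] by simp
qed

lemma W_measurable[measurable]: "W \<in> borel_measurable borel" unfolding W_def[abs_def] by measurable
lemma DW_measurable[measurable]: "DW \<in> borel_measurable borel" unfolding DW_def[abs_def] by measurable
lemma Y_continuous: "continuous_on UNIV Y" using Y_smooth[of 0] by simp
lemma Y_measurable[measurable]: "Y \<in> borel_measurable borel"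
  using Y_continuous by (rule borel_measurable_continuous_onI)
lemma Y'_measurable[measurable]: "Y' \<in> borel_measurable borel"
  using Y'_cont by (rule borel_measurable_continuous_onI)

lemma WY_le_1: "norm x \<ge> R \<Longrightarrow> W x * Y s \<le> 1"
proof -
  assume "norm x \<ge> R"
  then have "W x \<le> \<epsilon> / 2" using R unfolding W_def by blast
  then have "W x * Y s \<le> (\<epsilon> / 2) * (2 / \<epsilon>)"
    using Y_le Y_nonneg e by (intro mult_mono) auto
  then show ?thesis using e by simp
qed

lemma WY_le: "x \<in> \<Omega> \<Longrightarrow> W x * Y s \<le> k * (2 / \<epsilon>)"
  using W_le_k Y_le Y_nonneg W_nonneg k by (intro mult_mono) auto

end

section \<open>Test functions for a general profile\<close>

lemma tendsto_compose_cont: "continuous_on UNIV F \<Longrightarrow> s \<longlonglongrightarrow> l \<Longrightarrow> (\<lambda>n. F (s n)) \<longlonglongrightarrow> (F l :: real)" for F :: "real \<Rightarrow> real"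
  by (rule continuous_on_tendsto_compose[of UNIV]) auto

text \<open>The equations of \<open>u\<close> and of \<open>W\<close> are tested with functions of
  the same shape that differ only in \<open>H\<close>. Smoothness, support, bounds and the passage
  to the limit are therefore established once for general \<open>H\<close>.\<close>

locale barrier_profile = barrier +
  fixes H H' :: "real \<Rightarrow> real"
  assumes H_smooth: "\<And>j. Ck_on j UNIV H" and H_deriv: "\<And>s. (H has_field_derivative H' s) (at s)"
    and H'_cont: "continuous_on UNIV H'" and H_nonneg: "\<And>s. 0 \<le> H s"
    and H_eq_0: "\<And>s. s \<le> 1 \<Longrightarrow> H s = 0" and H'_eq_0: "\<And>s. s \<le> 1 \<Longrightarrow> H' s = 0"
begin

text \<open>The indicator matters near the origin: outside \<open>\<Omega>\<close> the barrier can
  exceed \<open>k + \<epsilon>\<close>, and the product would not vanish there although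
  \<open>\<phi>\<close> does.\<close>

definition test :: "('a \<Rightarrow> real) \<Rightarrow> 'a \<Rightarrow> real"
  where "test \<phi> x = indicator \<Omega> x * (W x * H (W x * Y (\<phi> x)))"

text \<open>The chain rule with the value \<open>w\<close> and the gradient \<open>d\<close> as
  independent arguments. The same formula then serves the smooth approximations and the limit, for
  which \<open>d\<close> is only a weak gradient.\<close>

definition Dtest :: "real \<Rightarrow> 'a \<Rightarrow> 'a \<Rightarrow> 'a"
  where "Dtest w d x = H (W x * Y w) *\<^sub>R DW x
    + (W x * H' (W x * Y w)) *\<^sub>R (Y w *\<^sub>R DW x + (W x * Y' w) *\<^sub>R d)"

lemma H_continuous: "continuous_on UNIV H" using H_smooth[of 0] by simp
lemma H_measurable[measurable]: "H \<in> borel_measurable borel"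
  using H_continuous by (rule borel_measurable_continuous_onI)
lemma H'_measurable[measurable]: "H' \<in> borel_measurable borel"
  using H'_cont by (rule borel_measurable_continuous_onI)

lemma test_nonneg: "test \<phi> x \<ge> 0"
  using W_nonneg H_nonneg by (simp add: test_def)

text \<open>Compact support is inherited from \<open>\<phi>\<close>: in \<open>\<Omega>\<close>,
  where \<open>\<phi>\<close> is zero, the argument of \<open>H\<close> is
  \<open>W / (k + \<epsilon>)\<close>, which is below 1 because \<open>W \<le> k\<close>.\<close>

lemma test_C0_infinity:
  assumes phi: "\<phi> \<in> C0_infinity \<Omega>"
  shows "test \<phi> \<in> C0_infinity \<Omega>"
proof -
  obtain K where K: "compact K" "K \<subseteq> \<Omega>" "\<And>x. x \<notin> K \<Longrightarrow> \<phi> x = 0"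
    using C0_infinity_support[OF phi] by metis
  show ?thesis
  proof (rule C0_infinityI[OF open_\<Omega> _ K(1,2,2)])
    fix j
    have "\<Omega> \<subseteq> - {0}" using zero_notin by auto
    then have w: "Ck_on j \<Omega> W" using W_smooth Ck_on_subset by blast
    have "Ck_on j \<Omega> (\<lambda>x. Y (\<phi> x))"
      by (rule Ck_on_compose[OF open_\<Omega> C0_infinity_Ck_on[OF phi] Y_smooth]) simp
    then have "Ck_on j \<Omega> (\<lambda>x. W x * Y (\<phi> x))" by (intro Ck_on_mult open_\<Omega> w)
    then have "Ck_on j \<Omega> (\<lambda>x. H (W x * Y (\<phi> x)))"
      by (rule Ck_on_compose[OF open_\<Omega> _ H_smooth]) simp
    then have "Ck_on j \<Omega> (\<lambda>x. W x * H (W x * Y (\<phi> x)))" by (intro Ck_on_mult open_\<Omega> w)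
    moreover have "Ck_on j \<Omega> (test \<phi>) = Ck_on j \<Omega> (\<lambda>x. W x * H (W x * Y (\<phi> x)))"
      by (rule Ck_on_cong[OF open_\<Omega>]) (simp add: test_def)
    ultimately show "Ck_on j \<Omega> (test \<phi>)" by simp
  next
    fix x assume x: "x \<notin> K"
    show "test \<phi> x = 0"
    proof (cases "x \<in> \<Omega>")
      case True
      have "W x * Y (\<phi> x) = W x / (k + \<epsilon>)" using K(3)[OF x] Y_eq[of 0] k by simp
      also have "\<dots> \<le> 1" using W_le_k[OF True] k e by (simp add: field_simps)
      finally show ?thesis by (simp add: test_def H_eq_0)
    qed (simp add: test_def)
  qed
qed

lemma test_gradient:
  assumes phi: "\<phi> \<in> C0_infinity \<Omega>" and x: "x \<in> \<Omega>"
  shows "gradient (test \<phi>) x = Dtest (\<phi> x) (gradient \<phi> x) x"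
proof -
  have x0: "x \<noteq> 0" using x zero_notin by auto
  have "GDERIV (\<lambda>x. Y (\<phi> x)) x :> Y' (\<phi> x) *\<^sub>R gradient \<phi> x"
    by (rule GDERIV_DERIV_compose[OF C0_infinity_GDERIV[OF phi] Y_deriv])
  from GDERIV_mult[OF W_GDERIV[OF x0] this]
  have "GDERIV (\<lambda>x. W x * Y (\<phi> x)) x :> W x *\<^sub>R (Y' (\<phi> x) *\<^sub>R gradient \<phi> x) + Y (\<phi> x) *\<^sub>R DW x" .
  from GDERIV_mult[OF W_GDERIV[OF x0] GDERIV_DERIV_compose[OF this H_deriv]]
  have "GDERIV (\<lambda>x. W x * H (W x * Y (\<phi> x))) x :> Dtest (\<phi> x) (gradient \<phi> x) x"
    by (rule GDERIV_subst) (simp add: Dtest_def algebra_simps)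
  then have "GDERIV (test \<phi>) x :> Dtest (\<phi> x) (gradient \<phi> x) x"
    by (subst GDERIV_cong_open[OF open_\<Omega> x, where g="\<lambda>x. W x * H (W x * Y (\<phi> x))"]) (simp add: test_def)
  then show ?thesis by (rule gradient_eqI)
qed

lemma Dtest_eq_0: "W x * Y w \<le> 1 \<Longrightarrow> Dtest w d x = 0"
  by (simp add: Dtest_def H_eq_0 H'_eq_0)

text \<open>\<open>H\<close> itself may be unbounded, but in \<open>\<Omega>\<close> its argument
  never exceeds \<open>2 * k / \<epsilon>\<close>, and up to 1 both \<open>H\<close> and
  \<open>H'\<close> vanish. So only their values on a compact interval count, uniformly in
  \<open>w\<close> and affinely in \<open>norm d\<close>.\<close>

lemma test_bound:
  obtains C where "C \<ge> 0" "\<And>x w. x \<in> \<Omega> \<Longrightarrow> W x * H (W x * Y w) \<le> C"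
    "\<And>x w d. x \<in> \<Omega> \<Longrightarrow> norm (Dtest w d x) \<le> C * (1 + norm d)"
proof -
  define M where "M = k * (2 / \<epsilon>)"
  have "bounded (H ` {1..M})" "bounded (H' ` {1..M})"
    by (intro compact_imp_bounded compact_continuous_image continuous_on_subset[OF H_continuous]
        continuous_on_subset[OF H'_cont]; simp)+
  then obtain B1 B2 where B: "\<And>t. t \<in> {1..M} \<Longrightarrow> \<bar>H t\<bar> \<le> B1" "\<And>t. t \<in> {1..M} \<Longrightarrow> \<bar>H' t\<bar> \<le> B2"
    unfolding bounded_iff by (auto simp del: atLeastAtMost_iff)
  define B where "B = max 0 (max B1 B2)"
  have BH: "\<bar>H t\<bar> \<le> B" "\<bar>H' t\<bar> \<le> B" if "t \<le> M" for t
    using that B[of t] H_eq_0[of t] H'_eq_0[of t] unfolding B_def by (cases "t \<le> 1"; auto)+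
  have B0: "B \<ge> 0" by (simp add: B_def)
  have BY0: "BY \<ge> 0" using Y'_le[of 0] by simp
  define G where "G = \<gamma> * k / r"
  have G0: "G \<ge> 0" using \<gamma> k r by (simp add: G_def)
  \<comment> \<open>The first summand bounds the test function itself, the others its gradient, with
    \<open>G\<close> bounding \<open>DW\<close>, \<open>2 / \<epsilon>\<close> bounding
    \<open>Y\<close> and \<open>BY\<close> bounding \<open>Y'\<close>.\<close>
  define C where "C = k * B + B * G + (k * B) * (2 / \<epsilon> * G + k * BY)"
  have nn: "k * B \<ge> 0" "B * G \<ge> 0" "2 / \<epsilon> * G \<ge> 0" "k * BY \<ge> 0"
    using k B0 G0 BY0 e by auto
  show ?thesis
  proof
    show "C \<ge> 0" unfolding C_def using k B0 G0 BY0 e by (intro add_nonneg_nonneg mult_nonneg_nonneg) auto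
    fix x w assume x: "x \<in> \<Omega>"
    have T: "W x * Y w \<le> M" using WY_le[OF x] by (simp add: M_def)
    have "W x * H (W x * Y w) \<le> k * B"
      using BH(1)[OF T] W_le_k[OF x] W_nonneg[of x] k H_nonneg by (intro mult_mono) auto
    also have "\<dots> \<le> C" unfolding C_def using nn
      by (simp add: add_nonneg_nonneg mult_nonneg_nonneg)
    finally show "W x * H (W x * Y w) \<le> C" .
    fix d
    have "norm (Dtest w d x) \<le> norm (H (W x * Y w) *\<^sub>R DW x)
        + norm ((W x * H' (W x * Y w)) *\<^sub>R (Y w *\<^sub>R DW x + (W x * Y' w) *\<^sub>R d))"
      unfolding Dtest_def by (rule norm_triangle_ineq)
    also have "\<dots> = \<bar>H (W x * Y w)\<bar> * norm (DW x) + (W x * \<bar>H' (W x * Y w)\<bar>) * norm (Y w *\<^sub>R DW x + (W x * Y' w) *\<^sub>R d)"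
      using W_nonneg[of x] by (simp add: abs_mult)
    also have "\<dots> \<le> B * G + (k * B) * (2 / \<epsilon> * G + k * BY * norm d)"
    proof (intro add_mono mult_mono)
      have "norm (Y w *\<^sub>R DW x + (W x * Y' w) *\<^sub>R d) \<le> norm (Y w *\<^sub>R DW x) + norm ((W x * Y' w) *\<^sub>R d)"
        by (rule norm_triangle_ineq)
      also have "\<dots> = Y w * norm (DW x) + (W x * \<bar>Y' w\<bar>) * norm d"
        using W_nonneg[of x] Y_nonneg[of w] by (simp add: abs_mult)
      also have "\<dots> \<le> 2 / \<epsilon> * G + k * BY * norm d"
        using Y_le[of w] Y'_le[of w] norm_DW_le[OF x] W_le_k[OF x] W_nonneg[of x] e k BY0
        unfolding G_def by (intro add_mono mult_mono mult_nonneg_nonneg) auto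
      finally show "norm (Y w *\<^sub>R DW x + (W x * Y' w) *\<^sub>R d) \<le> 2 / \<epsilon> * G + k * BY * norm d" .
    qed (use BH[OF T] norm_DW_le[OF x] W_le_k[OF x] W_nonneg[of x] B0 k nn in \<open>auto simp: G_def\<close>)
    also have "\<dots> \<le> C * (1 + norm d)"
    proof -
      have "C * (1 + norm d) = (B * G + (k * B) * (2 / \<epsilon> * G + k * BY * norm d))
        + (k * B * (1 + norm d) + B * G * norm d + (k * B) * (2 / \<epsilon> * G) * norm d + (k * B) * (k * BY))"
        unfolding C_def by (simp add: algebra_simps add_divide_distrib)
      moreover have "k * B * (1 + norm d) + B * G * norm d + (k * B) * (2 / \<epsilon> * G) * norm d + (k * B) * (k * BY) \<ge> 0"
        using nn by (intro add_nonneg_nonneg mult_nonneg_nonneg) (use k B0 G0 BY0 e in auto)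
      ultimately show ?thesis by linarith
    qed
    finally show "norm (Dtest w d x) \<le> C * (1 + norm d)" .
  qed
qed

lemma test_tendsto:
  assumes "w \<longlonglongrightarrow> w0"
  shows "(\<lambda>n. W x * H (W x * Y (w n))) \<longlonglongrightarrow> W x * H (W x * Y w0)"
  by (intro tendsto_intros tendsto_compose_cont[OF H_continuous] tendsto_compose_cont[OF Y_continuous] assms)

lemma Dtest_tendsto:
  assumes "w \<longlonglongrightarrow> w0" "d \<longlonglongrightarrow> d0"
  shows "(\<lambda>n. Dtest (w n) (d n) x) \<longlonglongrightarrow> Dtest w0 d0 x"
  unfolding Dtest_def
  by (intro tendsto_intros tendsto_compose_cont[OF H_continuous] tendsto_compose_cont[OF Y_continuous]
      tendsto_compose_cont[OF H'_cont] tendsto_compose_cont[OF Y'_cont] assms)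

end

section \<open>Passage to the limit in the test functions\<close>

lemma powr_add_le:
  fixes a b p :: real
  assumes "0 \<le> a" "0 \<le> b" "0 \<le> p"
  shows "(a + b) powr p \<le> 2 powr p * (a powr p + b powr p)"
proof -
  have "(a + b) powr p \<le> (2 * max a b) powr p" using assms by (intro powr_mono2) auto
  also have "\<dots> = 2 powr p * max a b powr p" using assms by (simp add: powr_mult)
  also have "\<dots> \<le> 2 powr p * (a powr p + b powr p)" by (intro mult_left_mono) (auto simp: max_def)
  finally show ?thesis .
qed

lemma powr_mult_le_add:
  fixes a b p :: real
  assumes "0 \<le> a" "0 \<le> b" "1 < p"
  shows "a powr (p - 1) * b \<le> a powr p + b powr p"
proof (cases "a \<le> b")
  case True
  have "a powr (p - 1) * b \<le> b powr (p - 1) * b" using True assms by (intro mult_right_mono powr_mono2) auto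
  then show ?thesis using powr_minus_1_mult[OF assms(2)] by (smt (verit) powr_ge_zero)
next
  case False
  have "a powr (p - 1) * b \<le> a powr (p - 1) * a" using False assms by (intro mult_left_mono) auto
  then show ?thesis using powr_minus_1_mult[OF assms(1)] by (smt (verit) powr_ge_zero)
qed

lemma powr_le_one_add:
  fixes a p q :: real
  assumes "0 \<le> a" "0 \<le> p" "p \<le> q"
  shows "a powr p \<le> 1 + a powr q"
proof (cases "a \<le> 1")
  case True
  then have "a powr p \<le> 1" using assms by (intro powr_le1) auto
  then show ?thesis by (smt (verit) powr_ge_zero)
next
  case False
  then have "a powr p \<le> a powr q" using assms by (intro powr_mono) auto
  then show ?thesis by simp
qed

lemma tendsto_of_powr_tendsto_0:
  fixes x :: "nat \<Rightarrow> 'b::real_normed_vector"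
  assumes "p > 0" "(\<lambda>n. norm (x n - l) powr p) \<longlonglongrightarrow> 0"
  shows "x \<longlonglongrightarrow> l"
proof -
  have "(\<lambda>n. (norm (x n - l) powr p) powr (1 / p)) \<longlonglongrightarrow> 0"
    by (rule tendsto_zero_powrI[OF assms(2) tendsto_const]) (use assms in auto)
  moreover have "(norm (x n - l) powr p) powr (1 / p) = norm (x n - l)" for n
    using assms(1) by (simp add: powr_powr)
  ultimately show ?thesis by (simp add: tendsto_norm_zero_iff LIM_zero_iff)
qed

lemma borel_measurable_lebesgue_on_id: "(\<lambda>x::'a::euclidean_space. x) \<in> borel_measurable (lebesgue_on \<Omega>)"
  by (intro measurable_restrict_space1 measurable_completion) simp

lemma borel_measurable_lebesgue_on: "f \<in> borel_measurable borel \<Longrightarrow> f \<in> borel_measurable (lebesgue_on \<Omega>)"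
  for f :: "'a::euclidean_space \<Rightarrow> 'b::topological_space"
  by (intro measurable_restrict_space1 measurable_completion) simp

context barrier_profile
begin

text \<open>Dominated convergence for a flux \<open>V\<close> and a potential \<open>c\<close>, used
  once with those of \<open>u\<close> and once with those of \<open>W\<close>. The hypothesis
  \<open>V_le\<close> has the form that Young's inequality gives for a flux of growth
  \<open>p - 1\<close>; bounds inside the ball of radius \<open>R\<close> suffice, since all test
  functions vanish beyond it.\<close>

lemma test_limit:
  fixes v c A g :: "'a \<Rightarrow> real" and G V :: "'a \<Rightarrow> 'a" and \<phi> :: "nat \<Rightarrow> 'a \<Rightarrow> real" and D :: real
  assumes phi: "\<And>n. \<phi> n \<in> C0_infinity \<Omega>"
    and meas: "v \<in> borel_measurable (lebesgue_on \<Omega>)" "G \<in> borel_measurable (lebesgue_on \<Omega>)"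
      "V \<in> borel_measurable (lebesgue_on \<Omega>)" "c \<in> borel_measurable (lebesgue_on \<Omega>)"
    and A: "integrable (lebesgue_on \<Omega>) A" and g: "integrable (lebesgue_on \<Omega>) g"
    and Gp: "integrable (lebesgue_on \<Omega>) (\<lambda>x. norm (G x) powr p)" and D: "D \<ge> 0"
    and V_le: "\<And>x b. x \<in> \<Omega> \<Longrightarrow> norm x < R \<Longrightarrow> b \<ge> 0 \<Longrightarrow> norm (V x) * b \<le> A x + D * b powr p"
    and c_le: "\<And>x. x \<in> \<Omega> \<Longrightarrow> norm x < R \<Longrightarrow> \<bar>c x\<bar> \<le> A x"
    and dom: "AE x in lebesgue_on \<Omega>. \<forall>n. \<bar>\<phi> n x - v x\<bar> powr p + norm (gradient (\<phi> n) x - G x) powr p \<le> g x"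
    and lim: "AE x in lebesgue_on \<Omega>. (\<lambda>n. \<bar>\<phi> n x - v x\<bar> powr p + norm (gradient (\<phi> n) x - G x) powr p) \<longlonglongrightarrow> 0"
  shows "integrable (lebesgue_on \<Omega>) (\<lambda>x. V x \<bullet> Dtest (v x) (G x) x - c x * (W x * H (W x * Y (v x))))"
    and "(\<lambda>n. LINT x|lebesgue_on \<Omega>. V x \<bullet> gradient (test (\<phi> n)) x - c x * test (\<phi> n) x)
      \<longlonglongrightarrow> (LINT x|lebesgue_on \<Omega>. V x \<bullet> Dtest (v x) (G x) x - c x * (W x * H (W x * Y (v x))))"
proof -
  have \<Omega>[measurable]: "\<Omega> \<in> sets lebesgue" using open_\<Omega> by simp
  have BR: "ball 0 R \<inter> \<Omega> \<in> sets (lebesgue_on \<Omega>)"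
    unfolding sets_restrict_space by (rule image_eqI[of _ _ "ball 0 R"]) auto
  obtain C where C: "C \<ge> 0" "\<And>x w. x \<in> \<Omega> \<Longrightarrow> W x * H (W x * Y w) \<le> C"
    "\<And>x w d. x \<in> \<Omega> \<Longrightarrow> norm (Dtest w d x) \<le> C * (1 + norm d)" by (rule test_bound) blast
  \<comment> \<open>The three copies of \<open>A\<close> come from \<open>V_le\<close> at 1, from
    \<open>V_le\<close> at the norm of the approximating gradient, and from \<open>c_le\<close>.
    That norm is split into \<open>G\<close> and an error dominated by \<open>g\<close>.
    \<open>V_le\<close> at 1 also leaves the constant \<open>C * D\<close>, which is integrable over
    the ball only.\<close>
  define B where "B x = C * (3 * A x + D * (2 powr p * (norm (G x) powr p + g x)))" for x
  define M where "M x = indicator (ball 0 R \<inter> \<Omega>) x *\<^sub>R B x + C * D * indicator (ball 0 R \<inter> \<Omega>) x" for x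
  have Mint: "integrable (lebesgue_on \<Omega>) M"
    unfolding M_def
  proof (intro Bochner_Integration.integrable_add integrable_mult_indicator BR integrable_mult_right integrable_real_indicator)
    show "integrable (lebesgue_on \<Omega>) B" unfolding B_def
      by (intro integrable_mult_right Bochner_Integration.integrable_add A Gp g)
    have "emeasure (lebesgue_on \<Omega>) (ball 0 R \<inter> \<Omega>) = emeasure lebesgue (ball 0 R \<inter> \<Omega>)"
      by (simp add: emeasure_restrict_space)
    also have "\<dots> \<le> emeasure lebesgue (ball (0::'a) R)" by (intro emeasure_mono) auto
    also have "\<dots> < \<infinity>" using emeasure_lborel_ball_finite[of "0::'a" R] by simp
    finally show "emeasure (lebesgue_on \<Omega>) (ball 0 R \<inter> \<Omega>) < \<infinity>" .
  qed
  note [measurable] = meas borel_measurable_lebesgue_on_id[of \<Omega>]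
    borel_measurable_lebesgue_on[OF W_measurable, of \<Omega>] borel_measurable_lebesgue_on[OF DW_measurable, of \<Omega>]
  have [measurable]: "test (\<phi> n) \<in> borel_measurable (lebesgue_on \<Omega>)"
    "gradient (test (\<phi> n)) \<in> borel_measurable (lebesgue_on \<Omega>)" for n
    by (intro borel_measurable_lebesgue_on C0_infinity_borel[OF test_C0_infinity[OF phi]]
        C0_infinity_gradient_borel[OF test_C0_infinity[OF phi]])+
  have m1: "(\<lambda>x. V x \<bullet> Dtest (v x) (G x) x - c x * (W x * H (W x * Y (v x)))) \<in> borel_measurable (lebesgue_on \<Omega>)"
    unfolding Dtest_def by measurable
  have m2: "(\<lambda>x. V x \<bullet> gradient (test (\<phi> n)) x - c x * test (\<phi> n) x) \<in> borel_measurable (lebesgue_on \<Omega>)" for n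
    by measurable
  have inO: "AE x in lebesgue_on \<Omega>. x \<in> \<Omega>"
    by (rule AE_I2) (simp add: space_restrict_space)
  have conv: "AE x in lebesgue_on \<Omega>. (\<lambda>n. V x \<bullet> gradient (test (\<phi> n)) x - c x * test (\<phi> n) x)
      \<longlonglongrightarrow> V x \<bullet> Dtest (v x) (G x) x - c x * (W x * H (W x * Y (v x)))"
    using lim inO
  proof eventually_elim
    case (elim x)
    have "(\<lambda>n. norm (\<phi> n x - v x) powr p) \<longlonglongrightarrow> 0"
      by (rule Lim_null_comparison[OF always_eventually elim(1)]) simp
    then have 1: "(\<lambda>n. \<phi> n x) \<longlonglongrightarrow> v x"
      by (rule tendsto_of_powr_tendsto_0[rotated]) (use p in simp)
    have "(\<lambda>n. norm (gradient (\<phi> n) x - G x) powr p) \<longlonglongrightarrow> 0"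
      by (rule Lim_null_comparison[OF always_eventually elim(1)]) simp
    then have 2: "(\<lambda>n. gradient (\<phi> n) x) \<longlonglongrightarrow> G x"
      by (rule tendsto_of_powr_tendsto_0[rotated]) (use p in simp)
    show ?case
      using elim(2) by (simp add: test_gradient[OF phi] test_def)
        (intro tendsto_intros Dtest_tendsto test_tendsto 1 2)
  qed
  have bound: "AE x in lebesgue_on \<Omega>. norm (V x \<bullet> gradient (test (\<phi> n)) x - c x * test (\<phi> n) x) \<le> M x" for n
    using dom inO
  proof eventually_elim
    case (elim x)
    show ?case
    proof (cases "norm x < R")
      case True
      let ?d = "gradient (\<phi> n) x"
      have A0: "A x \<ge> 0" using c_le[OF elim(2) True] by linarith
      have "norm ?d \<le> norm (G x) + norm (?d - G x)" using norm_triangle_ineq[of "G x" "?d - G x"] by simp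
      then have "norm ?d powr p \<le> (norm (G x) + norm (?d - G x)) powr p" using p by (intro powr_mono2) auto
      also have "\<dots> \<le> 2 powr p * (norm (G x) powr p + norm (?d - G x) powr p)" using p by (intro powr_add_le) auto
      also have "\<dots> \<le> 2 powr p * (norm (G x) powr p + g x)"
      proof -
        have "norm (?d - G x) powr p \<le> g x"
          using elim(1)[rule_format, of n] powr_ge_zero[of "\<bar>\<phi> n x - v x\<bar>" p] by linarith
        then show ?thesis by simp
      qed
      finally have d: "norm ?d powr p \<le> 2 powr p * (norm (G x) powr p + g x)" .
      have "\<bar>V x \<bullet> gradient (test (\<phi> n)) x\<bar> \<le> norm (V x) * norm (Dtest (\<phi> n x) ?d x)"
        unfolding test_gradient[OF phi elim(2)] by (rule Cauchy_Schwarz_ineq2)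
      also have "\<dots> \<le> norm (V x) * (C * (1 + norm ?d))"
        using C(3)[OF elim(2)] by (intro mult_left_mono) auto
      also have "\<dots> = C * (norm (V x) * 1 + norm (V x) * norm ?d)" by (simp add: algebra_simps)
      also have "\<dots> \<le> C * ((A x + D * 1 powr p) + (A x + D * norm ?d powr p))"
        using V_le[OF elim(2) True, of 1] V_le[OF elim(2) True, of "norm ?d"] C(1) by (intro mult_left_mono add_mono) auto
      also have "\<dots> \<le> C * ((A x + D) + (A x + D * (2 powr p * (norm (G x) powr p + g x))))"
        using C(1) D d by (intro mult_left_mono add_mono) auto
      finally have e1: "\<bar>V x \<bullet> gradient (test (\<phi> n)) x\<bar>
         \<le> C * ((A x + D) + (A x + D * (2 powr p * (norm (G x) powr p + g x))))" .
      have "\<bar>c x * test (\<phi> n) x\<bar> \<le> A x * C"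
        unfolding abs_mult using c_le[OF elim(2) True] C(2)[OF elim(2)] A0 test_nonneg[of "\<phi> n" x] elim(2)
        by (intro mult_mono) (auto simp: test_def)
      then have "\<bar>V x \<bullet> gradient (test (\<phi> n)) x - c x * test (\<phi> n) x\<bar>
        \<le> C * ((A x + D) + (A x + D * (2 powr p * (norm (G x) powr p + g x)))) + A x * C" using e1 by linarith
      also have "\<dots> = M x" using True elim(2) by (simp add: M_def B_def algebra_simps)
      finally show ?thesis by simp
    next
      case False
      then have "W x * Y (\<phi> n x) \<le> 1" using WY_le_1 by simp
      then have "gradient (test (\<phi> n)) x = 0" "test (\<phi> n) x = 0"
        using elim(2) by (simp_all add: test_gradient[OF phi] Dtest_eq_0 test_def H_eq_0)
      then show ?thesis using False by (simp add: M_def)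
    qed
  qed
  show "integrable (lebesgue_on \<Omega>) (\<lambda>x. V x \<bullet> Dtest (v x) (G x) x - c x * (W x * H (W x * Y (v x))))"
    by (rule integrable_dominated_convergence[OF m1 m2 Mint conv bound])
  show "(\<lambda>n. LINT x|lebesgue_on \<Omega>. V x \<bullet> gradient (test (\<phi> n)) x - c x * test (\<phi> n) x)
      \<longlonglongrightarrow> (LINT x|lebesgue_on \<Omega>. V x \<bullet> Dtest (v x) (G x) x - c x * (W x * H (W x * Y (v x))))"
    by (rule integral_dominated_convergence[OF m1 m2 Mint conv bound])
qed

end

text \<open>With \<open>T = w / (u + \<epsilon>)\<close>, the functions \<open>w * profile T\<close> and \<open>w * power_profile p T\<close> replace the Diaz-Saa
  test functions \<open>(w\<^sup>p - u\<^sup>p)\<^sup>+ / w powr (p - 1)\<close> and \<open>(w\<^sup>p - u\<^sup>p)\<^sup>+ / u powr (p - 1)\<close>.\<close>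

definition profile :: "real \<Rightarrow> real" where "profile t = exp_bump 0 (t - 1)"
definition profile' :: "real \<Rightarrow> real" where "profile' t = exp_bump 2 (t - 1)"
definition power_profile :: "real \<Rightarrow> real \<Rightarrow> real" where "power_profile p t = t powr (p - 1) * profile t"
definition power_profile' :: "real \<Rightarrow> real \<Rightarrow> real"
  where "power_profile' p t = (p - 1) * t powr (p - 2) * profile t + t powr (p - 1) * profile' t"

lemma profile_smooth: "Ck_on j UNIV profile"
  using Ck_on_compose[OF open_UNIV Ck_on_affine[of j 1 "-1"] Ck_on_exp_bump[of j 0]]
  by (simp add: profile_def[abs_def])

lemma profile'_smooth: "Ck_on j UNIV profile'"
  using Ck_on_compose[OF open_UNIV Ck_on_affine[of j 1 "-1"] Ck_on_exp_bump[of j 2]]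
  by (simp add: profile'_def[abs_def])

lemma profile_deriv: "(profile has_field_derivative profile' t) (at t)"
proof -
  have "(exp_bump 0 has_field_derivative exp_bump 2 (t - 1)) (at (t - 1))"
    using exp_bump_deriv[of 0 "t - 1"] by (simp add: numeral_2_eq_2)
  then have "((\<lambda>t. exp_bump 0 (t - 1)) has_field_derivative exp_bump 2 (t - 1) * 1) (at t)"
    by (rule DERIV_chain2) (auto intro!: derivative_eq_intros)
  then show ?thesis by (simp add: profile_def[abs_def] profile'_def)
qed

lemma profile_eq_0: "t \<le> 1 \<Longrightarrow> profile t = 0" "t \<le> 1 \<Longrightarrow> profile' t = 0"
  by (simp_all add: profile_def profile'_def exp_bump_eq_0)

lemma profile_pos: "t > 1 \<Longrightarrow> profile t > 0" by (simp add: profile_def exp_bump_pos)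
lemma profile_nonneg: "profile t \<ge> 0" "profile' t \<ge> 0" by (simp_all add: profile_def profile'_def exp_bump_nonneg)
lemma profile_le_1: "profile t \<le> 1" by (simp add: profile_def exp_bump_0_le_1)

lemma power_profile_eq_0: "t \<le> 1 \<Longrightarrow> power_profile p t = 0" "t \<le> 1 \<Longrightarrow> power_profile' p t = 0"
  by (simp_all add: power_profile_def power_profile'_def profile_eq_0)

lemma power_profile_deriv: "(power_profile p has_field_derivative power_profile' p t) (at t)"
proof (cases "t > 0")
  case True
  have "((\<lambda>t. t powr (p - 1) * profile t) has_field_derivative ((p - 1) * t powr (p - 1 - 1)) * profile t + profile' t * t powr (p - 1)) (at t)"
    using True by (intro DERIV_mult has_real_derivative_powr profile_deriv)
  then show ?thesis by (simp add: power_profile_def[abs_def] power_profile'_def mult_ac)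
next
  case False
  have "((\<lambda>t. 0) has_field_derivative 0) (at t)" by simp
  then have "(power_profile p has_field_derivative 0) (at t)"
    by (rule has_field_derivative_transform_within_open[where S="{..<1}"]) (use False power_profile_eq_0 in auto)
  then show ?thesis using False by (simp add: power_profile_eq_0)
qed

text \<open>The singularity of \<open>t powr (p - 1)\<close> at 0 is harmless because
  \<open>profile\<close> vanishes up to 1.\<close>

lemma power_profile_smooth: "Ck_on j UNIV (power_profile p)"
proof -
  have "Ck_on j {0<..} (power_profile p)" unfolding power_profile_def[abs_def]
    by (intro Ck_on_mult Ck_on_powr Ck_on_subset[OF subset_UNIV profile_smooth]) simp
  moreover have "Ck_on j {..<1} (power_profile p)"
    using Ck_on_cong[of "{..<1}" "power_profile p" "\<lambda>_. 0" j] Ck_on_const[OF open_lessThan, of j 1 0] power_profile_eq_0 by simp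
  ultimately have "Ck_on j ({0<..} \<union> {..<1}) (power_profile p)" by (intro Ck_on_Un) auto
  moreover have "{0<..} \<union> {..<1} = (UNIV :: real set)" by auto
  ultimately show ?thesis by simp
qed

lemma power_profile'_continuous: "continuous_on UNIV (power_profile' p)"
proof -
  have "gradient (power_profile p) = power_profile' p"
    using power_profile_deriv by (intro ext gradient_eqI) simp
  then show ?thesis using power_profile_smooth[of "Suc 0" p] by simp
qed

lemma power_profile_nonneg: "power_profile p t \<ge> 0" by (simp add: power_profile_def profile_nonneg)

context barrier
begin

sublocale P: barrier_profile \<Omega> p k \<epsilon> r \<gamma> R BY Y Y' profile profile'
  by unfold_locales (use profile_smooth profile_deriv profile_nonneg profile_eq_0 profile'_smooth[of 0] in auto)

sublocale Q: barrier_profile \<Omega> p k \<epsilon> r \<gamma> R BY Y Y' "power_profile p" "power_profile' p"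
  by unfold_locales (use power_profile_smooth power_profile_deriv power_profile_nonneg power_profile_eq_0 power_profile'_continuous in auto)

text \<open>Here \<open>G\<close> is \<open>\<nabla>u\<close>, and \<open>- G\<close> is the gradient of \<open>v = k - u\<close>.\<close>

lemma energy_le:
  assumes v: "v \<le> k"
  shows "(norm G powr (p - 2) *\<^sub>R G) \<bullet> Q.Dtest v (- G) x \<le> (norm (DW x) powr (p - 2) *\<^sub>R DW x) \<bullet> P.Dtest v (- G) x"
proof (cases "W x * Y v \<le> 1")
  case True
  then show ?thesis by (simp add: P.Dtest_eq_0 Q.Dtest_eq_0)
next
  case False
  define T where "T = W x * Y v"
  have T: "T > 1" using False by (simp add: T_def)
  \<comment> \<open>For \<open>v \<le> k\<close> the function \<open>Y\<close> is an exact
    reciprocal, so \<open>Y' v = (Y v)\<^sup>2\<close>. This turns \<open>W\<close> times the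
    gradient of \<open>T\<close> into \<open>T *\<^sub>R (DW x - T *\<^sub>R G)\<close>, the form
    required by \<open>picone_inequality\<close> with \<open>A = T *\<^sub>R G\<close>.\<close>
  have Y': "W x * (W x * Y' v) = T * T"
    using Y_eq[OF v] Y'_eq[OF v] by (simp add: T_def power2_eq_square)
  define h where "h = profile T" define h' where "h' = T * profile' T"
  have nn: "h \<ge> 0" "h' \<ge> 0" using T by (auto simp: h_def h'_def profile_nonneg)
  have Dp: "P.Dtest v (- G) x = h *\<^sub>R DW x + h' *\<^sub>R (DW x - T *\<^sub>R G)"
  proof -
    have "P.Dtest v (- G) x = h *\<^sub>R DW x + (profile' T * (W x * Y v)) *\<^sub>R DW x - (profile' T * (W x * (W x * Y' v))) *\<^sub>R G"
      unfolding P.Dtest_def by (simp add: T_def h_def algebra_simps)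
    then show ?thesis unfolding Y' T_def[symmetric] h'_def by (simp add: algebra_simps)
  qed
  have pp: "T * power_profile' p T = T powr (p - 1) * ((p - 1) * h + h')"
  proof -
    have "T * power_profile' p T = (p - 1) * (T powr (p - 2) * T) * profile T + T powr (p - 1) * (T * profile' T)"
      by (simp add: power_profile'_def algebra_simps)
    moreover have "T powr (p - 2) * T = T powr (p - 1)" using powr_minus_2_mult[of T p] T by simp
    ultimately show ?thesis by (simp only: h_def h'_def) (simp add: algebra_simps)
  qed
  have Dq: "Q.Dtest v (- G) x = T powr (p - 1) *\<^sub>R (h *\<^sub>R DW x + ((p - 1) * h + h') *\<^sub>R (DW x - T *\<^sub>R G))"
  proof -
    have "Q.Dtest v (- G) x = power_profile p T *\<^sub>R DW x + (power_profile' p T * (W x * Y v)) *\<^sub>R DW x - (power_profile' p T * (W x * (W x * Y' v))) *\<^sub>R G"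
      unfolding Q.Dtest_def by (simp add: T_def algebra_simps)
    also have "\<dots> = power_profile p T *\<^sub>R DW x + (T * power_profile' p T) *\<^sub>R (DW x - T *\<^sub>R G)"
      unfolding Y' T_def[symmetric] by (simp add: algebra_simps)
    also have "\<dots> = T powr (p - 1) *\<^sub>R (h *\<^sub>R DW x + ((p - 1) * h + h') *\<^sub>R (DW x - T *\<^sub>R G))"
      unfolding pp by (simp add: power_profile_def h_def scaleR_add_right)
    finally show ?thesis .
  qed
  \<comment> \<open>The flux is homogeneous of degree \<open>p - 1\<close>, so the factor by which
    \<open>power_profile\<close> differs from \<open>profile\<close> rescales \<open>G\<close> to
    \<open>T *\<^sub>R G\<close>.\<close>
  have "T powr (p - 1) *\<^sub>R (norm G powr (p - 2) *\<^sub>R G) = norm (T *\<^sub>R G) powr (p - 2) *\<^sub>R (T *\<^sub>R G)"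
  proof -
    have "T powr (p - 1) = T powr (p - 2) * T" using powr_minus_2_mult[of T p] T by simp
    then show ?thesis using T by (simp add: powr_mult mult_ac)
  qed
  note scale = this
  have "(norm G powr (p - 2) *\<^sub>R G) \<bullet> Q.Dtest v (- G) x
      = (T powr (p - 1) *\<^sub>R (norm G powr (p - 2) *\<^sub>R G)) \<bullet> (h *\<^sub>R DW x + ((p - 1) * h + h') *\<^sub>R (DW x - T *\<^sub>R G))"
    unfolding Dq by (simp only: inner_scaleR_left inner_scaleR_right mult_ac)
  also have "\<dots>
      = (norm (T *\<^sub>R G) powr (p - 2) *\<^sub>R (T *\<^sub>R G)) \<bullet> (h *\<^sub>R DW x + ((p - 1) * h + h') *\<^sub>R (DW x - T *\<^sub>R G))"
    unfolding scale ..
  also have "\<dots> \<le> (norm (DW x) powr (p - 2) *\<^sub>R DW x) \<bullet> P.Dtest v (- G) x"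
    unfolding Dp by (rule picone_inequality[OF p nn])
  finally show ?thesis .
qed

text \<open>The flux of \<open>W\<close> is a constant multiple of
  \<open>norm x powr (- \<sigma>) *\<^sub>R x\<close> with
  \<open>\<sigma> = \<gamma> * (p - 1) + p\<close>, and \<open>N - \<sigma>\<close> is the second
  factor of \<open>hardy_const\<close>. What remains is the integration by parts for radial
  fields.\<close>

lemma W_equation:
  assumes phi: "\<phi> \<in> C0_infinity \<Omega>"
  shows "(LINT x|lebesgue_on \<Omega>. (norm (DW x) powr (p - 2) *\<^sub>R DW x) \<bullet> gradient \<phi> x
     - hardy_const (real DIM('a)) p \<gamma> / norm x powr p * W x powr (p - 1) * \<phi> x) = 0"
proof -
  define \<sigma> where "\<sigma> = \<gamma> * (p - 1) + p"
  define a where "a = k * r powr \<gamma>"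
  have a: "a > 0" using k r by (simp add: a_def)
  have V: "norm (DW x) powr (p - 2) *\<^sub>R DW x = (- ((\<gamma> * a) powr (p - 1)) * norm x powr (- \<sigma>)) *\<^sub>R x" if "x \<in> \<Omega>" for x
  proof -
    have x: "norm x > 0" using norm_ge[OF that] r by linarith
    have DWx: "DW x = (- (\<gamma> * a * norm x powr (- \<gamma> - 2))) *\<^sub>R x" by (simp add: DW_def a_def)
    have n: "norm (DW x) = (\<gamma> * a) * norm x powr (- \<gamma> - 1)"
    proof -
      have "norm (DW x) = (\<gamma> * a) * (norm x powr (- \<gamma> - 2) * norm x powr 1)"
        unfolding DWx using \<gamma> a by (simp add: abs_mult)
      also have "norm x powr (- \<gamma> - 2) * norm x powr 1 = norm x powr (- \<gamma> - 1)"
        by (subst powr_add[symmetric], rule arg_cong[where f="\<lambda>t. norm x powr t"]) auto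
      finally show ?thesis .
    qed
    have "norm (DW x) powr (p - 2) * (\<gamma> * a * norm x powr (- \<gamma> - 2))
       = ((\<gamma> * a) powr (p - 2) * (\<gamma> * a)) * (norm x powr ((- \<gamma> - 1) * (p - 2)) * norm x powr (- \<gamma> - 2))"
      unfolding n using \<gamma> a x by (simp add: powr_mult powr_powr)
    also have "\<dots> = (\<gamma> * a) powr (p - 1) * norm x powr (- \<sigma>)"
      using powr_minus_2_mult[of "\<gamma> * a" p] \<gamma> a
      by (subst powr_add[symmetric]) (simp add: \<sigma>_def algebra_simps)
    finally show ?thesis unfolding DWx by simp
  qed
  have c: "hardy_const (real DIM('a)) p \<gamma> / norm x powr p * W x powr (p - 1)
     = (\<gamma> * a) powr (p - 1) * (real DIM('a) - \<sigma>) * norm x powr (- \<sigma>)" if "x \<in> \<Omega>" for x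
  proof -
    have x: "norm x > 0" using norm_ge[OF that] r by linarith
    have w: "W x powr (p - 1) = a powr (p - 1) * norm x powr (- \<gamma> * (p - 1))"
      unfolding W_def a_def[symmetric] using a x by (simp add: powr_mult powr_powr)
    have q: "norm x powr (- \<gamma> * (p - 1)) / norm x powr p = norm x powr (- \<sigma>)"
      by (subst powr_diff[symmetric]) (simp add: \<sigma>_def algebra_simps)
    have m: "(\<gamma> * a) powr (p - 1) = \<gamma> powr (p - 1) * a powr (p - 1)" using \<gamma> a by (simp add: powr_mult)
    have s: "real DIM('a) - \<sigma> = real DIM('a) - p - (p - 1) * \<gamma>" by (simp add: \<sigma>_def algebra_simps)
    show ?thesis unfolding hardy_const_def w m s q[symmetric]
      by (simp only: times_divide_eq_left times_divide_eq_right mult_ac)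
  qed
  note ibp = radial_field_integration_by_parts[OF phi zero_notin, of \<sigma>]
  obtain K where K: "compact K" "K \<subseteq> \<Omega>" "\<And>x. x \<notin> K \<Longrightarrow> \<phi> x = 0" "\<And>x. x \<notin> K \<Longrightarrow> gradient \<phi> x = 0"
    using C0_infinity_support[OF phi] by metis
  define F where "F x = - ((\<gamma> * a) powr (p - 1)) * (norm x powr (- \<sigma>) * (x \<bullet> gradient \<phi> x)
      + (real DIM('a) - \<sigma>) * (norm x powr (- \<sigma>) * \<phi> x))" for x
  have F0: "F x = 0" if "x \<notin> \<Omega>" for x
  proof -
    have "x \<notin> K" using K(2) that by auto
    then show ?thesis by (simp add: F_def K(3,4))
  qed
  have Fint: "integrable lborel F" unfolding F_def
    by (intro integrable_mult_right Bochner_Integration.integrable_add ibp(1,2))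
  have "(LINT x|lebesgue_on \<Omega>. (norm (DW x) powr (p - 2) *\<^sub>R DW x) \<bullet> gradient \<phi> x
     - hardy_const (real DIM('a)) p \<gamma> / norm x powr p * W x powr (p - 1) * \<phi> x) = (LINT x|lebesgue_on \<Omega>. F x)"
  proof (intro Bochner_Integration.integral_cong refl)
    fix x assume "x \<in> space (lebesgue_on \<Omega>)"
    then have x: "x \<in> \<Omega>" by (simp add: space_restrict_space)
    show "(norm (DW x) powr (p - 2) *\<^sub>R DW x) \<bullet> gradient \<phi> x
      - hardy_const (real DIM('a)) p \<gamma> / norm x powr p * W x powr (p - 1) * \<phi> x = F x"
      unfolding V[OF x] c[OF x] F_def by (simp add: algebra_simps)
  qed
  also have "\<dots> = (LINT x|lebesgue. indicator \<Omega> x *\<^sub>R F x)"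
    by (rule integral_restrict_space) (use open_\<Omega> in simp)
  also have "\<dots> = (LINT x|lebesgue. F x)"
    using F0 by (intro Bochner_Integration.integral_cong refl) (auto simp: indicator_def)
  also have "\<dots> = (LINT x|lborel. F x)"
    using borel_measurable_integrable[OF Fint] by (intro integral_completion)
  also have "\<dots> = - ((\<gamma> * a) powr (p - 1)) * ((LINT x|lborel. norm x powr (- \<sigma>) * (x \<bullet> gradient \<phi> x))
      + (real DIM('a) - \<sigma>) * (LINT x|lborel. norm x powr (- \<sigma>) * \<phi> x))"
    unfolding F_def using ibp(1,2) by simp
  also have "\<dots> = 0" unfolding ibp(3) by (simp add: algebra_simps)
  finally show ?thesis .
qed

end

section \<open>Truncation and the limit inequality\<close>

lemma integral_lebesgue_on_localize:
  fixes w \<psi> :: "'a::euclidean_space \<Rightarrow> real"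
  assumes "\<Omega> \<in> sets lebesgue" "K \<subseteq> \<Omega>" "\<And>x. x \<notin> K \<Longrightarrow> \<psi> x = 0"
  shows "(LINT x|lebesgue_on \<Omega>. w x * \<psi> x) = (LINT x|lebesgue. (indicator K x * w x) * \<psi> x)"
proof -
  have "(LINT x|lebesgue_on \<Omega>. w x * \<psi> x) = (LINT x|lebesgue. indicator \<Omega> x *\<^sub>R (w x * \<psi> x))"
    by (rule integral_restrict_space) (use assms in simp)
  also have "\<dots> = (LINT x|lebesgue. (indicator K x * w x) * \<psi> x)"
  proof (intro Bochner_Integration.integral_cong refl)
    fix x show "indicator \<Omega> x *\<^sub>R (w x * \<psi> x) = (indicator K x * w x) * \<psi> x"
      using assms(2) assms(3)[of x] by (cases "x \<in> K") auto
  qed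
  finally show ?thesis .
qed

lemma integrable_lebesgue_mult_bounded:
  fixes w \<psi> :: "'a::euclidean_space \<Rightarrow> real"
  assumes "integrable lebesgue w" "\<psi> \<in> borel_measurable borel" "\<And>x. \<bar>\<psi> x\<bar> \<le> B"
  shows "integrable lebesgue (\<lambda>x. w x * \<psi> x)"
proof (rule Bochner_Integration.integrable_bound)
  show "integrable lebesgue (\<lambda>x. B * w x)" using assms(1) by simp
  have "\<psi> \<in> borel_measurable lebesgue" using assms(2) by (simp add: measurable_completion)
  then show "(\<lambda>x. w x * \<psi> x) \<in> borel_measurable lebesgue" using assms(1) by simp
  have "B \<ge> 0" using assms(3)[of 0] by simp
  then have "norm (w x * \<psi> x) \<le> norm (B * w x)" for x
    using assms(3)[of x] by (simp add: abs_mult mult.commute[of B] mult_left_mono)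
  then show "AE x in lebesgue. norm (w x * \<psi> x) \<le> norm (B * w x)" by simp
qed

text \<open>Sobolev functions are given as Lebesgue measurable, whereas the results on translations
  and weak derivatives are stated for \<open>lborel\<close>. This is the bridge between
  them.\<close>

lemma borel_representative:
  fixes w :: "'a::euclidean_space \<Rightarrow> real"
  assumes "integrable lebesgue w"
  obtains b where "integrable lborel b" "AE x in lborel. w x = b x"
    "\<And>\<psi>. \<psi> \<in> borel_measurable borel \<Longrightarrow> (LINT x|lebesgue. w x * \<psi> x) = (LINT x|lborel. b x * \<psi> x)"
proof -
  obtain b where b: "b \<in> borel_measurable lborel" "AE x in lborel. w x = b x"
    using completion_ex_borel_measurable_real[OF borel_measurable_integrable[OF assms]] by auto
  have AE: "AE x in lebesgue. w x = b x" using b(2) by (rule AE_completion)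
  have bl: "b \<in> borel_measurable lebesgue" using b(1) by (rule measurable_completion)
  have "integrable lebesgue b" using integrable_cong_AE[of w lebesgue b] assms bl AE by auto
  then have "integrable lborel b" using integrable_completion[OF b(1)] by simp
  moreover have "(LINT x|lebesgue. w x * \<psi> x) = (LINT x|lborel. b x * \<psi> x)" if "\<psi> \<in> borel_measurable borel" for \<psi>
  proof -
    have pl: "\<psi> \<in> borel_measurable lebesgue" using that by (simp add: measurable_completion)
    have "(LINT x|lebesgue. w x * \<psi> x) = (LINT x|lebesgue. b x * \<psi> x)"
      by (rule integral_cong_AE) (use assms bl pl AE in \<open>auto elim!: eventually_mono\<close>)
    also have "\<dots> = (LINT x|lborel. b x * \<psi> x)"
      by (rule integral_completion) (use b(1) that in simp)
    finally show ?thesis .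
  qed
  ultimately show ?thesis using that b(2) by blast
qed

lemma AE_lebesgue_on_iff_negligible:
  assumes "\<Omega> \<in> sets lebesgue" "negligible {x \<in> \<Omega>. \<not> P x}"
  shows "AE x in lebesgue_on \<Omega>. P x"
proof -
  have "AE x in lebesgue. x \<notin> {x \<in> \<Omega>. \<not> P x}" using assms(2) unfolding negligible_iff_null_sets by (rule AE_not_in)
  then have "AE x in lebesgue. x \<in> \<Omega> \<longrightarrow> P x" by eventually_elim auto
  then show ?thesis using assms(1) by (subst AE_restrict_space_iff) auto
qed

lemma negligible_if_AE:
  assumes "AE x in lebesgue. x \<notin> S"
  shows "negligible S"
proof -
  obtain N where N: "N \<in> null_sets lebesgue" "{x \<in> space lebesgue. \<not> x \<notin> S} \<subseteq> N"
    using assms unfolding eventually_ae_filter by blast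
  then have "negligible N" "S \<subseteq> N" by (auto simp: negligible_iff_null_sets)
  then show ?thesis by (rule negligible_subset)
qed

text \<open>Where \<open>u < k\<close>, the weak gradient of \<open>(k - u)\<^sup>+\<close> is \<open>- \<nabla>u\<close>: their sum is the weak gradient of
  \<open>(u - k)\<^sup>+\<close>, which vanishes there.\<close>

lemma weak_gradient_truncation:
  fixes u v :: "'a::euclidean_space \<Rightarrow> real" and G G' :: "'a \<Rightarrow> 'a"
  assumes op: "open \<Omega>" and u: "has_weak_gradient \<Omega> u G" and v: "has_weak_gradient \<Omega> v G'"
    and eq: "\<And>x. x \<in> \<Omega> \<Longrightarrow> norm x < R \<Longrightarrow> v x = max (k - u x) 0"
  shows "AE x in lebesgue_on \<Omega>. norm x < R \<longrightarrow> u x < k \<longrightarrow> G' x = - G x"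
proof (rule AE_lebesgue_on_iff_negligible)
  show \<Omega>: "\<Omega> \<in> sets lebesgue" using op by simp
  define S where "S = {x \<in> \<Omega>. \<not> (norm x < R \<longrightarrow> u x < k \<longrightarrow> G' x = - G x)}"
  have "negligible S"
  \<comment> \<open>Local integrability gives integrable functions only on compact sets, so the
    claim is checked near each point of the exceptional set, inside one ball.\<close>
  proof (subst locally_negligible_alt, intro ballI)
    fix x0 assume x0: "x0 \<in> S"
    have "open (\<Omega> \<inter> ball 0 R)" "x0 \<in> \<Omega> \<inter> ball 0 R" using x0 op by (auto simp: S_def)
    then obtain \<rho> where \<rho>: "\<rho> > 0" "cball x0 \<rho> \<subseteq> \<Omega> \<inter> ball 0 R" using open_contains_cball by meson
    define \<delta> where "\<delta> = \<rho> / 2"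
    have \<delta>: "\<delta> > 0" "2 * \<delta> = \<rho>" using \<rho> by (auto simp: \<delta>_def)
    define K where "K = cball x0 \<rho>"
    have K: "compact K" "K \<subseteq> \<Omega>" "\<And>x. x \<in> K \<Longrightarrow> norm x < R" using \<rho> by (auto simp: K_def)
    have ai: "u absolutely_integrable_on K" "G absolutely_integrable_on K"
      "v absolutely_integrable_on K" "G' absolutely_integrable_on K"
      using u v K by (auto simp: has_weak_gradient_def locally_integrable_def)
    have iu: "integrable lebesgue (\<lambda>x. indicator K x * u x)" and iv: "integrable lebesgue (\<lambda>x. indicator K x * v x)"
      using ai(1,3) unfolding set_integrable_def by simp_all
    have iG: "integrable lebesgue (\<lambda>x. indicator K x * (G x \<bullet> i))" and iG': "integrable lebesgue (\<lambda>x. indicator K x * (G' x \<bullet> i))" for i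
      using ai(2,4) integrable_inner_left[of i lebesgue "\<lambda>x. indicator K x *\<^sub>R G x"]
        integrable_inner_left[of i lebesgue "\<lambda>x. indicator K x *\<^sub>R G' x"] unfolding set_integrable_def by simp_all
    have ik: "integrable lebesgue (\<lambda>x. indicator K x * k)"
      using K(1) by (intro integrable_mult_left integrable_real_indicator)
        (use K(1) emeasure_bounded_finite[OF compact_imp_bounded[OF K(1)]] in \<open>auto simp: compact_imp_closed\<close>)
    have main: "negligible {x \<in> ball x0 \<delta>. u x < k \<and> (G x + G' x) \<bullet> i \<noteq> 0}" if i: "i \<in> Basis" for i
    proof -
      \<comment> \<open>On \<open>K\<close> this is the positive part of \<open>u - k\<close>, and
        \<open>Z\<close> is its weak derivative in direction \<open>i\<close>. On
        \<open>{u < k}\<close> it vanishes, so \<open>Z\<close> has to vanish there as well.\<close>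
      define z where "z x = indicator K x * (u x - k + v x)" for x
      define Z where "Z x = indicator K x * ((G x + G' x) \<bullet> i)" for x
      have zint: "integrable lebesgue z" unfolding z_def
        using Bochner_Integration.integrable_add[OF Bochner_Integration.integrable_diff[OF iu ik] iv] by (simp add: algebra_simps)
      have Zint: "integrable lebesgue Z" unfolding Z_def
        using Bochner_Integration.integrable_add[OF iG[of i] iG'[of i]] by (simp add: algebra_simps inner_add_left)
      obtain zb where zb: "integrable lborel zb" "AE x in lborel. z x = zb x"
        "\<And>\<psi>. \<psi> \<in> borel_measurable borel \<Longrightarrow> (LINT x|lebesgue. z x * \<psi> x) = (LINT x|lborel. zb x * \<psi> x)"
        using borel_representative[OF zint] by blast
      obtain Zb where Zb: "integrable lborel Zb" "AE x in lborel. Z x = Zb x"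
        "\<And>\<psi>. \<psi> \<in> borel_measurable borel \<Longrightarrow> (LINT x|lebesgue. Z x * \<psi> x) = (LINT x|lborel. Zb x * \<psi> x)"
        using borel_representative[OF Zint] by blast
      have z0: "z x \<ge> 0" for x using eq[of x] K(2) K(3)[of x] by (auto simp: z_def indicator_def max_def)
      \<comment> \<open>\<open>weak_derivative_zero\<close> asks for nonnegativity at every point,
        but the Borel representative is nonnegative only almost everywhere.\<close>
      define zp where "zp x = max (zb x) 0" for x
      have zpint: "integrable lborel zp" unfolding zp_def using zb(1) by (intro integrable_max) auto
      have zp_eq: "AE x in lborel. zp x = zb x" using zb(2)
      proof eventually_elim
        case (elim x) then show ?case using z0[of x] by (simp add: zp_def)
      qed
      note [measurable] = borel_measurable_integrable[OF zpint] borel_measurable_integrable[OF zb(1)]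
      have weak: "(LINT x|lborel. zp x * (gradient \<phi> x \<bullet> i)) = - (LINT x|lborel. Zb x * \<phi> x)"
        if phi: "\<phi> \<in> C0_infinity (ball x0 (2 * \<delta>))" for \<phi>
      proof -
        have phi\<Omega>: "\<phi> \<in> C0_infinity \<Omega>" using phi K(2) ball_subset_cball[of x0 \<rho>] \<delta>(2)
          by (intro C0_infinity_mono[OF _ phi]) (auto simp: K_def)
        note [measurable] = C0_infinity_borel[OF phi] C0_infinity_gradient_borel[OF phi]
        obtain L where L: "L \<subseteq> ball x0 (2 * \<delta>)" "\<And>x. x \<notin> L \<Longrightarrow> \<phi> x = 0" "\<And>x. x \<notin> L \<Longrightarrow> gradient \<phi> x = 0"
          using C0_infinity_support[OF phi] by metis
        have LK: "L \<subseteq> K" using L(1) \<delta>(2) ball_subset_cball[of x0 \<rho>] by (auto simp: K_def)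
        have off: "\<phi> x = 0" "gradient \<phi> x \<bullet> i = 0" if "x \<notin> K" for x
        proof -
          have "x \<notin> L" using LK that by auto
          then show "\<phi> x = 0" "gradient \<phi> x \<bullet> i = 0" using L(2,3) by simp_all
        qed
        obtain B where B: "\<And>x. \<bar>\<phi> x\<bar> \<le> B" "\<And>x. norm (gradient \<phi> x) \<le> B"
          using C0_infinity_bounded[OF phi] by metis
        have Bg: "\<bar>gradient \<phi> x \<bullet> i\<bar> \<le> B" for x
          using B(2)[of x] Basis_le_norm[OF i, of "gradient \<phi> x"] by linarith
        have mg: "(\<lambda>x. gradient \<phi> x \<bullet> i) \<in> borel_measurable borel" by measurable
        note mb = integrable_lebesgue_mult_bounded[OF _ mg Bg] integrable_lebesgue_mult_bounded[OF _ C0_infinity_borel[OF phi] B(1)]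
        \<comment> \<open>The constant \<open>k\<close> has zero derivative: it meets only the
          integral of a gradient of a test function.\<close>
        have k0: "(LINT x|lebesgue. (indicator K x * k) * (gradient \<phi> x \<bullet> i)) = 0"
        proof -
          have "(LINT x|lebesgue. (indicator K x * k) * (gradient \<phi> x \<bullet> i)) = (LINT x|lebesgue. k * (gradient \<phi> x \<bullet> i))"
          proof (intro Bochner_Integration.integral_cong refl)
            fix x show "(indicator K x * k) * (gradient \<phi> x \<bullet> i) = k * (gradient \<phi> x \<bullet> i)"
              using off[of x] by (cases "x \<in> K") auto
          qed
          also have "\<dots> = k * (LINT x|lebesgue. gradient \<phi> x \<bullet> i)" by simp
          also have "(LINT x|lebesgue. gradient \<phi> x \<bullet> i) = (LINT x|lborel. gradient \<phi> x \<bullet> i)"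
            by (rule integral_completion) simp
          finally show ?thesis using integral_gradient_eq_0[OF phi, of i] by simp
        qed
        have "(LINT x|lborel. zp x * (gradient \<phi> x \<bullet> i)) = (LINT x|lborel. zb x * (gradient \<phi> x \<bullet> i))"
          by (rule integral_cong_AE) (use zp_eq in \<open>auto elim!: eventually_mono\<close>)
        also have "\<dots> = (LINT x|lebesgue. z x * (gradient \<phi> x \<bullet> i))" using zb(3)[OF mg] by simp
        also have "\<dots> = (LINT x|lebesgue. (indicator K x * u x) * (gradient \<phi> x \<bullet> i)
            - (indicator K x * k) * (gradient \<phi> x \<bullet> i) + (indicator K x * v x) * (gradient \<phi> x \<bullet> i))"
          by (simp add: z_def algebra_simps)
        also have "\<dots> = (LINT x|lebesgue. (indicator K x * u x) * (gradient \<phi> x \<bullet> i))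
            - (LINT x|lebesgue. (indicator K x * k) * (gradient \<phi> x \<bullet> i)) + (LINT x|lebesgue. (indicator K x * v x) * (gradient \<phi> x \<bullet> i))"
          using mb(1)[OF iu] mb(1)[OF ik] mb(1)[OF iv]
          by (simp only: Bochner_Integration.integral_add Bochner_Integration.integral_diff Bochner_Integration.integrable_diff)
        also have "\<dots> = (LINT x|lebesgue_on \<Omega>. u x * (gradient \<phi> x \<bullet> i)) + (LINT x|lebesgue_on \<Omega>. v x * (gradient \<phi> x \<bullet> i))"
          using integral_lebesgue_on_localize[OF \<Omega> K(2), of "\<lambda>x. gradient \<phi> x \<bullet> i"] off(2) k0 by simp
        also have "\<dots> = - (LINT x|lebesgue_on \<Omega>. (G x \<bullet> i) * \<phi> x) - (LINT x|lebesgue_on \<Omega>. (G' x \<bullet> i) * \<phi> x)"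
          using u v phi\<Omega> i by (simp add: has_weak_gradient_def)
        also have "\<dots> = - ((LINT x|lebesgue. (indicator K x * (G x \<bullet> i)) * \<phi> x) + (LINT x|lebesgue. (indicator K x * (G' x \<bullet> i)) * \<phi> x))"
          using integral_lebesgue_on_localize[OF \<Omega> K(2), of \<phi>] off(1) by simp
        also have "\<dots> = - (LINT x|lebesgue. (indicator K x * (G x \<bullet> i)) * \<phi> x + (indicator K x * (G' x \<bullet> i)) * \<phi> x)"
          using mb(2)[OF iG[of i]] mb(2)[OF iG'[of i]] by (simp only: Bochner_Integration.integral_add)
        also have "\<dots> = - (LINT x|lebesgue. Z x * \<phi> x)" by (simp add: Z_def algebra_simps inner_add_left)
        also have "\<dots> = - (LINT x|lborel. Zb x * \<phi> x)" using Zb(3) by simp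
        finally show ?thesis .
      qed
      have "AE x in lborel. x \<in> ball x0 \<delta> \<longrightarrow> zp x = 0 \<longrightarrow> Zb x = 0"
        by (rule weak_derivative_zero[OF zpint Zb(1) \<delta>(1) i weak]) (auto simp: zp_def)
      then have "AE x in lborel. x \<notin> {x \<in> ball x0 \<delta>. u x < k \<and> (G x + G' x) \<bullet> i \<noteq> 0}"
        using zp_eq zb(2) Zb(2)
      proof eventually_elim
        case (elim x)
        show ?case
        proof
          assume x: "x \<in> {x \<in> ball x0 \<delta>. u x < k \<and> (G x + G' x) \<bullet> i \<noteq> 0}"
          then have xK: "x \<in> K" using \<delta> by (auto simp: K_def)
          have "z x = 0" using x eq[of x] K(2) K(3)[of x] xK by (auto simp: z_def)
          then have "Zb x = 0" using elim x by simp
          then show False using elim(4) x xK by (simp add: Z_def)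
        qed
      qed
      then have "AE x in lebesgue. x \<notin> {x \<in> ball x0 \<delta>. u x < k \<and> (G x + G' x) \<bullet> i \<noteq> 0}" by (rule AE_completion)
      then show ?thesis by (rule negligible_if_AE)
    qed
    show "\<exists>U. openin (top_of_set S) U \<and> x0 \<in> U \<and> negligible U"
    proof (intro exI conjI)
      show "openin (top_of_set S) (S \<inter> ball x0 \<delta>)" by (simp add: openin_open_Int)
      show "x0 \<in> S \<inter> ball x0 \<delta>" using x0 \<delta> by simp
      have "S \<inter> ball x0 \<delta> \<subseteq> (\<Union>i\<in>Basis. {x \<in> ball x0 \<delta>. u x < k \<and> (G x + G' x) \<bullet> i \<noteq> 0})"
      proof
        fix x assume x: "x \<in> S \<inter> ball x0 \<delta>"
        then have "G x + G' x \<noteq> 0" by (auto simp: S_def add_eq_0_iff)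
        then obtain i where "i \<in> Basis" "(G x + G' x) \<bullet> i \<noteq> 0"
          using euclidean_all_zero_iff[of "G x + G' x"] by auto
        then show "x \<in> (\<Union>i\<in>Basis. {x \<in> ball x0 \<delta>. u x < k \<and> (G x + G' x) \<bullet> i \<noteq> 0})"
          using x by (auto simp: S_def)
      qed
      then show "negligible (S \<inter> ball x0 \<delta>)"
        by (rule negligible_subset[rotated]) (intro negligible_Union finite_imageI finite_Basis; use main in auto)
    qed
  qed
  then show "negligible {x \<in> \<Omega>. \<not> (norm x < R \<longrightarrow> u x < k \<longrightarrow> G' x = - G x)}" by (simp only: S_def)
qed

section \<open>Comparison of the two tested equations\<close>

context barrier
begin

text \<open>The potential term of \<open>W\<close> minus that of \<open>u\<close>, tested with their
  respective functions. The factor \<open>T powr (p - 1)\<close> in the test function for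
  \<open>u\<close> trades \<open>u powr (p - 1)\<close> for a power of \<open>W\<close>, up to the
  error \<open>u / (u + \<epsilon>)\<close> due to the shift.\<close>

definition excess :: "real \<Rightarrow> ('a \<Rightarrow> real) \<Rightarrow> 'a \<Rightarrow> real"
  where "excess \<mu> u x = norm x powr (- p) * W x powr p * profile (W x / (u x + \<epsilon>))
    * (hardy_const (real DIM('a)) p \<gamma> - \<mu> * (u x / (u x + \<epsilon>)) powr (p - 1))"

text \<open>In the limit, testing the inequality for \<open>u\<close> with \<open>Q.test\<close>
  gives a nonnegative integral of \<open>I1\<close>, and testing the equation of \<open>W\<close>
  with \<open>P.test\<close> gives a zero integral of \<open>I2\<close>. By \<open>energy_le\<close>
  the energy terms drop out of \<open>I1 - I2\<close>, and what is left is at most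
  \<open>excess\<close>.\<close>

lemma excess_integral_nonneg:
  fixes u v g :: "'a \<Rightarrow> real" and G G' :: "'a \<Rightarrow> 'a" and \<phi> :: "nat \<Rightarrow> 'a \<Rightarrow> real" and \<mu> q :: real
  assumes \<mu>: "\<mu> \<ge> 0" and q: "p - 1 \<le> q"
    and u: "u \<in> Lspace q \<Omega>" and G: "G \<in> Lspace p \<Omega>"
    and u0: "AE x in lebesgue_on \<Omega>. u x \<ge> 0"
    and super: "\<And>\<phi>. \<phi> \<in> C0_infinity \<Omega> \<Longrightarrow> (\<And>x. \<phi> x \<ge> 0) \<Longrightarrow>
      0 \<le> (LINT x|lebesgue_on \<Omega>. norm (G x) powr (p - 2) * (G x \<bullet> gradient \<phi> x)
          - \<mu> / norm x powr p * (\<bar>u x\<bar> powr (p - 2) * u x * \<phi> x))"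
    and phi: "\<And>n. \<phi> n \<in> C0_infinity \<Omega>"
    and v: "v \<in> borel_measurable (lebesgue_on \<Omega>)" and G': "G' \<in> Lspace p \<Omega>"
    and g: "integrable (lebesgue_on \<Omega>) g"
    and dom: "AE x in lebesgue_on \<Omega>. \<forall>n. \<bar>\<phi> n x - v x\<bar> powr p + norm (gradient (\<phi> n) x - G' x) powr p \<le> g x"
    and lim: "AE x in lebesgue_on \<Omega>. (\<lambda>n. \<bar>\<phi> n x - v x\<bar> powr p + norm (gradient (\<phi> n) x - G' x) powr p) \<longlonglongrightarrow> 0"
    and v_le: "AE x in lebesgue_on \<Omega>. v x \<le> k"
    and v_eq: "\<And>x. x \<in> \<Omega> \<Longrightarrow> norm x < R \<Longrightarrow> v x = max (k - u x) 0"
    and G'_eq: "AE x in lebesgue_on \<Omega>. norm x < R \<longrightarrow> u x < k \<longrightarrow> G' x = - G x"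
    and J: "integrable (lebesgue_on \<Omega>) (excess \<mu> u)"
  shows "0 \<le> (LINT x|lebesgue_on \<Omega>. excess \<mu> u x)"
proof -
  define N where "N = real DIM('a)"
  have \<Omega>: "\<Omega> \<in> sets lebesgue" using open_\<Omega> by simp
  have inO: "AE x in lebesgue_on \<Omega>. x \<in> \<Omega>" by (rule AE_I2) (simp add: space_restrict_space)
  have BR: "ball 0 R \<inter> \<Omega> \<in> sets (lebesgue_on \<Omega>)"
    unfolding sets_restrict_space by (rule image_eqI[of _ _ "ball 0 R"]) auto
  have BRint: "integrable (lebesgue_on \<Omega>) (indicator (ball 0 R \<inter> \<Omega>) :: 'a \<Rightarrow> real)"
  proof (intro integrable_real_indicator BR)
    have "emeasure (lebesgue_on \<Omega>) (ball 0 R \<inter> \<Omega>) = emeasure lebesgue (ball 0 R \<inter> \<Omega>)"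
      using \<Omega> by (simp add: emeasure_restrict_space)
    also have "\<dots> \<le> emeasure lebesgue (ball (0::'a) R)" by (intro emeasure_mono) auto
    also have "\<dots> < \<infinity>" using emeasure_lborel_ball_finite[of "0::'a" R] by simp
    finally show "emeasure (lebesgue_on \<Omega>) (ball 0 R \<inter> \<Omega>) < \<infinity>" .
  qed
  have um: "u \<in> borel_measurable (lebesgue_on \<Omega>)" and ui: "integrable (lebesgue_on \<Omega>) (\<lambda>x. \<bar>u x\<bar> powr q)"
    using u by (simp_all add: Lspace_def)
  have Gm: "G \<in> borel_measurable (lebesgue_on \<Omega>)" and Gi: "integrable (lebesgue_on \<Omega>) (\<lambda>x. norm (G x) powr p)"
    using G by (simp_all add: Lspace_def)
  have G'm: "G' \<in> borel_measurable (lebesgue_on \<Omega>)" and G'i: "integrable (lebesgue_on \<Omega>) (\<lambda>x. norm (G' x) powr p)"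
    using G' by (simp_all add: Lspace_def)
  note [measurable] = um Gm G'm v borel_measurable_lebesgue_on_id[of \<Omega>]
    borel_measurable_lebesgue_on[OF W_measurable, of \<Omega>] borel_measurable_lebesgue_on[OF DW_measurable, of \<Omega>]
  define V1 where "V1 x = norm (G x) powr (p - 2) *\<^sub>R G x" for x
  define c1 where "c1 x = \<mu> / norm x powr p * (\<bar>u x\<bar> powr (p - 2) * u x)" for x
  \<comment> \<open>\<open>u\<close> is only known to have an integrable power \<open>q\<close>; on
    the bounded set where the test functions live, \<open>\<bar>u\<bar> powr (p - 1)\<close> is
    controlled by \<open>1 + \<bar>u\<bar> powr q\<close>.\<close>
  define A1 where "A1 x = norm (G x) powr p + \<mu> / r powr p * (indicator (ball 0 R \<inter> \<Omega>) x + \<bar>u x\<bar> powr q)" for x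
  define V2 where "V2 x = norm (DW x) powr (p - 2) *\<^sub>R DW x" for x
  define c2 where "c2 x = hardy_const N p \<gamma> / norm x powr p * W x powr (p - 1)" for x
  define A2 where "A2 x = ((\<gamma> * k / r) powr p + \<bar>hardy_const N p \<gamma>\<bar> / r powr p * k powr (p - 1)) * indicator (ball 0 R \<inter> \<Omega>) x" for x :: 'a
  have norm_V: "norm (norm X powr (p - 2) *\<^sub>R X) * b \<le> norm X powr p + 1 * b powr p" if "b \<ge> 0" for X :: 'a and b
    using powr_mult_le_add[OF norm_ge_zero that p, of X] powr_minus_2_mult[of "norm X" p] by simp
  have rp: "norm x powr p \<ge> r powr p" if "x \<in> \<Omega>" for x
    using norm_ge[OF that] r p by (intro powr_mono2) auto
  have c1_le: "\<bar>c1 x\<bar> \<le> \<mu> / r powr p * (1 + \<bar>u x\<bar> powr q)" if "x \<in> \<Omega>" for x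
  proof -
    have "\<bar>c1 x\<bar> = \<mu> / norm x powr p * \<bar>u x\<bar> powr (p - 1)"
      unfolding c1_def using \<mu> powr_minus_2_mult[of "\<bar>u x\<bar>" p] by (simp add: abs_mult)
    also have "\<dots> \<le> \<mu> / r powr p * (1 + \<bar>u x\<bar> powr q)"
      using rp[OF that] \<mu> r q p powr_le_one_add[of "\<bar>u x\<bar>" "p - 1" q] by (intro mult_mono divide_left_mono mult_pos_pos) auto
    finally show ?thesis .
  qed
  have mV1: "V1 \<in> borel_measurable (lebesgue_on \<Omega>)" unfolding V1_def by measurable
  have mc1: "c1 \<in> borel_measurable (lebesgue_on \<Omega>)" unfolding c1_def by measurable
  have iA1: "integrable (lebesgue_on \<Omega>) A1" unfolding A1_def
    by (intro Bochner_Integration.integrable_add integrable_mult_right Gi ui BRint)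
  have V1_le: "norm (V1 x) * b \<le> A1 x + 1 * b powr p" if "x \<in> \<Omega>" "norm x < R" "0 \<le> b" for x b
  proof -
    have "0 \<le> \<mu> / r powr p * (indicator (ball 0 R \<inter> \<Omega>) x + \<bar>u x\<bar> powr q)"
      using \<mu> by (intro mult_nonneg_nonneg add_nonneg_nonneg) auto
    then show ?thesis using norm_V[OF that(3), of "G x"] unfolding V1_def A1_def by linarith
  qed
  have c1_le: "\<bar>c1 x\<bar> \<le> A1 x" if "x \<in> \<Omega>" "norm x < R" for x
  proof -
    have "\<bar>c1 x\<bar> \<le> \<mu> / r powr p * (indicator (ball 0 R \<inter> \<Omega>) x + \<bar>u x\<bar> powr q)" using c1_le[of x] that by simp
    then show ?thesis using powr_ge_zero[of "norm (G x)" p] unfolding A1_def by linarith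
  qed
  note lim1 = Q.test_limit[OF phi v G'm mV1 mc1 iA1 g G'i zero_le_one V1_le c1_le dom lim]
  have mV2: "V2 \<in> borel_measurable (lebesgue_on \<Omega>)" unfolding V2_def by measurable
  have mc2: "c2 \<in> borel_measurable (lebesgue_on \<Omega>)" unfolding c2_def by measurable
  have iA2: "integrable (lebesgue_on \<Omega>) A2" unfolding A2_def by (intro integrable_mult_right BRint)
  have V2_le: "norm (V2 x) * b \<le> A2 x + 1 * b powr p" if x: "x \<in> \<Omega>" "norm x < R" and b: "0 \<le> b" for x b
  proof -
    have "norm (DW x) powr p \<le> (\<gamma> * k / r) powr p" using norm_DW_le[OF x(1)] p by (intro powr_mono2) auto
    moreover have "0 \<le> \<bar>hardy_const N p \<gamma>\<bar> / r powr p * k powr (p - 1)" by simp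
    moreover have "A2 x = (\<gamma> * k / r) powr p + \<bar>hardy_const N p \<gamma>\<bar> / r powr p * k powr (p - 1)"
      using x by (simp add: A2_def)
    ultimately show ?thesis using norm_V[OF b, of "DW x"] unfolding V2_def by linarith
  qed
  have c2_le: "\<bar>c2 x\<bar> \<le> A2 x" if x: "x \<in> \<Omega>" "norm x < R" for x
  proof -
    have "\<bar>c2 x\<bar> = \<bar>hardy_const N p \<gamma>\<bar> / norm x powr p * W x powr (p - 1)"
      unfolding c2_def by (simp add: abs_mult)
    also have "\<dots> \<le> \<bar>hardy_const N p \<gamma>\<bar> / r powr p * k powr (p - 1)"
      using rp[OF x(1)] r p W_le_k[OF x(1)] W_nonneg[of x] norm_ge[OF x(1)]
      by (intro mult_mono divide_left_mono mult_pos_pos powr_mono2) auto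
    also have "\<dots> \<le> A2 x" using x unfolding A2_def by simp
    finally show ?thesis .
  qed
  note lim2 = P.test_limit[OF phi v G'm mV2 mc2 iA2 g G'i zero_le_one V2_le c2_le dom lim]
  define I1 where "I1 x = V1 x \<bullet> Q.Dtest (v x) (G' x) x - c1 x * (W x * power_profile p (W x * Y (v x)))" for x
  define I2 where "I2 x = V2 x \<bullet> P.Dtest (v x) (G' x) x - c2 x * (W x * profile (W x * Y (v x)))" for x
  have "0 \<le> (LINT x|lebesgue_on \<Omega>. V1 x \<bullet> gradient (Q.test (\<phi> n)) x - c1 x * Q.test (\<phi> n) x)" for n
    using super[OF Q.test_C0_infinity[OF phi[of n]] Q.test_nonneg] by (simp add: V1_def c1_def mult.assoc)
  then have 1: "0 \<le> (LINT x|lebesgue_on \<Omega>. I1 x)" unfolding I1_def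
    by (intro LIMSEQ_le_const[OF lim1(2)]) auto
  have "(LINT x|lebesgue_on \<Omega>. V2 x \<bullet> gradient (P.test (\<phi> n)) x - c2 x * P.test (\<phi> n) x) = 0" for n
    using W_equation[OF P.test_C0_infinity[OF phi[of n]]] by (simp add: V2_def c2_def N_def)
  then have 2: "(LINT x|lebesgue_on \<Omega>. I2 x) = 0"
    using LIMSEQ_unique[OF lim2(2)] unfolding I2_def by simp
  have "AE x in lebesgue_on \<Omega>. I1 x - I2 x \<le> excess \<mu> u x"
    using inO u0 v_le G'_eq
  proof eventually_elim
    case (elim x)
    note x = elim(1)
    have Wn: "W x > 0" by (rule W_pos[OF x])
    have far: "W x \<le> \<epsilon> / 2" if "norm x \<ge> R" using R[OF that] by (simp add: W_def)
    show ?case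
    proof (cases "W x * Y (v x) \<le> 1")
      case True
      \<comment> \<open>\<open>v\<close> determines \<open>u\<close> only inside the ball of radius
        \<open>R\<close> and where \<open>u < k\<close>. Both follow from
        \<open>W > u + \<epsilon>\<close>: beyond \<open>R\<close> the barrier is at most
        \<open>\<epsilon> / 2\<close>, and it never exceeds \<open>k\<close>.\<close>
      have "W x / (u x + \<epsilon>) \<le> 1"
      proof (rule ccontr)
        assume "\<not> ?thesis"
        then have gt: "W x > u x + \<epsilon>" using elim(2) e by (simp add: divide_simps split: if_splits)
        then have nx: "norm x < R" using far elim(2) e by force
        have "u x < k" using gt W_le_k[OF x] e by linarith
        then have "v x = k - u x" using v_eq[OF x nx] by simp
        then have "Y (v x) = 1 / (u x + \<epsilon>)" using Y_eq[of "v x"] elim(2) by simp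
        then have "W x * Y (v x) = W x / (u x + \<epsilon>)" by simp
        also have "\<dots> > 1" using gt elim(2) e by (simp add: less_divide_eq)
        finally show False using True by simp
      qed
      then show ?thesis using True
        by (simp add: I1_def I2_def excess_def P.Dtest_eq_0 Q.Dtest_eq_0 profile_eq_0 power_profile_eq_0)
    next
      case False
      then have nx: "norm x < R" using WY_le_1[of x "v x"] by (meson not_le)
      have "u x < k"
      proof (rule ccontr)
        assume "\<not> u x < k"
        then have "v x = 0" using v_eq[OF x nx] by simp
        then have "W x * Y (v x) = W x / (k + \<epsilon>)" using Y_eq[of 0] k by simp
        also have "\<dots> \<le> 1" using W_le_k[OF x] k e by (simp add: divide_simps)
        finally show False using False by simp
      qed
      then have vx: "v x = k - u x" and gx: "G' x = - G x" using v_eq[OF x nx] elim(4) nx by auto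
      have T: "W x * Y (v x) = W x / (u x + \<epsilon>)" using Y_eq[of "v x"] vx elim(2) by simp
      define T where "T = W x / (u x + \<epsilon>)"
      have Tpos: "T > 1" using False T by (simp add: T_def)
      have "V1 x \<bullet> Q.Dtest (v x) (G' x) x \<le> V2 x \<bullet> P.Dtest (v x) (G' x) x"
        unfolding V1_def V2_def gx by (rule energy_le) (rule elim(3))
      then have "I1 x - I2 x \<le> c2 x * (W x * profile T) - c1 x * (W x * power_profile p T)"
        unfolding I1_def I2_def T T_def[symmetric] by linarith
      also have "\<dots> = excess \<mu> u x"
      proof -
        have u1: "\<bar>u x\<bar> powr (p - 2) * u x = u x powr (p - 1)"
          using elim(2) powr_minus_2_mult[of "u x" p] by simp
        have w1: "W x powr (p - 1) * W x = W x powr p" using powr_minus_1_mult[of "W x" p] Wn by simp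
        have t1: "u x powr (p - 1) * (W x * T powr (p - 1)) = W x powr p * (u x / (u x + \<epsilon>)) powr (p - 1)"
          using elim(2) e Wn w1 by (simp add: T_def powr_divide mult_ac)
        have n1: "norm x powr (- p) = 1 / norm x powr p" by (simp add: powr_minus divide_inverse)
        have "c2 x * (W x * profile T) = hardy_const N p \<gamma> * (norm x powr (- p) * (W x powr (p - 1) * W x) * profile T)"
          unfolding c2_def n1 by simp
        moreover have "c1 x * (W x * power_profile p T) = \<mu> * (norm x powr (- p) * (u x powr (p - 1) * (W x * T powr (p - 1))) * profile T)"
          unfolding c1_def u1 n1 power_profile_def by simp
        ultimately show ?thesis unfolding t1 w1 excess_def T_def[symmetric] N_def by (simp add: algebra_simps)
      qed
      finally show ?thesis .
    qed
  qed
  then have "(LINT x|lebesgue_on \<Omega>. I1 x - I2 x) \<le> (LINT x|lebesgue_on \<Omega>. excess \<mu> u x)"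
    using lim1(1) lim2(1) J by (intro integral_mono_AE Bochner_Integration.integrable_diff) (auto simp: I1_def I2_def)
  moreover have "(LINT x|lebesgue_on \<Omega>. I1 x - I2 x) = (LINT x|lebesgue_on \<Omega>. I1 x) - (LINT x|lebesgue_on \<Omega>. I2 x)"
    using lim1(1) lim2(1) by (intro Bochner_Integration.integral_diff) (auto simp: I1_def I2_def)
  ultimately show ?thesis using 1 2 by linarith
qed

end

section \<open>Comparison with the barrier\<close>

lemma integrable_lebesgue_on_if_lborel:
  fixes f :: "'a::euclidean_space \<Rightarrow> real"
  assumes "integrable lborel f" "\<Omega> \<in> sets lebesgue"
  shows "integrable (lebesgue_on \<Omega>) f"
proof -
  have "integrable lebesgue f"
    using assms(1) integrable_completion[OF borel_measurable_integrable[OF assms(1)]] by simp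
  then have "integrable lebesgue (\<lambda>x. indicator \<Omega> x *\<^sub>R f x)" by (rule integrable_mult_indicator[OF assms(2)])
  then show ?thesis using integrable_restrict_space[of \<Omega> lebesgue f] assms(2) by simp
qed

lemma C0_infinity_integrable_powr:
  fixes \<phi> :: "'a::euclidean_space \<Rightarrow> real"
  assumes phi: "\<phi> \<in> C0_infinity U" and \<Omega>: "\<Omega> \<in> sets lebesgue" and p: "p > 0"
  shows "integrable (lebesgue_on \<Omega>) (\<lambda>x. norm (\<phi> x) powr p)"
    and "integrable (lebesgue_on \<Omega>) (\<lambda>x. norm (gradient \<phi> x) powr p)"
proof -
  obtain K where K: "compact K" "\<And>x. x \<notin> K \<Longrightarrow> \<phi> x = 0" "\<And>x. x \<notin> K \<Longrightarrow> gradient \<phi> x = 0"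
    using C0_infinity_support[OF phi] by metis
  show "integrable (lebesgue_on \<Omega>) (\<lambda>x. norm (\<phi> x) powr p)"
    by (intro integrable_lebesgue_on_if_lborel continuous_compact_support_integrable[OF _ K(1)]
        continuous_on_powr' continuous_on_norm continuous_on_const C0_infinity_continuous[OF phi] \<Omega>)
      (use K p in auto)
  show "integrable (lebesgue_on \<Omega>) (\<lambda>x. norm (gradient \<phi> x) powr p)"
    by (intro integrable_lebesgue_on_if_lborel continuous_compact_support_integrable[OF _ K(1)]
        continuous_on_powr' continuous_on_norm continuous_on_const C0_infinity_continuous_gradient[OF phi] \<Omega>)
      (use K p in auto)
qed

lemma integrable_powr_diff:
  fixes f g :: "'a::euclidean_space \<Rightarrow> 'b::euclidean_space"
  assumes [measurable]: "f \<in> borel_measurable M" "g \<in> borel_measurable M" and p: "p \<ge> 0"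
    and int: "integrable M (\<lambda>x. norm (f x) powr p)" "integrable M (\<lambda>x. norm (g x) powr p)"
  shows "integrable M (\<lambda>x. norm (f x - g x) powr p)"
proof (rule Bochner_Integration.integrable_bound)
  show "integrable M (\<lambda>x. 2 powr p * (norm (f x) powr p + norm (g x) powr p))"
    by (intro integrable_mult_right Bochner_Integration.integrable_add int)
  have "norm (f x - g x) powr p \<le> 2 powr p * (norm (f x) powr p + norm (g x) powr p)" for x
  proof -
    have "norm (f x - g x) powr p \<le> (norm (f x) + norm (g x)) powr p"
      using norm_triangle_ineq4[of "f x" "g x"] p by (intro powr_mono2) auto
    also have "\<dots> \<le> 2 powr p * (norm (f x) powr p + norm (g x) powr p)" using p by (intro powr_add_le) auto
    finally show ?thesis .
  qed
  then have "norm (norm (f x - g x) powr p) \<le> norm (2 powr p * (norm (f x) powr p + norm (g x) powr p))" for x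
    by (smt (verit) real_norm_def powr_ge_zero)
  then show "AE x in M. norm (norm (f x - g x) powr p) \<le> norm (2 powr p * (norm (f x) powr p + norm (g x) powr p))" by simp
qed measurable

lemma cutoff_exists:
  assumes R: "R > 0"
  obtains \<eta> :: "'a::euclidean_space \<Rightarrow> real" where "\<eta> \<in> C0_infinity UNIV" "\<And>x. 0 \<le> \<eta> x" "\<And>x. \<eta> x \<le> 1"
    "\<And>x. norm x \<le> R \<Longrightarrow> \<eta> x = 1"
proof
  define \<eta> where "\<eta> x = smooth_step (2 - (1 / R\<^sup>2) * (\<Sum>i\<in>Basis. (x \<bullet> i) * (x \<bullet> i)))" for x :: 'a
  have ss: "(\<Sum>i\<in>Basis. (x \<bullet> i) * (x \<bullet> i)) = (norm x)\<^sup>2" for x :: 'a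
    by (simp add: euclidean_inner[symmetric] dot_square_norm)
  have "Ck_on j UNIV (\<lambda>x::'a. 2 + (- (1 / R\<^sup>2)) * (\<Sum>i\<in>Basis. (x \<bullet> i) * (x \<bullet> i)))" for j
    by (intro Ck_on_add Ck_on_mult Ck_on_sum Ck_on_inner Ck_on_const open_UNIV)
  then have "Ck_on j UNIV (\<lambda>x::'a. 2 - (1 / R\<^sup>2) * (\<Sum>i\<in>Basis. (x \<bullet> i) * (x \<bullet> i)))" for j by simp
  from Ck_on_compose[OF open_UNIV this Ck_on_smooth_step] have sm: "Ck_on j UNIV \<eta>" for j
    by (simp add: \<eta>_def[abs_def])
  show "\<eta> \<in> C0_infinity UNIV"
  proof (rule C0_infinityI[OF open_UNIV sm, of "cball 0 (2 * R)"])
    fix x :: 'a assume "x \<notin> cball 0 (2 * R)"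
    then have "(norm x)\<^sup>2 \<ge> (2 * R)\<^sup>2" using R by (intro power_mono) auto
    moreover have "(2 * R)\<^sup>2 \<ge> 2 * R\<^sup>2" by (simp add: power_mult_distrib)
    ultimately have "2 * R\<^sup>2 \<le> (norm x)\<^sup>2" by linarith
    then have "(norm x)\<^sup>2 / R\<^sup>2 \<ge> 2" using R by (simp add: le_divide_eq)
    then show "\<eta> x = 0" unfolding \<eta>_def ss by (intro smooth_step_eq_0) simp
  qed auto
  show "0 \<le> \<eta> x" "\<eta> x \<le> 1" for x by (simp_all add: \<eta>_def smooth_step_nonneg smooth_step_le_1)
  show "\<eta> x = 1" if "norm x \<le> R" for x
  proof -
    have "(norm x)\<^sup>2 \<le> R\<^sup>2" using that by (intro power_mono) auto
    then have "(norm x)\<^sup>2 / R\<^sup>2 \<le> 1" using R by (simp add: divide_le_eq)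
    then show ?thesis unfolding \<eta>_def ss by (intro smooth_step_eq_1) simp
  qed
qed

lemma AE_eq_0_if_nonpos:
  assumes J: "integrable (M) J" "0 \<le> (LINT x|M. J x)"
    and le: "AE x in M. J x \<le> 0"
  shows "AE x in M. J x = (0::real)"
proof -
  have "(LINT x|M. - J x) \<ge> 0" using le by (intro integral_nonneg_AE) auto
  then have "(LINT x|M. - J x) = 0" using J(2) by simp
  then have "AE x in M. - J x = 0"
    using J(1) le by (subst (asm) integral_nonneg_eq_0_iff_AE) auto
  then show ?thesis by simp
qed

lemma le_if_profile_eq_0: "a > 0 \<Longrightarrow> profile (b / a) = 0 \<Longrightarrow> b \<le> a"
  using profile_pos[of "b / a"] by (simp add: divide_simps split: if_splits) force

text \<open>The same function as \<open>W\<close>, with the exponent as an argument, since the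
  comparison uses it for varying \<open>\<gamma>\<close>.\<close>

definition barrier_fun :: "real \<Rightarrow> real \<Rightarrow> real \<Rightarrow> 'a::euclidean_space \<Rightarrow> real"
  where "barrier_fun k r \<gamma> x = k * r powr \<gamma> * norm x powr (- \<gamma>)"

text \<open>What the comparison uses of a supersolution once \<open>f\<close> is discarded. The
  exponent \<open>\<gamma>\<close> and the shift \<open>\<epsilon>\<close> stay free because both
  will vary. \<open>G\<close> is an arbitrary weak gradient, as the definition of a supersolution
  refers to the one chosen for \<open>- u\<close>.\<close>

locale hardy_supersolution =
  fixes \<Omega> :: "'a::euclidean_space set" and p \<mu> q r k :: real and u :: "'a \<Rightarrow> real" and G :: "'a \<Rightarrow> 'a"
  assumes open_\<Omega>: "open \<Omega>" and r: "r > 0" and norm_ge: "\<And>x. x \<in> \<Omega> \<Longrightarrow> r \<le> norm x"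
    and p: "1 < p" "p < real DIM('a)" and \<mu>: "\<mu> \<ge> 0" and q: "p - 1 \<le> q" and k: "k > 0"
    and u: "u \<in> Lspace q \<Omega>" and G: "G \<in> Lspace p \<Omega>" and uG: "has_weak_gradient \<Omega> u G"
    and u0: "AE x in lebesgue_on \<Omega>. u x \<ge> 0"
    and super: "\<And>\<phi>. \<phi> \<in> C0_infinity \<Omega> \<Longrightarrow> (\<And>x. \<phi> x \<ge> 0) \<Longrightarrow>
      0 \<le> (LINT x|lebesgue_on \<Omega>. norm (G x) powr (p - 2) * (G x \<bullet> gradient \<phi> x)
          - \<mu> / norm x powr p * (\<bar>u x\<bar> powr (p - 2) * u x * \<phi> x))"
    and bdry: "boundary_ge p \<Omega> u k"
begin

abbreviation w where "w \<gamma> x \<equiv> barrier_fun k r \<gamma> x"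

text \<open>This is \<open>excess\<close> with \<open>\<gamma>\<close> and \<open>\<epsilon>\<close>
  as arguments, for the limits in which they move.\<close>

definition gap :: "real \<Rightarrow> real \<Rightarrow> 'a \<Rightarrow> real"
  where "gap \<gamma> \<epsilon> x = norm x powr (- p) * w \<gamma> x powr p * profile (w \<gamma> x / (u x + \<epsilon>))
    * (hardy_const (real DIM('a)) p \<gamma> - \<mu> * (u x / (u x + \<epsilon>)) powr (p - 1))"

text \<open>A majorant of \<open>gap\<close> independent of \<open>\<epsilon>\<close>, from
  \<open>profile \<le> 1\<close> and \<open>u / (u + \<epsilon>) \<le> 1\<close>.\<close>

definition gap_bound :: "real \<Rightarrow> 'a \<Rightarrow> real"
  where "gap_bound \<gamma> x = (\<bar>hardy_const (real DIM('a)) p \<gamma>\<bar> + \<mu>) * ((k * r powr \<gamma>) powr p *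
    (indicator {x. r \<le> norm x} x * norm x powr (- (p + \<gamma> * p))))"

lemma \<Omega>_sets: "\<Omega> \<in> sets lebesgue" using open_\<Omega> by simp

lemma in_\<Omega>: "AE x in lebesgue_on \<Omega>. x \<in> \<Omega>" by (rule AE_I2) (simp add: space_restrict_space)

lemma w_pos: "x \<in> \<Omega> \<Longrightarrow> w \<gamma> x > 0"
proof -
  assume "x \<in> \<Omega>"
  then have "norm x > 0" using norm_ge r by (meson less_le_trans)
  then show ?thesis using k r unfolding barrier_fun_def by (intro mult_pos_pos) auto
qed

text \<open>The decay rate \<open>p + \<gamma> * p\<close> exceeds the dimension exactly when
  \<open>\<gamma> > (N - p) / p\<close>.\<close>

lemma gap_bound_integrable:
  assumes \<gamma>: "\<gamma> > (real DIM('a) - p) / p"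
  shows "integrable (lebesgue_on \<Omega>) (gap_bound \<gamma>)"
proof -
  have "real DIM('a) < p + \<gamma> * p" using \<gamma> p by (simp add: divide_less_eq)
  then show ?thesis unfolding gap_bound_def
    by (intro integrable_lebesgue_on_if_lborel integrable_mult_right integrable_powr_exterior r \<Omega>_sets)
qed

lemma gap_measurable[measurable]: "gap \<gamma> \<epsilon> \<in> borel_measurable (lebesgue_on \<Omega>)"
proof -
  note [measurable] = borel_measurable_lebesgue_on_id[of \<Omega>]
  have [measurable]: "u \<in> borel_measurable (lebesgue_on \<Omega>)" using u by (simp add: Lspace_def)
  have [measurable]: "profile \<in> borel_measurable borel"
    using profile_smooth[of 0] by (simp add: borel_measurable_continuous_onI)
  show ?thesis unfolding gap_def barrier_fun_def by measurable
qed

lemma gap_le_bound: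
  assumes "\<epsilon> > 0"
  shows "AE x in lebesgue_on \<Omega>. norm (gap \<gamma> \<epsilon> x) \<le> gap_bound \<gamma> x"
  using in_\<Omega> u0
proof eventually_elim
  case (elim x)
  have x0: "norm x > 0" using norm_ge[OF elim(1)] r by linarith
  have "u x / (u x + \<epsilon>) \<le> 1" "0 \<le> u x / (u x + \<epsilon>)" using elim(2) assms by (auto simp: divide_simps)
  then have "(u x / (u x + \<epsilon>)) powr (p - 1) \<le> 1"
    using p powr_mono2[of "p - 1" "u x / (u x + \<epsilon>)" 1] by simp
  then have "\<mu> * (u x / (u x + \<epsilon>)) powr (p - 1) \<le> \<mu> * 1" using \<mu> by (intro mult_left_mono) auto
  moreover have "0 \<le> \<mu> * (u x / (u x + \<epsilon>)) powr (p - 1)" using \<mu> by simp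
  ultimately have c: "\<bar>hardy_const (real DIM('a)) p \<gamma> - \<mu> * (u x / (u x + \<epsilon>)) powr (p - 1)\<bar>
      \<le> \<bar>hardy_const (real DIM('a)) p \<gamma>\<bar> + \<mu>" by linarith
  have "w \<gamma> x powr p = (k * r powr \<gamma>) powr p * norm x powr (- (\<gamma> * p))"
    unfolding barrier_fun_def using k r x0 by (simp add: powr_mult powr_powr)
  moreover have "norm x powr (- p) * norm x powr (- (\<gamma> * p)) = norm x powr (- (p + \<gamma> * p))"
    by (subst powr_add[symmetric]) simp
  ultimately have e: "norm x powr (- p) * w \<gamma> x powr p = (k * r powr \<gamma>) powr p * norm x powr (- (p + \<gamma> * p))"
    by (simp add: mult_ac)
  have "norm (gap \<gamma> \<epsilon> x) = (norm x powr (- p) * w \<gamma> x powr p) * profile (w \<gamma> x / (u x + \<epsilon>))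
    * \<bar>hardy_const (real DIM('a)) p \<gamma> - \<mu> * (u x / (u x + \<epsilon>)) powr (p - 1)\<bar>"
    unfolding gap_def by (simp add: abs_mult profile_nonneg)
  also have "\<dots> \<le> (norm x powr (- p) * w \<gamma> x powr p) * 1 * (\<bar>hardy_const (real DIM('a)) p \<gamma>\<bar> + \<mu>)"
    using c profile_le_1 profile_nonneg by (intro mult_mono mult_left_mono mult_nonneg_nonneg) auto
  also have "\<dots> = gap_bound \<gamma> x" using norm_ge[OF elim(1)] unfolding e gap_bound_def by simp
  finally show ?case .
qed

lemma gap_integrable:
  assumes "\<gamma> > (real DIM('a) - p) / p" "\<epsilon> > 0"
  shows "integrable (lebesgue_on \<Omega>) (gap \<gamma> \<epsilon>)"
proof (rule Bochner_Integration.integrable_bound[OF gap_bound_integrable[OF assms(1)] gap_measurable])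
  show "AE x in lebesgue_on \<Omega>. norm (gap \<gamma> \<epsilon> x) \<le> norm (gap_bound \<gamma> x)"
    using gap_le_bound[OF assms(2), of \<gamma>] by eventually_elim simp
qed

lemma gap_integral_nonneg:
  assumes gt: "\<gamma> > (real DIM('a) - p) / p" and e: "\<epsilon> > 0"
  shows "0 \<le> (LINT x|lebesgue_on \<Omega>. gap \<gamma> \<epsilon> x)"
proof -
  have "0 < (real DIM('a) - p) / p" using p by simp
  then have \<gamma>0: "\<gamma> > 0" using gt by linarith
  obtain Y Y' B where Y: "\<And>j. Ck_on j UNIV Y" "\<And>s. (Y has_field_derivative Y' s) (at s)"
    "continuous_on UNIV Y'" "\<And>s. 0 \<le> Y s" "\<And>s. Y s \<le> 2 / \<epsilon>" "\<And>s. \<bar>Y' s\<bar> \<le> B"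
    "\<And>s. s \<le> k \<Longrightarrow> Y s = 1 / (k + \<epsilon> - s)" "\<And>s. s \<le> k \<Longrightarrow> Y' s = 1 / (k + \<epsilon> - s)\<^sup>2"
    using smooth_reciprocal[OF e, of k] by metis
  \<comment> \<open>The radius at which the barrier has decayed to
    \<open>\<epsilon> / 2\<close>.\<close>
  define R where "R = r * (2 * k / \<epsilon>) powr (1 / \<gamma>)"
  have R0: "R > 0" using r k e by (simp add: R_def)
  have R: "k * r powr \<gamma> * norm x powr (- \<gamma>) \<le> \<epsilon> / 2" if "norm x \<ge> R" for x :: 'a
  proof -
    have "norm x powr (- \<gamma>) \<le> R powr (- \<gamma>)" using that R0 \<gamma>0 by (intro powr_mono2') auto
    also have "R powr (- \<gamma>) = r powr (- \<gamma>) * (2 * k / \<epsilon>) powr (- 1)"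
      unfolding R_def using r k e \<gamma>0 by (simp add: powr_mult powr_powr)
    also have "(2 * k / \<epsilon>) powr (- 1) = \<epsilon> / (2 * k)" using k e by (simp add: powr_minus)
    finally have "k * r powr \<gamma> * norm x powr (- \<gamma>) \<le> k * r powr \<gamma> * (r powr (- \<gamma>) * (\<epsilon> / (2 * k)))"
      using k by (intro mult_left_mono) auto
    also have "\<dots> = (r powr \<gamma> * r powr (- \<gamma>)) * (\<epsilon> / 2)" using k by simp
    also have "r powr \<gamma> * r powr (- \<gamma>) = 1" using r by (simp add: powr_minus)
    finally show ?thesis by simp
  qed
  interpret barrier \<Omega> p k \<epsilon> r \<gamma> R B Y Y'
    by unfold_locales (use open_\<Omega> r norm_ge p k e \<gamma>0 Y R in auto)
  obtain \<eta> :: "'a \<Rightarrow> real" where \<eta>: "\<eta> \<in> C0_infinity UNIV" "\<And>x. 0 \<le> \<eta> x" "\<And>x. \<eta> x \<le> 1"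
    "\<And>x. norm x \<le> R \<Longrightarrow> \<eta> x = 1" using cutoff_exists[OF R0] by metis
  \<comment> \<open>Since \<open>\<eta>\<close> is 1 up to radius \<open>R\<close>, the cutoff
    changes \<open>(k - u)\<^sup>+\<close> only where the test functions vanish anyway; it is what
    lets \<open>boundary_ge\<close> supply the approximating test functions.\<close>
  define v where "v x = \<eta> x * max (k - u x) 0" for x
  define G' where "G' = weak_gradient \<Omega> v"
  have vW: "v \<in> W01p p \<Omega>" using bdry \<eta>(1) unfolding boundary_ge_def v_def by blast
  have vL: "v \<in> Lspace p \<Omega>" and G'L: "G' \<in> Lspace p \<Omega>" and wd: "weakly_differentiable \<Omega> v"
    using vW by (auto simp: W01p_def G'_def)
  have vG': "has_weak_gradient \<Omega> v G'"
    using wd someI_ex[of "\<lambda>G. has_weak_gradient \<Omega> v G"] unfolding weakly_differentiable_def G'_def weak_gradient_def by blast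
  obtain \<phi> where phi: "\<And>n. \<phi> n \<in> C0_infinity \<Omega>"
    and l1: "(\<lambda>n. LINT x|lebesgue_on \<Omega>. \<bar>\<phi> n x - v x\<bar> powr p) \<longlonglongrightarrow> 0"
    and l2: "(\<lambda>n. LINT x|lebesgue_on \<Omega>. norm (gradient (\<phi> n) x - G' x) powr p) \<longlonglongrightarrow> 0"
    using vW unfolding W01p_def G'_def by blast
  have vm: "v \<in> borel_measurable (lebesgue_on \<Omega>)" and vi: "integrable (lebesgue_on \<Omega>) (\<lambda>x. norm (v x) powr p)"
    using vL by (auto simp: Lspace_def)
  have G'm: "G' \<in> borel_measurable (lebesgue_on \<Omega>)" and G'i: "integrable (lebesgue_on \<Omega>) (\<lambda>x. norm (G' x) powr p)"
    using G'L by (auto simp: Lspace_def)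
  have p0: "p > 0" using p by simp
  have i1: "integrable (lebesgue_on \<Omega>) (\<lambda>x. \<bar>\<phi> n x - v x\<bar> powr p)" for n
    using integrable_powr_diff[OF borel_measurable_lebesgue_on[OF C0_infinity_borel[OF phi]] vm _
        C0_infinity_integrable_powr(1)[OF phi \<Omega>_sets p0] vi] p0 by simp
  have i2: "integrable (lebesgue_on \<Omega>) (\<lambda>x. norm (gradient (\<phi> n) x - G' x) powr p)" for n
    using integrable_powr_diff[OF borel_measurable_lebesgue_on[OF C0_infinity_gradient_borel[OF phi]] G'm _
        C0_infinity_integrable_powr(2)[OF phi \<Omega>_sets p0] G'i] p0 by simp
  define F where "F n x = \<bar>\<phi> n x - v x\<bar> powr p + norm (gradient (\<phi> n) x - G' x) powr p" for n x
  have Fi: "integrable (lebesgue_on \<Omega>) (F n)" for n unfolding F_def by (intro Bochner_Integration.integrable_add i1 i2)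
  have "(\<lambda>n. (LINT x|lebesgue_on \<Omega>. \<bar>\<phi> n x - v x\<bar> powr p) + (LINT x|lebesgue_on \<Omega>. norm (gradient (\<phi> n) x - G' x) powr p)) \<longlonglongrightarrow> 0"
    using tendsto_add[OF l1 l2] by simp
  then have Flim: "(\<lambda>n. LINT x|lebesgue_on \<Omega>. F n x) \<longlonglongrightarrow> 0"
    unfolding F_def using i1 i2 by simp
  have Fnn: "F n x \<ge> 0" for n x by (simp add: F_def)
  \<comment> \<open>\<open>W01p\<close> provides convergence of integrals only, whereas the
    nonlinear test functions need pointwise convergence and a majorant.\<close>
  obtain s g where g: "integrable (lebesgue_on \<Omega>) g" "AE x in lebesgue_on \<Omega>. \<forall>n. F (s n) x \<le> g x"
    "AE x in lebesgue_on \<Omega>. (\<lambda>n. F (s n) x) \<longlonglongrightarrow> 0"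
    by (rule dominated_subsequence[OF Fi Fnn Flim])
  have v_eq: "v x = max (k - u x) 0" if "x \<in> \<Omega>" "norm x < R" for x using \<eta>(4)[of x] that by (simp add: v_def)
  have v_le: "AE x in lebesgue_on \<Omega>. v x \<le> k"
    using u0
  proof eventually_elim
    case (elim x)
    have "v x \<le> 1 * max (k - u x) 0" unfolding v_def using \<eta>(3) by (intro mult_right_mono) auto
    then show ?case using elim k by simp
  qed
  have ex: "excess \<mu> u = gap \<gamma> \<epsilon>" by (simp add: fun_eq_iff excess_def gap_def W_def barrier_fun_def)
  have "0 \<le> (LINT x|lebesgue_on \<Omega>. excess \<mu> u x)"
  proof (rule excess_integral_nonneg[OF \<mu> q u G u0 super phi vm G'L g(1) _ _ v_le v_eq])
    show "AE x in lebesgue_on \<Omega>. norm x < R \<longrightarrow> u x < k \<longrightarrow> G' x = - G x"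
      by (rule weak_gradient_truncation[OF open_\<Omega> uG vG' v_eq])
    show "integrable (lebesgue_on \<Omega>) (excess \<mu> u)" unfolding ex by (rule gap_integrable[OF gt e])
    show "AE x in lebesgue_on \<Omega>. \<forall>n. \<bar>\<phi> (s n) x - v x\<bar> powr p + norm (gradient (\<phi> (s n)) x - G' x) powr p \<le> g x"
      using g(2) by (simp add: F_def)
    show "AE x in lebesgue_on \<Omega>. (\<lambda>n. \<bar>\<phi> (s n) x - v x\<bar> powr p + norm (gradient (\<phi> (s n)) x - G' x) powr p) \<longlonglongrightarrow> 0"
      using g(3) by (simp add: F_def)
  qed
  then show ?thesis unfolding ex .
qed

text \<open>The potential term of \<open>u\<close> only helps here: the last factor of
  \<open>gap\<close> is negative for every \<open>\<epsilon>\<close>, whatever \<open>u\<close> is.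
  A nonpositive function with nonnegative integral vanishes almost everywhere, so
  \<open>profile\<close> does, that is \<open>w \<le> u + \<epsilon>\<close>.\<close>

lemma barrier_le_if_neg:
  assumes \<gamma>: "\<gamma> > (real DIM('a) - p) / p" and neg: "hardy_const (real DIM('a)) p \<gamma> < 0"
  shows "AE x in lebesgue_on \<Omega>. w \<gamma> x \<le> u x"
proof -
  have "AE x in lebesgue_on \<Omega>. w \<gamma> x \<le> u x + \<epsilon>" if e: "\<epsilon> > 0" for \<epsilon>
  proof -
    have fac: "hardy_const (real DIM('a)) p \<gamma> - \<mu> * (u x / (u x + \<epsilon>)) powr (p - 1) < 0" for x
      using neg mult_nonneg_nonneg[OF \<mu> powr_ge_zero, of "u x / (u x + \<epsilon>)" "p - 1"] by linarith
    have "AE x in lebesgue_on \<Omega>. gap \<gamma> \<epsilon> x = 0"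
    proof (rule AE_eq_0_if_nonpos[OF gap_integrable[OF \<gamma> e] gap_integral_nonneg[OF \<gamma> e]], rule AE_I2)
      fix x show "gap \<gamma> \<epsilon> x \<le> 0" unfolding gap_def
        using fac[of x] profile_nonneg by (intro mult_nonneg_nonpos mult_nonneg_nonneg) auto
    qed
    then show ?thesis using in_\<Omega> u0
    proof eventually_elim
      case (elim x)
      have "norm x > 0" using norm_ge[OF elim(2)] r by linarith
      then have "profile (w \<gamma> x / (u x + \<epsilon>)) = 0"
        using elim(1) fac[of x] w_pos[OF elim(2), of \<gamma>] by (simp add: gap_def)
      then show ?case using elim(3) e by (intro le_if_profile_eq_0) auto
    qed
  qed
  then have "AE x in lebesgue_on \<Omega>. \<forall>n. w \<gamma> x \<le> u x + 1 / real (Suc n)"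
    by (subst AE_all_countable) simp
  then show ?thesis
  proof eventually_elim
    case (elim x)
    have "(\<lambda>n. u x + 1 / real (Suc n)) \<longlonglongrightarrow> u x + 0"
      by (intro tendsto_intros LIMSEQ_Suc[OF lim_1_over_n])
    then show ?case using elim by (intro LIMSEQ_le_const) auto
  qed
qed

text \<open>For fixed \<open>\<epsilon>\<close> the last factor of \<open>gap\<close> may be
  positive where \<open>u\<close> is small compared with \<open>\<epsilon>\<close>. So the limit is
  taken first: where \<open>u > 0\<close> that factor tends to \<open>hardy_const - \<mu>\<close>,
  which is negative, and the sign argument is applied to the limit \<open>J\<close>.\<close>

lemma barrier_le_if_pos:
  assumes \<gamma>: "\<gamma> > (real DIM('a) - p) / p" and less: "hardy_const (real DIM('a)) p \<gamma> < \<mu>"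
    and pos: "AE x in lebesgue_on \<Omega>. u x > 0"
  shows "AE x in lebesgue_on \<Omega>. w \<gamma> x \<le> u x"
proof -
  define e where "e n = 1 / real (Suc n)" for n
  have e0: "e n > 0" for n by (simp add: e_def)
  have elim0: "e \<longlonglongrightarrow> 0" unfolding e_def by (rule LIMSEQ_Suc[OF lim_1_over_n])
  define J where "J x = norm x powr (- p) * w \<gamma> x powr p * profile (w \<gamma> x / u x) * (hardy_const (real DIM('a)) p \<gamma> - \<mu>)" for x
  have conv: "AE x in lebesgue_on \<Omega>. (\<lambda>n. gap \<gamma> (e n) x) \<longlonglongrightarrow> J x"
    using pos
  proof eventually_elim
    case (elim x)
    have 1: "(\<lambda>n. u x + e n) \<longlonglongrightarrow> u x + 0" by (intro tendsto_intros elim0)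
    have 2: "(\<lambda>n. w \<gamma> x / (u x + e n)) \<longlonglongrightarrow> w \<gamma> x / (u x + 0)" using elim by (intro tendsto_intros 1) auto
    have 3: "(\<lambda>n. profile (w \<gamma> x / (u x + e n))) \<longlonglongrightarrow> profile (w \<gamma> x / (u x + 0))"
      using profile_smooth[of 0] by (intro continuous_on_tendsto_compose[OF _ 2, of UNIV]) auto
    have 4: "(\<lambda>n. (u x / (u x + e n)) powr (p - 1)) \<longlonglongrightarrow> (u x / (u x + 0)) powr (p - 1)"
      using elim by (intro tendsto_intros 1) auto
    have "(\<lambda>n. gap \<gamma> (e n) x) \<longlonglongrightarrow> norm x powr (- p) * w \<gamma> x powr p * profile (w \<gamma> x / (u x + 0))
      * (hardy_const (real DIM('a)) p \<gamma> - \<mu> * (u x / (u x + 0)) powr (p - 1))"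
      unfolding gap_def by (intro tendsto_intros 3 4)
    then show ?case using elim by (simp add: J_def)
  qed
  have [measurable]: "J \<in> borel_measurable (lebesgue_on \<Omega>)"
  proof -
    note [measurable] = borel_measurable_lebesgue_on_id[of \<Omega>]
    have [measurable]: "u \<in> borel_measurable (lebesgue_on \<Omega>)" using u by (simp add: Lspace_def)
    have [measurable]: "profile \<in> borel_measurable borel"
      using profile_smooth[of 0] by (simp add: borel_measurable_continuous_onI)
    show ?thesis unfolding J_def barrier_fun_def by measurable
  qed
  have Ji: "integrable (lebesgue_on \<Omega>) J"
    by (rule integrable_dominated_convergence[OF _ gap_measurable gap_bound_integrable[OF \<gamma>] conv gap_le_bound[OF e0]]) measurable
  have "(\<lambda>n. LINT x|lebesgue_on \<Omega>. gap \<gamma> (e n) x) \<longlonglongrightarrow> (LINT x|lebesgue_on \<Omega>. J x)"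
    by (rule integral_dominated_convergence[OF _ gap_measurable gap_bound_integrable[OF \<gamma>] conv gap_le_bound[OF e0]]) measurable
  then have J0: "0 \<le> (LINT x|lebesgue_on \<Omega>. J x)"
    using gap_integral_nonneg[OF \<gamma> e0] by (intro LIMSEQ_le_const) auto
  have "AE x in lebesgue_on \<Omega>. J x = 0"
  proof (rule AE_eq_0_if_nonpos[OF Ji J0], rule AE_I2)
    fix x show "J x \<le> 0" unfolding J_def
      using less profile_nonneg by (intro mult_nonneg_nonpos mult_nonneg_nonneg) auto
  qed
  then show ?thesis using in_\<Omega> pos
  proof eventually_elim
    case (elim x)
    have "norm x > 0" using norm_ge[OF elim(2)] r by linarith
    then have "profile (w \<gamma> x / u x) = 0"
      using elim(1) less w_pos[OF elim(2), of \<gamma>] by (simp add: J_def)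
    then show ?case using elim(3) by (intro le_if_profile_eq_0) auto
  qed
qed

text \<open>A barrier with negative \<open>hardy_const\<close> works even where \<open>u = 0\<close>; the positivity it yields is what
  the passage \<open>\<epsilon> \<rightarrow> 0\<close> in \<open>barrier_le_if_pos\<close> needs when \<open>\<mu> > 0\<close>.\<close>

lemma u_pos: "AE x in lebesgue_on \<Omega>. u x > 0"
proof -
  \<comment> \<open>Any exponent beyond \<open>(N - p) / (p - 1)\<close> would do.\<close>
  define \<gamma> where "\<gamma> = (real DIM('a) - p) / (p - 1) + 1"
  have "(real DIM('a) - p) / p \<le> (real DIM('a) - p) / (p - 1)" using p by (intro divide_left_mono) auto
  then have 1: "\<gamma> > (real DIM('a) - p) / p" by (simp add: \<gamma>_def)
  have 2: "hardy_const (real DIM('a)) p \<gamma> < 0" using p by (intro hardy_const_neg) (auto simp: \<gamma>_def)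
  from barrier_le_if_neg[OF 1 2] in_\<Omega> show ?thesis
    by eventually_elim (rule less_le_trans[OF w_pos])
qed

text \<open>Exponents above the root \<open>\<gamma>2\<close> give strict subsolutions; then let \<open>\<gamma> \<rightarrow> \<gamma>2\<close>.\<close>

lemma lower_bound:
  assumes "(real DIM('a) - p) / p < \<gamma>2" "hardy_const (real DIM('a)) p \<gamma>2 = \<mu>"
  shows "AE x in lebesgue_on \<Omega>. k * r powr \<gamma>2 * norm x powr (- \<gamma>2) \<le> u x"
proof -
  have "AE x in lebesgue_on \<Omega>. w (\<gamma>2 + 1 / real (Suc n)) x \<le> u x" for n
  proof (rule barrier_le_if_pos[OF _ _ u_pos])
    have "1 / real (Suc n) > 0" by simp
    then show "(real DIM('a) - p) / p < \<gamma>2 + 1 / real (Suc n)" using assms(1) by linarith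
    show "hardy_const (real DIM('a)) p (\<gamma>2 + 1 / real (Suc n)) < \<mu>"
      using hardy_const_decreasing[OF p, of \<gamma>2 "\<gamma>2 + 1 / real (Suc n)"] assms by simp
  qed
  then have "AE x in lebesgue_on \<Omega>. \<forall>n. w (\<gamma>2 + 1 / real (Suc n)) x \<le> u x"
    by (subst AE_all_countable) simp
  then show ?thesis using in_\<Omega>
  proof eventually_elim
    case (elim x)
    have x0: "norm x \<noteq> 0" using norm_ge[OF elim(2)] r by linarith
    have g: "(\<lambda>n. \<gamma>2 + 1 / real (Suc n)) \<longlonglongrightarrow> \<gamma>2 + 0"
      by (intro tendsto_intros LIMSEQ_Suc[OF lim_1_over_n])
    have "(\<lambda>n. w (\<gamma>2 + 1 / real (Suc n)) x) \<longlonglongrightarrow> k * r powr (\<gamma>2 + 0) * norm x powr (- (\<gamma>2 + 0))"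
      unfolding barrier_fun_def using x0 r by (intro tendsto_intros g) auto
    then have "k * r powr (\<gamma>2 + 0) * norm x powr (- (\<gamma>2 + 0)) \<le> u x"
      using elim(1) by (intro LIMSEQ_le_const2) auto
    then show ?case by simp
  qed
qed

end

text \<open>Undoes the sign change in the definition of a supersolution and drops the term with
  \<open>f\<close>, which has a favourable sign. The exponent \<open>q\<close> is the Sobolev
  conjugate, which is at least \<open>p\<close>.\<close>

lemma supersolution_data:
  fixes \<Omega> :: "'a::euclidean_space set"
  assumes p: "1 < p" "p < real DIM('a)"
    and f: "AE x in lebesgue_on \<Omega>. f x \<ge> 0" and u0: "AE x in lebesgue_on \<Omega>. u x \<ge> 0"
    and super: "weak_supersolution p \<mu> f \<Omega> u"
  obtains q G where "p - 1 \<le> q" "u \<in> Lspace q \<Omega>" "G \<in> Lspace p \<Omega>" "has_weak_gradient \<Omega> u G"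
    "\<forall>\<phi>\<in>C0_infinity \<Omega>. (\<forall>x. \<phi> x \<ge> 0) \<longrightarrow>
      0 \<le> (LINT x|lebesgue_on \<Omega>. norm (G x) powr (p - 2) * (G x \<bullet> gradient \<phi> x)
          - \<mu> / norm x powr p * (\<bar>u x\<bar> powr (p - 2) * u x * \<phi> x))"
proof -
  define q where "q = sobolev_conjugate TYPE('a) p"
  define H where "H = weak_gradient \<Omega> (\<lambda>x. - u x)"
  define G where "G x = - H x" for x
  have sub: "weak_subsolution p \<mu> f \<Omega> (\<lambda>x. - u x)" using super by (simp add: weak_supersolution_def)
  then have D: "(\<lambda>x. - u x) \<in> D1p p \<Omega>" by (simp add: weak_subsolution_def)
  show ?thesis
  proof (rule that[of q G])
    have "p * (real DIM('a) - p) \<le> real DIM('a) * p" using p by (simp add: algebra_simps)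
    then have "p \<le> q" using p by (simp add: q_def sobolev_conjugate_def le_divide_eq)
    then show "p - 1 \<le> q" by simp
    have mu: "(\<lambda>x. - u x) \<in> borel_measurable (lebesgue_on \<Omega>)"
      and "integrable (lebesgue_on \<Omega>) (\<lambda>x. norm (- u x) powr q)"
      using D by (auto simp: D1p_def Lspace_def q_def)
    moreover have "u \<in> borel_measurable (lebesgue_on \<Omega>)" using borel_measurable_uminus[OF mu] by simp
    ultimately show "u \<in> Lspace q \<Omega>" by (simp add: Lspace_def)
    have "H \<in> Lspace p \<Omega>" using D by (simp add: D1p_def H_def)
    then show "G \<in> Lspace p \<Omega>" by (auto simp: Lspace_def G_def[abs_def])
    have "has_weak_gradient \<Omega> (\<lambda>x. - u x) H"
      using D someI_ex[of "has_weak_gradient \<Omega> (\<lambda>x. - u x)"]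
      by (auto simp: D1p_def weakly_differentiable_def H_def weak_gradient_def)
    then have li: "locally_integrable \<Omega> (\<lambda>x. - u x)" "locally_integrable \<Omega> H"
      and w: "\<And>\<phi> i. \<phi> \<in> C0_infinity \<Omega> \<Longrightarrow> i \<in> Basis \<Longrightarrow>
        (LINT x|lebesgue_on \<Omega>. - u x * (gradient \<phi> x \<bullet> i)) = - (LINT x|lebesgue_on \<Omega>. (H x \<bullet> i) * \<phi> x)"
      by (auto simp: has_weak_gradient_def)
    show "has_weak_gradient \<Omega> u G"
      unfolding has_weak_gradient_def
    proof (intro conjI ballI)
      show "locally_integrable \<Omega> u" using li(1) by (simp add: locally_integrable_def set_integrable_def)
      show "locally_integrable \<Omega> G" using li(2) by (simp add: locally_integrable_def set_integrable_def G_def[abs_def])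
      show "(LINT x|lebesgue_on \<Omega>. u x * (gradient \<phi> x \<bullet> i)) = - (LINT x|lebesgue_on \<Omega>. (G x \<bullet> i) * \<phi> x)"
        if "\<phi> \<in> C0_infinity \<Omega>" "i \<in> Basis" for \<phi> i
        using w[OF that] by (simp add: G_def)
    qed
  next
    have "0 \<le> (LINT x|lebesgue_on \<Omega>. norm (G x) powr (p - 2) * (G x \<bullet> gradient \<phi> x)
          - \<mu> / norm x powr p * (\<bar>u x\<bar> powr (p - 2) * u x * \<phi> x))"
      if phi: "\<phi> \<in> C0_infinity \<Omega>" "\<forall>x. \<phi> x \<ge> 0" for \<phi>
    proof -
    have "(LINT x|lebesgue_on \<Omega>. norm (H x) powr (p - 2) * (H x \<bullet> gradient \<phi> x)
          - \<mu> / norm x powr p * (\<bar>- u x\<bar> powr (p - 2) * - u x * \<phi> x))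
       \<le> (LINT x|lebesgue_on \<Omega>. f x * (\<bar>- u x\<bar> powr (p - 2) * - u x * \<phi> x))"
      using sub phi unfolding weak_subsolution_def H_def by blast
    also have "\<dots> = - (LINT x|lebesgue_on \<Omega>. f x * (\<bar>u x\<bar> powr (p - 2) * u x * \<phi> x))" by simp
    also have "\<dots> \<le> 0"
    proof -
      \<comment> \<open>Only the sign of the integrand is used, so the case of a non-integrable
        product, whose integral is 0 by convention, needs no separate treatment.\<close>
      have "AE x in lebesgue_on \<Omega>. 0 \<le> f x * (\<bar>u x\<bar> powr (p - 2) * u x * \<phi> x)"
        using f u0 by eventually_elim (simp add: phi(2))
      from integral_nonneg_AE[OF this] show ?thesis by simp
    qed
    finally have "(LINT x|lebesgue_on \<Omega>. norm (H x) powr (p - 2) * (H x \<bullet> gradient \<phi> x)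
          - \<mu> / norm x powr p * (\<bar>- u x\<bar> powr (p - 2) * - u x * \<phi> x)) \<le> 0" .
    moreover have "(LINT x|lebesgue_on \<Omega>. norm (H x) powr (p - 2) * (H x \<bullet> gradient \<phi> x)
          - \<mu> / norm x powr p * (\<bar>- u x\<bar> powr (p - 2) * - u x * \<phi> x))
        = (LINT x|lebesgue_on \<Omega>. - (norm (G x) powr (p - 2) * (G x \<bullet> gradient \<phi> x)
          - \<mu> / norm x powr p * (\<bar>u x\<bar> powr (p - 2) * u x * \<phi> x)))"
      by (intro Bochner_Integration.integral_cong refl) (simp add: G_def)
    ultimately show ?thesis by (simp only: Bochner_Integration.integral_minus)
    qed
    then show "\<forall>\<phi>\<in>C0_infinity \<Omega>. (\<forall>x. \<phi> x \<ge> 0) \<longrightarrow>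
      0 \<le> (LINT x|lebesgue_on \<Omega>. norm (G x) powr (p - 2) * (G x \<bullet> gradient \<phi> x)
          - \<mu> / norm x powr p * (\<bar>u x\<bar> powr (p - 2) * u x * \<phi> x))" by blast
  qed
qed

theorem theorem1p6:
  fixes \<Omega> :: "'a::euclidean_space set"
    and f u :: "'a \<Rightarrow> real"
    and p \<mu> \<gamma>1 \<gamma>2 :: real
  assumes "1 < p" "p < real DIM('a)"
    and "0 \<le> \<mu>" "\<mu> < ((real DIM('a) - p) / p) powr p"
    and "hardy_root TYPE('a) p \<mu> \<gamma>1" "hardy_root TYPE('a) p \<mu> \<gamma>2" "\<gamma>1 < \<gamma>2"
    and "exterior_domain \<Omega>" "0 \<notin> \<Omega>"
    and "f \<in> Lspace (real DIM('a) / p) \<Omega>" "AE x in lebesgue_on \<Omega>. f x \<ge> 0"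
    and "AE x in lebesgue_on \<Omega>. u x \<ge> 0"
    and "weak_supersolution p \<mu> f \<Omega> u"
  shows "AE x in lebesgue_on \<Omega>.
    ereal (u x) \<ge>
      ereal (INF y\<in>frontier \<Omega>. norm y powr \<gamma>2) * boundary_inf p \<Omega> u * ereal (norm x powr (- \<gamma>2))"
proof (cases "\<Omega> = {}")
  case True
  then show ?thesis by (intro AE_I2) (simp add: space_restrict_space)
next
  case False
  note p = assms(1,2) and \<mu> = assms(3) and u0 = assms(12)
  have \<gamma>: "0 \<le> \<gamma>1" "hardy_const (real DIM('a)) p \<gamma>1 = \<mu>" "hardy_const (real DIM('a)) p \<gamma>2 = \<mu>"
    using assms(5,6) by (simp_all add: hardy_root_iff)
  have \<gamma>2: "(real DIM('a) - p) / p < \<gamma>2" using hardy_roots[OF p \<gamma>(1) assms(7)] \<gamma>(2,3) by simp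
  have \<gamma>2_pos: "\<gamma>2 > 0" using \<gamma>(1) assms(7) by linarith
  have op: "open \<Omega>" and bd: "bounded (- \<Omega>)" using assms(8) by (auto simp: exterior_domain_def)
  have "compact (frontier \<Omega>)"
    using compact_frontier_bounded[OF bd] by (simp add: frontier_complement)
  \<comment> \<open>\<open>\<Omega>\<close> is neither empty nor the whole space, as it misses the
    origin.\<close>
  moreover have "frontier \<Omega> \<noteq> {}" using False assms(9) by (auto simp: frontier_eq_empty)
  ultimately obtain y0 where y0: "y0 \<in> frontier \<Omega>" "\<And>y. y \<in> frontier \<Omega> \<Longrightarrow> norm y0 \<le> norm y"
    using continuous_attains_inf[of "frontier \<Omega>" norm] by (auto intro: continuous_on_norm_id)
  define r where "r = norm y0"
  have C: "(INF y\<in>frontier \<Omega>. norm y powr \<gamma>2) = r powr \<gamma>2"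
    unfolding r_def using y0 \<gamma>2_pos by (intro cInf_eq_minimum) (auto intro!: powr_mono2)
  show ?thesis
  proof (cases "r = 0")
    case True
    \<comment> \<open>If the origin lies on the frontier, the constant is
      \<open>0 powr \<gamma>2 = 0\<close>. The extended real product is then 0 even for an infinite
      \<open>boundary_inf\<close>, and the claim is \<open>u \<ge> 0\<close>.\<close>
    then show ?thesis using u0 unfolding C by (simp add: zero_ereal_def[symmetric])
  next
    case r0: False
    then have r: "r > 0" by (simp add: r_def)
    \<comment> \<open>The ball of radius \<open>r\<close> is connected, contains the origin, which
      is outside \<open>\<Omega>\<close>, and misses the frontier; so it misses
      \<open>\<Omega>\<close>.\<close>
    have norm_ge: "r \<le> norm x" if x: "x \<in> \<Omega>" for x
    proof (rule ccontr)
      assume "\<not> r \<le> norm x"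
      then have "x \<in> ball 0 r \<inter> \<Omega>" "0 \<in> ball 0 r - \<Omega>" using x r assms(9) by auto
      then have "ball 0 r \<inter> frontier \<Omega> \<noteq> {}" by (intro connected_Int_frontier connected_ball; blast)
      then show False using y0(2) by (force simp: r_def)
    qed
    obtain q G where qG: "p - 1 \<le> q" "u \<in> Lspace q \<Omega>" "G \<in> Lspace p \<Omega>" "has_weak_gradient \<Omega> u G"
      "\<forall>\<phi>\<in>C0_infinity \<Omega>. (\<forall>x. \<phi> x \<ge> 0) \<longrightarrow>
        0 \<le> (LINT x|lebesgue_on \<Omega>. norm (G x) powr (p - 2) * (G x \<bullet> gradient \<phi> x)
          - \<mu> / norm x powr p * (\<bar>u x\<bar> powr (p - 2) * u x * \<phi> x))"
      using supersolution_data[OF p assms(11) u0 assms(13)] by blast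
    have bound: "AE x in lebesgue_on \<Omega>. k * r powr \<gamma>2 * norm x powr (- \<gamma>2) \<le> u x" if k: "boundary_ge p \<Omega> u k" for k
    proof (cases "k > 0")
      case True
      interpret hardy_supersolution \<Omega> p \<mu> q r k u G
        by unfold_locales (use op r norm_ge p \<mu> True qG u0 k in auto)
      show ?thesis by (rule lower_bound[OF \<gamma>2 \<gamma>(3)])
    next
      case False
      have "k * r powr \<gamma>2 * norm x powr (- \<gamma>2) \<le> 0" for x
        using False by (intro mult_nonpos_nonneg) auto
      then show ?thesis using u0 by (auto elim!: eventually_mono intro: order_trans)
    qed
    have "AE x in lebesgue_on \<Omega>. boundary_inf p \<Omega> u \<le> ereal (u x / (r powr \<gamma>2 * norm x powr (- \<gamma>2)))"
    proof (cases "{ereal k |k. boundary_ge p \<Omega> u k} = {}")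
      case True
      then show ?thesis unfolding boundary_inf_def by (simp only: Sup_empty) (simp add: bot_ereal_def)
    next
      case False
      \<comment> \<open>The exceptional null set depends on \<open>k\<close>, and there may be
        uncountably many admissible \<open>k\<close>; a sequence with the same supremum keeps the
        union of these sets null.\<close>
      from Sup_countable_SUP[OF False]
      obtain e :: "nat \<Rightarrow> ereal" where e: "range e \<subseteq> {ereal k |k. boundary_ge p \<Omega> u k}"
        "Sup {ereal k |k. boundary_ge p \<Omega> u k} = Sup (range e)"
        by blast
      have bi: "boundary_inf p \<Omega> u = Sup (range e)" unfolding boundary_inf_def by (rule e(2))
      have "\<exists>k. e n = ereal k \<and> boundary_ge p \<Omega> u k" for n using e(1) by auto
      then obtain \<kappa> where \<kappa>: "\<And>n. e n = ereal (\<kappa> n)" "\<And>n. boundary_ge p \<Omega> u (\<kappa> n)" by metis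
      have "AE x in lebesgue_on \<Omega>. \<forall>n. \<kappa> n * r powr \<gamma>2 * norm x powr (- \<gamma>2) \<le> u x"
        by (subst AE_all_countable) (use bound[OF \<kappa>(2)] in blast)
      moreover have "AE x in lebesgue_on \<Omega>. x \<in> \<Omega>" by (rule AE_I2) (simp add: space_restrict_space)
      ultimately show ?thesis
      proof eventually_elim
        case (elim x)
        have "norm x > 0" using norm_ge[OF elim(2)] r by linarith
        then have pos: "r powr \<gamma>2 * norm x powr (- \<gamma>2) > 0" using r by simp
        show ?case unfolding bi
        proof (rule SUP_least)
          fix n show "e n \<le> ereal (u x / (r powr \<gamma>2 * norm x powr (- \<gamma>2)))"
            using elim(1)[rule_format, of n] pos by (simp add: \<kappa>(1) le_divide_eq mult.assoc)
        qed
      qed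
    qed
    moreover have "AE x in lebesgue_on \<Omega>. x \<in> \<Omega>" by (rule AE_I2) (simp add: space_restrict_space)
    ultimately show ?thesis
    proof eventually_elim
      case (elim x)
      have "norm x > 0" using norm_ge[OF elim(2)] r by linarith
      then have pos: "r powr \<gamma>2 * norm x powr (- \<gamma>2) > 0" using r by simp
      have "ereal (r powr \<gamma>2) * boundary_inf p \<Omega> u * ereal (norm x powr (- \<gamma>2))
        = ereal (r powr \<gamma>2 * norm x powr (- \<gamma>2)) * boundary_inf p \<Omega> u"
        by (simp add: mult_ac flip: times_ereal.simps(1))
      also have "\<dots> \<le> ereal (r powr \<gamma>2 * norm x powr (- \<gamma>2)) * ereal (u x / (r powr \<gamma>2 * norm x powr (- \<gamma>2)))"
        using elim(1) pos by (intro ereal_mult_left_mono) auto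
      also have "\<dots> = ereal (u x)"
        using pos by (simp only: times_ereal.simps(1) times_divide_eq_right nonzero_mult_div_cancel_left[OF less_imp_neq[OF pos, symmetric]])
      finally show ?case unfolding C .
    qed
  qed
qed

end
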